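(* A smooth pluriexact holomorphic foliation by curves on a compact complex manifold admits a (non-trivial) transversal invariant measure.
   Context: Let $\mathcal L$ be a holomorphic foliation by curves on a compact complex manifold $X$, $dd^c=\frac{i}{2\pi}\partial\bar\partial$. A current $T$ of bidimension $(1,1)$ with measure coefficients, written $\langle\phi,T\rangle=\int_X\phi(\hat T_z)\,d\|T\|(z)$, is directed by $\mathcal L$ if $\hat T_z=\frac i2\mathrm v\wedge\bar{\mathrm v}$ with $\mathrm v\in T_z\mathcal L$ for $\|T\|$-almost all $z$. $\mathcal L$ is pluriexact if there is a non-trivial positive current $T$ of bidimension $(1,1)$ directed by $\mathcal L$ with $T=dd^cS$ for some real current $S$ of bidimension $(2,2)$. A transversal invariant measure is a Radon measure on transversals to $\mathcal L$ invariant under the holonomy of $\mathcal L$. *)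

theory Defs
  imports "HOL-Analysis.Analysis" "HOL-Combinatorics.Permutations"
begin

section \<open>Smooth and holomorphic maps between coordinate spaces\<close>

primrec nderiv ::
    "'a list \<Rightarrow> ('a::real_normed_vector \<Rightarrow> 'b::real_normed_vector) \<Rightarrow> 'a \<Rightarrow> 'b" where
  "nderiv [] f = f"
| "nderiv (v # vs) f = (\<lambda>x. frechet_derivative (nderiv vs f) (at x) v)"

text \<open>Class C-infinity in the real sense; used on open sets only.\<close>

definition smooth_on ::
    "'a set \<Rightarrow> ('a::real_normed_vector \<Rightarrow> 'b::real_normed_vector) \<Rightarrow> bool" where
  "smooth_on S f \<longleftrightarrow> (\<forall>vs. \<forall>x\<in>S. nderiv vs f differentiable (at x))"

definition holomorphic_map_on ::
    "(complex^'n) set \<Rightarrow> (complex^'n \<Rightarrow> complex^'n) \<Rightarrow> bool" where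
  "holomorphic_map_on S f \<longleftrightarrow>
     (\<forall>x\<in>S. \<exists>D. (f has_derivative D) (at x) \<and> (\<forall>a v. D (a *s v) = a *s D v))"

section \<open>Complex manifolds\<close>

type_synonym ('a, 'n) chart = "'a set \<times> ('a \<Rightarrow> complex^'n)"

definition is_chart :: "('a::topological_space, 'n::finite) chart \<Rightarrow> bool" where
  "is_chart c \<longleftrightarrow> open (fst c) \<and> open (snd c ` fst c) \<and>
     (\<exists>g. homeomorphism (fst c) (snd c ` fst c) (snd c) g)"

definition trans_map ::
    "('a, 'n::finite) chart \<Rightarrow> ('a, 'n) chart \<Rightarrow> complex^'n \<Rightarrow> complex^'n" where
  "trans_map c c' = snd c' \<circ> inv_into (fst c) (snd c)"

definition dtrans ::
    "('a, 'n::finite) chart \<Rightarrow> ('a, 'n) chart \<Rightarrow> complex^'n \<Rightarrow> complex^'n \<Rightarrow> complex^'n" where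
  "dtrans c c' x = frechet_derivative (trans_map c c') (at x)"

definition compatible :: "('a, 'n::finite) chart \<Rightarrow> ('a, 'n) chart \<Rightarrow> bool" where
  "compatible c c' \<longleftrightarrow>
     holomorphic_map_on (snd c ` (fst c \<inter> fst c')) (trans_map c c') \<and>
     holomorphic_map_on (snd c' ` (fst c \<inter> fst c')) (trans_map c' c)"

text \<open>A complex structure is a maximal holomorphic atlas.\<close>

definition complex_structure :: "('a::topological_space, 'n::finite) chart set \<Rightarrow> bool" where
  "complex_structure A \<longleftrightarrow>
     (\<forall>c\<in>A. is_chart c) \<and> (\<Union>c\<in>A. fst c) = UNIV \<and>
     (\<forall>c\<in>A. \<forall>c'\<in>A. compatible c c') \<and>
     (\<forall>c. is_chart c \<and> (\<forall>c'\<in>A. compatible c c') \<longrightarrow> c \<in> A)"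

text \<open>The tangent space at \<open>p\<close> is identified with the coordinate space by means of one
  preferred chart around \<open>p\<close>; \<open>dtrans\<close> passes to the coordinates of any other chart.\<close>

definition chart_at :: "('a, 'n::finite) chart set \<Rightarrow> 'a \<Rightarrow> ('a, 'n) chart" where
  "chart_at A p = (SOME c. c \<in> A \<and> p \<in> fst c)"

section \<open>Differential forms\<close>

text \<open>The value of \<open>dz\<^sub>I \<and> cnj dz\<^sub>J\<close> on a list of (real) tangent vectors, with the
  normalisation \<open>(\<alpha> \<and> \<beta>)(v, w) = \<alpha> v * \<beta> w - \<alpha> w * \<beta> v\<close>.\<close>

definition wedge_dz ::
    "'n::finite list \<Rightarrow> 'n list \<Rightarrow> (complex^'n) list \<Rightarrow> complex" where
  "wedge_dz I J vs =
     (\<Sum>\<sigma> | \<sigma> permutes {..<length vs}. of_int (sign \<sigma>) *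
        (\<Prod>i<length I. (vs ! \<sigma> i) $ (I ! i)) *
        (\<Prod>j<length J. cnj ((vs ! \<sigma> (length I + j)) $ (J ! j))))"

text \<open>Covectors of bidegree \<open>(p, q)\<close>; they vanish on lists of the wrong length.\<close>

definition covectors :: "nat \<Rightarrow> nat \<Rightarrow> ((complex^'n::finite) list \<Rightarrow> complex) set" where
  "covectors p q = {\<alpha>. \<exists>a. \<forall>vs. \<alpha> vs =
     (if length vs = p + q
      then \<Sum>I | length I = p. \<Sum>J | length J = q. a I J * wedge_dz I J vs else 0)}"

text \<open>At a point \<open>p\<close> of the manifold a form takes tangent vectors written in the chart
  \<open>chart_at A p\<close>. The function \<open>form_in A c \<omega>\<close> is the expression of \<open>\<omega>\<close> in the
  coordinates of the chart \<open>c\<close>.\<close>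

type_synonym ('a, 'n) form = "'a \<Rightarrow> (complex^'n) list \<Rightarrow> complex"

definition form_in ::
    "('a, 'n::finite) chart set \<Rightarrow> ('a, 'n) chart \<Rightarrow> ('a, 'n) form \<Rightarrow>
     (complex^'n, 'n) form" where
  "form_in A c \<omega> x vs =
     (let p = inv_into (fst c) (snd c) x in \<omega> p (map (dtrans c (chart_at A p) x) vs))"

definition forms :: "('a, 'n::finite) chart set \<Rightarrow> nat \<Rightarrow> nat \<Rightarrow> ('a, 'n) form set" where
  "forms A p q = {\<omega>. (\<forall>z. \<omega> z \<in> covectors p q) \<and>
     (\<forall>c\<in>A. \<forall>vs. smooth_on (snd c ` fst c) (\<lambda>x. form_in A c \<omega> x vs))}"

text \<open>Complex linear and antilinear parts of the real differential.\<close>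

definition d10 :: "(complex^'n::finite \<Rightarrow> complex) \<Rightarrow> complex^'n \<Rightarrow> complex^'n \<Rightarrow> complex" where
  "d10 f x v = (frechet_derivative f (at x) v - \<i> * frechet_derivative f (at x) (\<i> *s v)) / 2"

definition d01 :: "(complex^'n::finite \<Rightarrow> complex) \<Rightarrow> complex^'n \<Rightarrow> complex^'n \<Rightarrow> complex" where
  "d01 f x v = (frechet_derivative f (at x) v + \<i> * frechet_derivative f (at x) (\<i> *s v)) / 2"

text \<open>The Dolbeault operators in coordinates: the usual alternating-sum formula for
  the exterior derivative, split into its (1,0)- and (0,1)-parts.\<close>

definition del :: "(complex^'n, 'n::finite) form \<Rightarrow> (complex^'n, 'n) form" where
  "del \<omega> x vs = (\<Sum>i<length vs.
     (-1) ^ i * d10 (\<lambda>y. \<omega> y (take i vs @ drop (Suc i) vs)) x (vs ! i))"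

definition delbar :: "(complex^'n, 'n::finite) form \<Rightarrow> (complex^'n, 'n) form" where
  "delbar \<omega> x vs = (\<Sum>i<length vs.
     (-1) ^ i * d01 (\<lambda>y. \<omega> y (take i vs @ drop (Suc i) vs)) x (vs ! i))"

definition ddc :: "('a, 'n::finite) chart set \<Rightarrow> ('a, 'n) form \<Rightarrow> ('a, 'n) form" where
  "ddc A \<omega> p vs = \<i> / (2 * of_real pi) *
     del (delbar (form_in A (chart_at A p) \<omega>)) (snd (chart_at A p) p) vs"

section \<open>Currents\<close>

definition forms_tendsto_0 ::
    "('a, 'n::finite) chart set \<Rightarrow> (nat \<Rightarrow> ('a, 'n) form) \<Rightarrow> bool" where
  "forms_tendsto_0 A \<omega> \<longleftrightarrow>
     (\<forall>c\<in>A. \<forall>K. compact K \<and> K \<subseteq> snd c ` fst c \<longrightarrow>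
       (\<forall>us vs. uniform_limit K (\<lambda>m. nderiv us (\<lambda>x. form_in A c (\<omega> m) x vs)) (\<lambda>_. 0) sequentially))"

text \<open>Currents of bidimension \<open>(p, q)\<close> on a compact manifold: continuous linear functionals on
  the smooth \<open>(p, q)\<close>-forms. That space is metrizable, so sequential continuity suffices.
  Values outside \<open>forms A p q\<close> are irrelevant.\<close>

type_synonym ('a, 'n) current = "('a, 'n) form \<Rightarrow> complex"

definition currents :: "('a, 'n::finite) chart set \<Rightarrow> nat \<Rightarrow> nat \<Rightarrow> ('a, 'n) current set" where
  "currents A p q = {T.
     (\<forall>\<omega>\<in>forms A p q. \<forall>\<eta>\<in>forms A p q. T (\<lambda>z vs. \<omega> z vs + \<eta> z vs) = T \<omega> + T \<eta>) \<and>
     (\<forall>a. \<forall>\<omega>\<in>forms A p q. T (\<lambda>z vs. a * \<omega> z vs) = a * T \<omega>) \<and>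
     (\<forall>\<omega>. (\<forall>m. \<omega> m \<in> forms A p q) \<and> forms_tendsto_0 A \<omega> \<longrightarrow> (\<lambda>m. T (\<omega> m)) \<longlonglongrightarrow> 0)}"

definition real_current ::
    "('a, 'n::finite) chart set \<Rightarrow> nat \<Rightarrow> ('a, 'n) current \<Rightarrow> bool" where
  "real_current A p S \<longleftrightarrow> (\<forall>\<omega>\<in>forms A p p. S (\<lambda>z vs. cnj (\<omega> z vs)) = cnj (S \<omega>))"

text \<open>Evaluation of a 2-covector on \<open>v \<and> Jv\<close>, the positive (1,1)-vector of the complex line
  spanned by \<open>v\<close>.\<close>

definition bivector ::
    "complex^'n::finite \<Rightarrow> ((complex^'n) list \<Rightarrow> complex) \<Rightarrow> complex" where
  "bivector v \<alpha> = \<alpha> [v, \<i> *s v]"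

definition positive_form :: "('a, 'n::finite) chart set \<Rightarrow> ('a, 'n) form \<Rightarrow> bool" where
  "positive_form A \<omega> \<longleftrightarrow> \<omega> \<in> forms A 1 1 \<and> (\<forall>z v. bivector v (\<omega> z) \<in> \<real>\<^sub>\<ge>\<^sub>0)"

definition positive_current :: "('a, 'n::finite) chart set \<Rightarrow> ('a, 'n) current \<Rightarrow> bool" where
  "positive_current A T \<longleftrightarrow> (\<forall>\<omega>. positive_form A \<omega> \<longrightarrow> T \<omega> \<in> \<real>\<^sub>\<ge>\<^sub>0)"

section \<open>Foliations by curves\<close>

text \<open>The index \<open>k\<close> is that of the leaf coordinate; all other coordinates are transverse.\<close>

definition same_transverse :: "'n \<Rightarrow> complex^'n::finite \<Rightarrow> complex^'n \<Rightarrow> bool" where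
  "same_transverse k x y \<longleftrightarrow> (\<forall>j. j \<noteq> k \<longrightarrow> x $ j = y $ j)"

text \<open>A non-singular holomorphic foliation by curves is given by a covering by holomorphic flow
  boxes (onto the unit polydisc, so that plaques are connected) whose changes of coordinates are
  locally of the form \<open>(z, t) \<mapsto> (f (z, t), g t)\<close>.\<close>

definition foliation ::
    "('a, 'n::finite) chart set \<Rightarrow> 'n \<Rightarrow> ('a, 'n) chart set \<Rightarrow> bool" where
  "foliation A k F \<longleftrightarrow>
     F \<subseteq> A \<and> (\<Union>c\<in>F. fst c) = UNIV \<and>
     (\<forall>c\<in>F. snd c ` fst c = {x. \<forall>j. cmod (x $ j) < 1}) \<and>
     (\<forall>c\<in>F. \<forall>c'\<in>F. \<forall>x\<in>snd c ` (fst c \<inter> fst c'). \<exists>N.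
        open N \<and> x \<in> N \<and> N \<subseteq> snd c ` (fst c \<inter> fst c') \<and>
        (\<forall>y\<in>N. \<forall>y'\<in>N. same_transverse k y y' \<longrightarrow>
           same_transverse k (trans_map c c' y) (trans_map c c' y')))"

definition leaf_tangent ::
    "('a, 'n::finite) chart set \<Rightarrow> 'n \<Rightarrow> ('a, 'n) chart set \<Rightarrow> 'a \<Rightarrow> (complex^'n) set" where
  "leaf_tangent A k F z = {v. \<forall>c\<in>F. z \<in> fst c \<longrightarrow>
     same_transverse k (dtrans (chart_at A z) c (snd (chart_at A z) z) v) 0}"

text \<open>In \<open>directed\<close>, \<open>M\<close> and \<open>\<tau>\<close> play the roles of the mass measure of \<open>T\<close> and of its field
  of (1,1)-vectors. The normalisation of \<open>\<tau>\<close> to unit length for some Hermitian metric is left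
  out; any \<open>M\<close> and \<open>\<tau>\<close> as below can be rescaled to achieve it.\<close>

definition directed ::
    "('a::topological_space, 'n::finite) chart set \<Rightarrow> 'n \<Rightarrow> ('a, 'n) chart set \<Rightarrow>
     ('a, 'n) current \<Rightarrow> bool" where
  "directed A k F T \<longleftrightarrow>
     (\<exists>(M :: 'a measure) (\<tau> :: 'a \<Rightarrow> ((complex^'n) list \<Rightarrow> complex) \<Rightarrow> complex).
        sets M = sets borel \<and> finite_measure M \<and>
        (\<forall>\<omega>\<in>forms A 1 1. integrable M (\<lambda>z. \<tau> z (\<omega> z)) \<and> T \<omega> = (LINT z|M. \<tau> z (\<omega> z))) \<and>
        (AE z in M. \<exists>v\<in>leaf_tangent A k F z. v \<noteq> 0 \<and> \<tau> z = bivector v))"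

definition pluriexact ::
    "('a::topological_space, 'n::finite) chart set \<Rightarrow> 'n \<Rightarrow> ('a, 'n) chart set \<Rightarrow> bool" where
  "pluriexact A k F \<longleftrightarrow>
     (\<exists>T\<in>currents A 1 1. (\<exists>\<omega>\<in>forms A 1 1. T \<omega> \<noteq> 0) \<and>
        positive_current A T \<and> directed A k F T \<and>
        (\<exists>S\<in>currents A 2 2. real_current A 2 S \<and> (\<forall>\<omega>\<in>forms A 1 1. T \<omega> = S (ddc A \<omega>))))"

section \<open>Transversals, holonomy and invariant measures\<close>

text \<open>Embedded submanifolds of real codimension 2, transverse to the leaves and not necessarily
  closed: locally the zero set of a smooth complex function whose differential is injective on
  the tangent lines of the leaves.\<close>

definition transversal ::
    "'n::finite \<Rightarrow> ('a::topological_space, 'n) chart set \<Rightarrow> 'a set \<Rightarrow> bool" where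
  "transversal k F \<Sigma> \<longleftrightarrow>
     (\<forall>p\<in>\<Sigma>. \<exists>c\<in>F. \<exists>V u. open V \<and> p \<in> V \<and> V \<subseteq> fst c \<and>
        smooth_on (snd c ` V) (u :: complex^'n \<Rightarrow> complex) \<and>
        (\<forall>x\<in>snd c ` V. \<forall>w. w \<noteq> 0 \<longrightarrow> frechet_derivative u (at x) (axis k w) \<noteq> 0) \<and>
        \<Sigma> \<inter> V = {q\<in>V. u (snd c q) = 0})"

text \<open>Holonomy maps between transversals: finite compositions of homeomorphisms that slide points
  along the plaques of one flow box.\<close>

inductive holonomy ::
    "'n::finite \<Rightarrow> ('a::topological_space, 'n) chart set \<Rightarrow> 'a set \<Rightarrow> 'a set \<Rightarrow> ('a \<Rightarrow> 'a) \<Rightarrow> bool"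
  for k F where
  slide: "\<lbrakk>transversal k F B; transversal k F B'; homeomorphism B B' h g; c \<in> F;
           \<And>x. x \<in> B \<Longrightarrow> x \<in> fst c \<and> h x \<in> fst c \<and> same_transverse k (snd c x) (snd c (h x))\<rbrakk>
          \<Longrightarrow> holonomy k F B B' h"
| comp: "\<lbrakk>holonomy k F B B' h; holonomy k F B' B'' h'\<rbrakk> \<Longrightarrow> holonomy k F B B'' (h' \<circ> h)"

definition radon_on :: "'a::topological_space set \<Rightarrow> 'a measure \<Rightarrow> bool" where
  "radon_on \<Sigma> \<nu> \<longleftrightarrow> sets \<nu> = sets (restrict_space borel \<Sigma>) \<and>
     (\<forall>K. compact K \<and> K \<subseteq> \<Sigma> \<longrightarrow> emeasure \<nu> K < \<infinity>) \<and>
     (\<forall>E\<in>sets \<nu>. emeasure \<nu> E = (SUP K\<in>{K. compact K \<and> K \<subseteq> E}. emeasure \<nu> K))"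

definition transversal_invariant_measure ::
    "'n::finite \<Rightarrow> ('a::topological_space, 'n) chart set \<Rightarrow> ('a set \<Rightarrow> 'a measure) \<Rightarrow> bool" where
  "transversal_invariant_measure k F \<nu> \<longleftrightarrow>
     (\<forall>\<Sigma>. transversal k F \<Sigma> \<longrightarrow> radon_on \<Sigma> (\<nu> \<Sigma>)) \<and>
     (\<forall>\<Sigma> \<Sigma>' B B' h E. transversal k F \<Sigma> \<and> transversal k F \<Sigma>' \<and>
        openin (top_of_set \<Sigma>) B \<and> openin (top_of_set \<Sigma>') B' \<and> holonomy k F B B' h \<and>
        E \<in> sets (\<nu> \<Sigma>) \<and> E \<subseteq> B \<longrightarrow> emeasure (\<nu> \<Sigma>') (h ` E) = emeasure (\<nu> \<Sigma>) E)"

end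

theory Submission
  imports Defs "HOL-Complex_Analysis.Cauchy_Integral_Formula"
begin

text \<open>Since \<open>T\<close> is \<open>dd\<^sup>c\<close>-exact, it vanishes on every (1,1)-form killed by \<open>dd\<^sup>c\<close>, in particular
  on the forms \<open>\<partial>\<close>-bar of \<open>\<phi> * dz\<^sub>k\<close> with \<open>\<phi>\<close> supported in a flow box; so \<open>T\<close> is closed as far as
  the leaves can tell. In a flow box, \<open>T\<close> is integration over the leaves against a measure \<open>m\<close>, and
  testing on these forms shows that \<open>m\<close> annihilates all derivatives in the leaf direction. Hence \<open>m\<close>
  is invariant under small translations along the leaves, and by uniqueness of Haar measure the mass
  of a tube \<open>{cmod (z - b) < r} \<times> Q\<close> is \<open>r\<^sup>2\<close> times a measure \<open>\<nu>\<close> of \<open>Q\<close> on the space of plaques.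
  A change of flow box acts on \<open>m\<close> by the squared modulus of the leafwise derivative and distorts
  thin tubes by nearly the same factor, so the measures \<open>\<nu>\<close> of different flow boxes agree. They
  therefore induce measures on all transversals, and sliding along plaques preserves these. They do
  not all vanish because \<open>T\<close> is not 0.\<close>

section \<open>Smooth maps\<close>

text \<open>No disintegration of \<open>T\<close> along the leaves is made: a transverse measure is
  read off from the masses of tubes over Borel sets of plaques. The test form delbar
  \<open>\<phi>\<close> wedge \<open>dz\<^sub>k\<close> is chosen because on leaf tangents it sees
  only the derivative of \<open>\<phi>\<close> along the leaf. As \<open>\<phi>\<close> and
  \<open>m\<close> are real, the real and imaginary parts of the single complex equation yield both
  real directions of the leaf. Three obstacles shape the proof. The field \<open>\<tau>\<close> is
  known only through the integrable functions \<open>\<tau> z (\<omega> z)\<close>, so the density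
  that defines \<open>m\<close> is rebuilt from countably many test forms. A change of flow box does
  not map tubes to tubes, so two transverse measures are compared on small sets up to the factors (1
  - \<eta>)^2 and (1 + \<eta>)^2; these inequalities are summed over a countable Borel partition
  before \<eta> tends to 0. Finally, a transversal is merely smooth and need not be closed, so it is
  cut into compact pieces on which the passage to the space of plaques is a homeomorphism onto its
  image.\<close>

lemma nderiv_append: "nderiv (us @ vs) f = nderiv us (nderiv vs f)"
  by (induction us) auto

lemma has_derivative_cong_open:
  assumes "open S" "x \<in> S" "\<And>y. y \<in> S \<Longrightarrow> f y = g y"
  shows "(f has_derivative D) (at x) \<longleftrightarrow> (g has_derivative D) (at x)"
  by (metis assms has_derivative_transform_within_open)

lemma differentiable_cong_open:
  assumes "open S" "x \<in> S" "\<And>y. y \<in> S \<Longrightarrow> f y = g y"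
  shows "f differentiable (at x) \<longleftrightarrow> g differentiable (at x)"
  unfolding differentiable_def using has_derivative_cong_open[of S x f g, OF assms] by simp

lemma frechet_derivative_cong_open:
  assumes "open S" "x \<in> S" "\<And>y. y \<in> S \<Longrightarrow> f y = g y"
  shows "frechet_derivative f (at x) = frechet_derivative g (at x)"
  unfolding frechet_derivative_def using has_derivative_cong_open[of S x f g, OF assms] by simp

lemma nderiv_cong_open:
  assumes "open S" "\<And>y. y \<in> S \<Longrightarrow> f y = g y" "x \<in> S"
  shows "nderiv vs f x = nderiv vs g x"
  using assms(3)
proof (induction vs arbitrary: x)
  case (Cons v vs)
  then show ?case
    using frechet_derivative_cong_open[OF assms(1) Cons.prems, of "nderiv vs f" "nderiv vs g"] by simp
qed (use assms in auto)

lemma smooth_on_cong_open: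
  assumes "open S" "\<And>y. y \<in> S \<Longrightarrow> f y = g y" "smooth_on S f"
  shows "smooth_on S g"
  unfolding smooth_on_def
proof (intro allI ballI)
  fix vs x assume x: "x \<in> S"
  have "nderiv vs f differentiable (at x)"
    using assms(3) x unfolding smooth_on_def by blast
  then show "nderiv vs g differentiable (at x)"
    using differentiable_cong_open[OF assms(1) x, of "nderiv vs f" "nderiv vs g"] nderiv_cong_open[of S f g, OF assms(1,2)]
    by blast
qed

lemma smooth_on_subset: "smooth_on S f \<Longrightarrow> T \<subseteq> S \<Longrightarrow> smooth_on T f"
  unfolding smooth_on_def by blast

lemma smooth_on_Un: "smooth_on S f \<Longrightarrow> smooth_on T f \<Longrightarrow> smooth_on (S \<union> T) f"
  unfolding smooth_on_def by blast

lemma smooth_on_nderiv: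
  assumes "smooth_on S f"
  shows "smooth_on S (nderiv vs f)"
  using assms unfolding smooth_on_def by (simp flip: nderiv_append)

lemma smooth_on_frechet_derivative:
  "smooth_on S f \<Longrightarrow> smooth_on S (\<lambda>x. frechet_derivative f (at x) v)"
  using smooth_on_nderiv[of S f "[v]"] by simp

lemma smooth_on_differentiable: "smooth_on S f \<Longrightarrow> x \<in> S \<Longrightarrow> f differentiable (at x)"
  unfolding smooth_on_def by (drule spec[of _ "[]"]) simp

lemma smooth_on_has_derivative:
  "smooth_on S f \<Longrightarrow> x \<in> S \<Longrightarrow> (f has_derivative frechet_derivative f (at x)) (at x)"
  using smooth_on_differentiable frechet_derivative_works by blast

lemma smooth_on_isCont: "smooth_on S f \<Longrightarrow> x \<in> S \<Longrightarrow> isCont f x"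
  using smooth_on_differentiable differentiable_imp_continuous_within by blast

lemma smooth_on_continuous_on: "smooth_on S f \<Longrightarrow> continuous_on S f"
  by (rule continuous_at_imp_continuous_on) (use smooth_on_isCont in blast)

text \<open>A class \<open>P\<close> closed under directional derivatives contains, up to equality
  on \<open>S\<close>, every iterated derivative of its members. Matching on \<open>S\<close> is
  enough because \<open>S\<close> is open, and more cannot be asked since
  \<open>frechet_derivative\<close> is uncontrolled where no derivative exists.\<close>

lemma smooth_on_coinduct:
  assumes "open S" and "P f"
    and step: "\<And>f. P f \<Longrightarrow> \<exists>D. (\<forall>x\<in>S. (f has_derivative D x) (at x)) \<and>
                 (\<forall>v. \<exists>g. P g \<and> (\<forall>x\<in>S. D x v = g x))"
  shows "smooth_on S f"
proof -
  have "\<exists>g. P g \<and> (\<forall>x\<in>S. nderiv vs f x = g x)" for vs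
  proof (induction vs)
    case Nil then show ?case using assms(2) by auto
  next
    case (Cons v vs)
    then obtain g where g: "P g" "\<And>x. x \<in> S \<Longrightarrow> nderiv vs f x = g x" by blast
    obtain D where D: "\<And>x. x\<in>S \<Longrightarrow> (g has_derivative D x) (at x)"
      "\<And>v. \<exists>g. P g \<and> (\<forall>x\<in>S. D x v = g x)"
      using step[OF g(1)] by blast
    have "nderiv (v # vs) f x = D x v" if "x \<in> S" for x
      using frechet_derivative_cong_open[OF \<open>open S\<close> that g(2)] frechet_derivative_at[OF D(1)[OF that]]
      by simp
    then show ?case using D(2)[of v] by metis
  qed
  moreover have "g differentiable (at x)" if "P g" "x \<in> S" for g x
    using step[OF that(1)] that(2) by (meson differentiableI)
  ultimately show ?thesis
    unfolding smooth_on_def using differentiable_cong_open[OF \<open>open S\<close>] by blast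
qed

section \<open>Closure properties of smooth functions\<close>

lemma smooth_on_const: "open S \<Longrightarrow> smooth_on S (\<lambda>x. c)"
  by (rule smooth_on_coinduct[where P="\<lambda>f. \<exists>c. f = (\<lambda>x. c)"])
     (auto intro!: exI[where x="\<lambda>x v. 0"])

lemma smooth_on_bounded_linear:
  assumes "open S" "smooth_on S f" "bounded_linear L"
  shows "smooth_on S (\<lambda>x. L (f x))"
proof (rule smooth_on_coinduct[OF assms(1), where P="\<lambda>g. \<exists>f. smooth_on S f \<and> g = (\<lambda>x. L (f x))"])
  fix g assume "\<exists>f. smooth_on S f \<and> g = (\<lambda>x. L (f x))"
  then obtain f where f: "smooth_on S f" and g: "g = (\<lambda>x. L (f x))" by blast
  show "\<exists>D. (\<forall>x\<in>S. (g has_derivative D x) (at x)) \<and>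
      (\<forall>v. \<exists>g. (\<exists>f. smooth_on S f \<and> g = (\<lambda>x. L (f x))) \<and> (\<forall>x\<in>S. D x v = g x))"
    unfolding g
  proof (intro exI[where x="\<lambda>x v. L (frechet_derivative f (at x) v)"] conjI ballI allI)
    show "((\<lambda>x. L (f x)) has_derivative (\<lambda>v. L (frechet_derivative f (at x) v))) (at x)" if "x \<in> S" for x
      by (rule bounded_linear.has_derivative[OF assms(3) smooth_on_has_derivative[OF f that]])
    show "\<exists>g. (\<exists>f. smooth_on S f \<and> g = (\<lambda>x. L (f x))) \<and>
        (\<forall>x\<in>S. L (frechet_derivative f (at x) v) = g x)" for v
      by (rule exI[where x="\<lambda>x. L (frechet_derivative f (at x) v)"])
         (use smooth_on_frechet_derivative[OF f] in blast)
  qed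
qed (use assms in auto)

lemma smooth_on_bounded_linear_id: "open S \<Longrightarrow> bounded_linear L \<Longrightarrow> smooth_on S L"
proof -
  assume S: "open S" and L: "bounded_linear L"
  have "smooth_on S (\<lambda>x. x)"
  proof (rule smooth_on_coinduct[where P="\<lambda>f. f = (\<lambda>x. x) \<or> (\<exists>c. f = (\<lambda>x. c))", OF S])
    fix f :: "'a \<Rightarrow> 'a" assume "f = (\<lambda>x. x) \<or> (\<exists>c. f = (\<lambda>x. c))"
    then consider "f = (\<lambda>x. x)" | c where "f = (\<lambda>x. c)" by blast
    then show "\<exists>D. (\<forall>x\<in>S. (f has_derivative D x) (at x)) \<and>
        (\<forall>v. \<exists>g. (g = (\<lambda>x. x) \<or> (\<exists>c. g = (\<lambda>x. c))) \<and> (\<forall>x\<in>S. D x v = g x))"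
    proof cases
      case 1 then show ?thesis by (intro exI[where x="\<lambda>x v. v"]) auto
    next
      case 2 then show ?thesis by (intro exI[where x="\<lambda>x v. 0"]) auto
    qed
  qed simp
  from smooth_on_bounded_linear[OF S this L] show ?thesis by simp
qed

lemma smooth_on_add:
  assumes "open S" "smooth_on S f" "smooth_on S g"
  shows "smooth_on S (\<lambda>x. f x + g x)"
proof (rule smooth_on_coinduct[OF assms(1),
      where P="\<lambda>h. \<exists>f g. smooth_on S f \<and> smooth_on S g \<and> h = (\<lambda>x. f x + g x)"])
  fix h assume "\<exists>f g. smooth_on S f \<and> smooth_on S g \<and> h = (\<lambda>x. f x + g x)"
  then obtain f g where f: "smooth_on S f" and g: "smooth_on S g" and h: "h = (\<lambda>x. f x + g x)" by blast
  show "\<exists>D. (\<forall>x\<in>S. (h has_derivative D x) (at x)) \<and>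
      (\<forall>v. \<exists>h. (\<exists>f g. smooth_on S f \<and> smooth_on S g \<and> h = (\<lambda>x. f x + g x)) \<and> (\<forall>x\<in>S. D x v = h x))"
    unfolding h
  proof (intro exI[where x="\<lambda>x v. frechet_derivative f (at x) v + frechet_derivative g (at x) v"]
      conjI ballI allI)
    show "((\<lambda>x. f x + g x) has_derivative
        (\<lambda>v. frechet_derivative f (at x) v + frechet_derivative g (at x) v)) (at x)" if "x \<in> S" for x
      by (intro has_derivative_add smooth_on_has_derivative[OF f that] smooth_on_has_derivative[OF g that])
    show "\<exists>h. (\<exists>f g. smooth_on S f \<and> smooth_on S g \<and> h = (\<lambda>x. f x + g x)) \<and>
        (\<forall>x\<in>S. frechet_derivative f (at x) v + frechet_derivative g (at x) v = h x)" for v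
      by (rule exI[where x="\<lambda>x. frechet_derivative f (at x) v + frechet_derivative g (at x) v"])
         (use smooth_on_frechet_derivative[OF f] smooth_on_frechet_derivative[OF g] in blast)
  qed
qed (use assms in auto)

lemma smooth_on_sum:
  assumes "open S" "\<And>i. i \<in> I \<Longrightarrow> smooth_on S (f i)"
  shows "smooth_on S (\<lambda>x. \<Sum>i\<in>I. f i x)"
  using assms(2)
proof (induction I rule: infinite_finite_induct)
  case (insert i I)
  then show ?case using smooth_on_add[OF assms(1)] by auto
qed (auto intro: smooth_on_const[OF assms(1)])

text \<open>The functions below form a module over the smooth functions that is closed under directional
  derivatives, which gives compositions and, for \<open>\<Phi> = id\<close>, products.\<close>

inductive smooth_compositions ::
  "'a::real_normed_vector set \<Rightarrow> 'b::euclidean_space set \<Rightarrow> ('a \<Rightarrow> 'b) \<Rightarrow> ('a \<Rightarrow> 'c::real_normed_field) \<Rightarrow> bool"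
  for S T \<Phi> where
  comp: "smooth_on T f \<Longrightarrow> smooth_compositions S T \<Phi> (\<lambda>x. f (\<Phi> x))"
| zero: "smooth_compositions S T \<Phi> (\<lambda>x. 0)"
| add: "smooth_compositions S T \<Phi> f \<Longrightarrow> smooth_compositions S T \<Phi> g \<Longrightarrow>
    smooth_compositions S T \<Phi> (\<lambda>x. f x + g x)"
| mult: "smooth_on S f \<Longrightarrow> smooth_compositions S T \<Phi> g \<Longrightarrow>
    smooth_compositions S T \<Phi> (\<lambda>x. f x * g x)"

lemma smooth_compositions_sum:
  "(\<And>i. i \<in> I \<Longrightarrow> smooth_compositions S T \<Phi> (f i)) \<Longrightarrow> smooth_compositions S T \<Phi> (\<lambda>x. \<Sum>i\<in>I. f i x)"
  by (induction I rule: infinite_finite_induct) (auto intro: smooth_compositions.intros)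

lemma smooth_compositions_smooth:
  fixes f :: "'a::real_normed_vector \<Rightarrow> 'c::real_normed_field" and \<Phi> :: "'a \<Rightarrow> 'b::euclidean_space"
  assumes S: "open S" and \<Phi>: "smooth_on S \<Phi>" and ST: "\<And>x. x \<in> S \<Longrightarrow> \<Phi> x \<in> T"
    and f: "smooth_compositions S T \<Phi> f"
  shows "smooth_on S f"
proof (rule smooth_on_coinduct[where P="smooth_compositions S T \<Phi>", OF S f])
  fix h :: "_ \<Rightarrow> 'c" assume "smooth_compositions S T \<Phi> h"
  then show "\<exists>D. (\<forall>x\<in>S. (h has_derivative D x) (at x)) \<and>
      (\<forall>v. \<exists>g. smooth_compositions S T \<Phi> g \<and> (\<forall>x\<in>S. D x v = g x))"
  proof induction
    case (comp f)
    let ?D = "\<lambda>x v. frechet_derivative f (at (\<Phi> x)) (frechet_derivative \<Phi> (at x) v)"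
    have D: "((\<lambda>x. f (\<Phi> x)) has_derivative ?D x) (at x)" if "x \<in> S" for x
      by (rule has_derivative_compose[OF smooth_on_has_derivative[OF \<Phi> that]])
         (rule smooth_on_has_derivative[OF comp ST[OF that]])
    \<comment> \<open>The chain rule is expanded in a basis so that each summand is a smooth
      function on \<open>S\<close> times a derivative of \<open>f\<close> composed with
      \<open>\<Phi>\<close>; this stays inside the module.\<close>
    have eq: "?D x v = (\<Sum>b\<in>Basis. of_real (frechet_derivative \<Phi> (at x) v \<bullet> b) *
        frechet_derivative f (at (\<Phi> x)) b)" if "x \<in> S" for x v
    proof -
      have l: "linear (frechet_derivative f (at (\<Phi> x)))"
        using smooth_on_has_derivative[OF comp ST[OF that]] has_derivative_linear by blast
      have "?D x v = frechet_derivative f (at (\<Phi> x))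
          (\<Sum>b\<in>Basis. (frechet_derivative \<Phi> (at x) v \<bullet> b) *\<^sub>R b)"
        by (simp add: euclidean_representation)
      then show ?thesis
        by (simp add: linear_sum[OF l] linear_cmul[OF l] scaleR_conv_of_real)
    qed
    show ?case
    proof (intro exI[where x="?D"] conjI ballI allI D)
      fix v
      have bl: "bounded_linear (\<lambda>y. of_real (y \<bullet> b) :: 'c)" for b :: 'b
        by (intro bounded_linear_compose[OF bounded_linear_of_real bounded_linear_inner_left])
      show "\<exists>g. smooth_compositions S T \<Phi> g \<and> (\<forall>x\<in>S. ?D x v = g x)"
        by (intro exI[where x="\<lambda>x. \<Sum>b\<in>Basis. of_real (frechet_derivative \<Phi> (at x) v \<bullet> b) *
              frechet_derivative f (at (\<Phi> x)) b"] conjI ballI eq smooth_compositions_sum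
              smooth_compositions.mult smooth_compositions.comp smooth_on_frechet_derivative comp
              smooth_on_bounded_linear[OF S _ bl] \<Phi>)
    qed
  next
    case zero
    show ?case by (intro exI[where x="\<lambda>x v. 0"]) (auto intro: smooth_compositions.zero)
  next
    case (add f g)
    then obtain D E where D: "\<And>x. x \<in> S \<Longrightarrow> (f has_derivative D x) (at x)"
      "\<And>v. \<exists>g. smooth_compositions S T \<Phi> g \<and> (\<forall>x\<in>S. D x v = g x)"
      and E: "\<And>x. x \<in> S \<Longrightarrow> (g has_derivative E x) (at x)"
      "\<And>v. \<exists>g. smooth_compositions S T \<Phi> g \<and> (\<forall>x\<in>S. E x v = g x)" by metis
    show ?case
    proof (intro exI[where x="\<lambda>x v. D x v + E x v"] conjI ballI allI)
      fix v
      obtain d e where "smooth_compositions S T \<Phi> d" "\<forall>x\<in>S. D x v = d x"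
          "smooth_compositions S T \<Phi> e" "\<forall>x\<in>S. E x v = e x"
        using D(2)[of v] E(2)[of v] by auto
      then show "\<exists>h. smooth_compositions S T \<Phi> h \<and> (\<forall>x\<in>S. D x v + E x v = h x)"
        by (intro exI[where x="\<lambda>x. d x + e x"]) (auto intro: smooth_compositions.add)
    qed (intro has_derivative_add D(1) E(1))
  next
    case (mult f g)
    then obtain E where E: "\<And>x. x \<in> S \<Longrightarrow> (g has_derivative E x) (at x)"
      "\<And>v. \<exists>g. smooth_compositions S T \<Phi> g \<and> (\<forall>x\<in>S. E x v = g x)" by metis
    let ?D = "\<lambda>x. frechet_derivative f (at x)"
    show ?case
    proof (intro exI[where x="\<lambda>x v. f x * E x v + ?D x v * g x"] conjI ballI allI)
      fix v
      obtain e where "smooth_compositions S T \<Phi> e" "\<forall>x\<in>S. E x v = e x"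
        using E(2)[of v] by auto
      then show "\<exists>h. smooth_compositions S T \<Phi> h \<and> (\<forall>x\<in>S. f x * E x v + ?D x v * g x = h x)"
        using mult.hyps smooth_on_frechet_derivative[OF mult.hyps(1), of v]
        by (intro exI[where x="\<lambda>x. f x * e x + ?D x v * g x"])
          (auto intro: smooth_compositions.add smooth_compositions.mult)
    qed (intro has_derivative_mult smooth_on_has_derivative[OF mult.hyps(1)] E(1))
  qed
qed

lemma smooth_on_compose:
  fixes f :: "'b::euclidean_space \<Rightarrow> 'c::real_normed_field"
  assumes "open S" "smooth_on S \<Phi>" "\<And>x. x \<in> S \<Longrightarrow> \<Phi> x \<in> T" "smooth_on T f"
  shows "smooth_on S (\<lambda>x. f (\<Phi> x))"
  by (rule smooth_compositions_smooth[OF assms(1-3) smooth_compositions.comp[OF assms(4)]])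

lemma smooth_on_mult:
  fixes f g :: "'a::euclidean_space \<Rightarrow> 'c::real_normed_field"
  assumes S: "open S" and f: "smooth_on S f" and g: "smooth_on S g"
  shows "smooth_on S (\<lambda>x. f x * g x)"
  by (rule smooth_compositions_smooth[OF S smooth_on_bounded_linear_id[OF S bounded_linear_ident]
        _ smooth_compositions.mult[OF f smooth_compositions.comp[OF g]]])

lemma smooth_on_prod:
  fixes f :: "_ \<Rightarrow> 'a::euclidean_space \<Rightarrow> 'c::real_normed_field"
  assumes "open S" "\<And>i. i \<in> I \<Longrightarrow> smooth_on S (f i)"
  shows "smooth_on S (\<lambda>x. \<Prod>i\<in>I. f i x)"
  using assms(2)
proof (induction I rule: infinite_finite_induct)
  case (insert i I)
  then show ?case using smooth_on_mult[OF assms(1)] by auto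
qed (auto intro: smooth_on_const[OF assms(1)])

lemma smooth_on_vec:
  fixes f :: "'a::real_normed_vector \<Rightarrow> 'b::euclidean_space ^ 'n::finite"
  assumes S: "open S" and "\<And>j. smooth_on S (\<lambda>x. f x $ j)"
  shows "smooth_on S f"
proof -
  have bl: "bounded_linear (\<lambda>y. axis j y :: 'b ^ 'n)" for j
    unfolding linear_conv_bounded_linear[symmetric]
    by (rule linearI) (auto simp: axis_def vec_eq_iff)
  have "f = (\<lambda>x. \<Sum>j\<in>UNIV. axis j (f x $ j))"
    by (auto simp: fun_eq_iff vec_eq_iff axis_def sum.delta if_distrib cong: if_cong)
  moreover have "smooth_on S (\<lambda>x. \<Sum>j\<in>UNIV. axis j (f x $ j))"
    by (intro smooth_on_sum S smooth_on_bounded_linear[OF S _ bl] assms(2))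
  ultimately show ?thesis by simp
qed

section \<open>Symmetry of second derivatives\<close>

lemma smooth_on_line_derivative:
  assumes "smooth_on S f" "p + s *\<^sub>R u \<in> S"
  shows "((\<lambda>s. f (p + s *\<^sub>R u)) has_vector_derivative frechet_derivative f (at (p + s *\<^sub>R u)) u) (at s)"
proof -
  have "((\<lambda>s. p + s *\<^sub>R u) has_derivative (\<lambda>h. h *\<^sub>R u)) (at s)"
    by (auto intro!: derivative_eq_intros)
  from has_derivative_compose[OF this smooth_on_has_derivative[OF assms]]
  show ?thesis
    unfolding has_vector_derivative_def
    using has_derivative_linear[OF smooth_on_has_derivative[OF assms]]
    by (simp add: linear_cmul)
qed

lemma nderiv_bounded_linear:
  assumes "open S" "smooth_on S f" "bounded_linear L" "x \<in> S"
  shows "nderiv vs (\<lambda>x. L (f x)) x = L (nderiv vs f x)"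
  using assms(4)
proof (induction vs arbitrary: x)
  case (Cons v vs)
  have "frechet_derivative (nderiv vs (\<lambda>x. L (f x))) (at x)
      = frechet_derivative (\<lambda>x. L (nderiv vs f x)) (at x)"
    by (rule frechet_derivative_cong_open[OF assms(1) Cons.prems]) (rule Cons.IH)
  moreover have "((\<lambda>x. L (nderiv vs f x)) has_derivative
      (\<lambda>v. L (frechet_derivative (nderiv vs f) (at x) v))) (at x)"
    by (rule bounded_linear.has_derivative[OF assms(3)
          smooth_on_has_derivative[OF smooth_on_nderiv[OF assms(2)] Cons.prems]])
  ultimately show ?case by (simp flip: frechet_derivative_at)
qed simp

text \<open>The mean value theorem is applied twice: along \<open>u\<close> to the increment of
  \<open>f\<close> in direction \<open>v\<close>, then along \<open>v\<close> to the derivative in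
  direction \<open>u\<close>. It needs real values, hence the codomain.\<close>

lemma second_difference:
  fixes f :: "'a::real_normed_vector \<Rightarrow> real"
  assumes f: "smooth_on S f" and h: "h > 0"
    and sub: "\<And>s t. 0 \<le> s \<Longrightarrow> s \<le> h \<Longrightarrow> 0 \<le> t \<Longrightarrow> t \<le> h \<Longrightarrow> x + s *\<^sub>R u + t *\<^sub>R v \<in> S"
  obtains s t where "0 < s" "s < h" "0 < t" "t < h"
    "f (x + h *\<^sub>R u + h *\<^sub>R v) - f (x + h *\<^sub>R u) - f (x + h *\<^sub>R v) + f x
      = h\<^sup>2 * nderiv [v, u] f (x + s *\<^sub>R u + t *\<^sub>R v)"
proof -
  let ?D = "\<lambda>y. frechet_derivative f (at y) u"
  have "\<exists>s>0. s < h \<and> (f (x + h *\<^sub>R v + h *\<^sub>R u) - f (x + h *\<^sub>R u)) - (f (x + h *\<^sub>R v + 0 *\<^sub>R u) - f (x + 0 *\<^sub>R u)) =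
     (h - 0) * (?D (x + h *\<^sub>R v + s *\<^sub>R u) - ?D (x + s *\<^sub>R u))"
  proof (rule MVT2[OF h, of "\<lambda>s. f (x + h *\<^sub>R v + s *\<^sub>R u) - f (x + s *\<^sub>R u)"
        "\<lambda>s. ?D (x + h *\<^sub>R v + s *\<^sub>R u) - ?D (x + s *\<^sub>R u)"])
    fix s assume s: "0 \<le> s" "s \<le> h"
    have "x + h *\<^sub>R v + s *\<^sub>R u \<in> S" "x + s *\<^sub>R u \<in> S"
      using sub[OF s, of h] sub[OF s, of 0] h by (auto simp: algebra_simps)
    then show "((\<lambda>s. f (x + h *\<^sub>R v + s *\<^sub>R u) - f (x + s *\<^sub>R u)) has_real_derivative
        ?D (x + h *\<^sub>R v + s *\<^sub>R u) - ?D (x + s *\<^sub>R u)) (at s)"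
      using smooth_on_line_derivative[OF f, of "x + h *\<^sub>R v" s u]
        smooth_on_line_derivative[OF f, of x s u]
      by (auto simp: has_real_derivative_iff_has_vector_derivative intro!: has_vector_derivative_diff)
  qed
  then obtain s where s: "0 < s" "s < h" and
    1: "(f (x + h *\<^sub>R v + h *\<^sub>R u) - f (x + h *\<^sub>R u)) - (f (x + h *\<^sub>R v) - f x) =
     h * (?D (x + h *\<^sub>R v + s *\<^sub>R u) - ?D (x + s *\<^sub>R u))" by auto
  have "\<exists>t>0. t < h \<and> ?D (x + s *\<^sub>R u + h *\<^sub>R v) - ?D (x + s *\<^sub>R u + 0 *\<^sub>R v) =
     (h - 0) * frechet_derivative ?D (at (x + s *\<^sub>R u + t *\<^sub>R v)) v"
  proof (rule MVT2[OF h])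
    fix t assume t: "0 \<le> t" "t \<le> h"
    show "((\<lambda>t. ?D (x + s *\<^sub>R u + t *\<^sub>R v)) has_real_derivative
        frechet_derivative ?D (at (x + s *\<^sub>R u + t *\<^sub>R v)) v) (at t)"
      using smooth_on_line_derivative[OF smooth_on_frechet_derivative[OF f] sub[OF _ _ t], of s u] s
      by (simp add: has_real_derivative_iff_has_vector_derivative)
  qed
  then obtain t where "0 < t" "t < h" "?D (x + s *\<^sub>R u + h *\<^sub>R v) - ?D (x + s *\<^sub>R u) =
     h * frechet_derivative ?D (at (x + s *\<^sub>R u + t *\<^sub>R v)) v" by auto
  with 1 s that show thesis
    by (auto simp: algebra_simps power2_eq_square)
qed

text \<open>The second difference is symmetric in \<open>u\<close> and \<open>v\<close>, so both
  mixed derivatives take a common value at points arbitrarily close to \<open>x\<close>, where both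
  are continuous.\<close>

lemma second_derivative_symmetric_real:
  fixes f :: "'a::real_normed_vector \<Rightarrow> real"
  assumes S: "open S" and f: "smooth_on S f" and x: "x \<in> S"
  shows "nderiv [u, v] f x = nderiv [v, u] f x"
proof (rule ccontr)
  let ?A = "nderiv [u, v] f" and ?B = "nderiv [v, u] f"
  assume "?A x \<noteq> ?B x"
  then have e: "dist (?A x) (?B x) / 2 > 0" (is "?e > 0") by simp
  have "isCont ?A x" "isCont ?B x"
    by (rule smooth_on_isCont[OF smooth_on_nderiv[OF f] x])+
  then obtain d1 d2 where d: "d1 > 0" "d2 > 0"
    "\<And>y. dist y x < d1 \<Longrightarrow> dist (?A y) (?A x) < ?e" "\<And>y. dist y x < d2 \<Longrightarrow> dist (?B y) (?B x) < ?e"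
    using e unfolding continuous_at_eps_delta by metis
  obtain d3 where d3: "d3 > 0" "ball x d3 \<subseteq> S" using S x openE by blast
  define d where "d = Min {d1, d2, d3}"
  have dpos: "d > 0" using d d3 by (auto simp: d_def)
  \<comment> \<open>The summand 1 keeps the denominator positive for \<open>u = v = 0\<close> and
    makes the distance estimate below strict.\<close>
  define h where "h = d / (1 + norm u + norm v)"
  have h: "h > 0" using dpos by (auto simp: h_def intro!: divide_pos_pos add_pos_nonneg)
  have dist: "dist (x + s *\<^sub>R u + t *\<^sub>R v) x < d" if "0 \<le> s" "s \<le> h" "0 \<le> t" "t \<le> h" for s t
  proof -
    have "dist (x + s *\<^sub>R u + t *\<^sub>R v) x = norm (s *\<^sub>R u + t *\<^sub>R v)" by (simp add: dist_norm)
    also have "\<dots> \<le> s * norm u + t * norm v"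
      using that by (intro order.trans[OF norm_triangle_ineq]) simp
    also have "\<dots> \<le> h * norm u + h * norm v"
      using that by (intro add_mono mult_right_mono) auto
    also have "\<dots> < h * (1 + norm u + norm v)" using h by (simp add: algebra_simps)
    also have "\<dots> = d" unfolding h_def using norm_ge_zero[of u] norm_ge_zero[of v]
      by (simp add: add_nonneg_eq_0_iff)
    finally show ?thesis .
  qed
  have sub: "x + s *\<^sub>R u + t *\<^sub>R v \<in> S" if "0 \<le> s" "s \<le> h" "0 \<le> t" "t \<le> h" for s t
    using dist[OF that] d3(2) by (auto simp: d_def dist_commute subset_iff)
  obtain s t where 1: "0 < s" "s < h" "0 < t" "t < h"
    "f (x + h *\<^sub>R u + h *\<^sub>R v) - f (x + h *\<^sub>R u) - f (x + h *\<^sub>R v) + f x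
      = h\<^sup>2 * ?B (x + s *\<^sub>R u + t *\<^sub>R v)"
    using second_difference[OF f h sub] by blast
  have sub': "x + s *\<^sub>R v + t *\<^sub>R u \<in> S" if "0 \<le> s" "s \<le> h" "0 \<le> t" "t \<le> h" for s t
    using sub[OF that(3,4,1,2)] by (simp add: algebra_simps)
  obtain s' t' where 2: "0 < s'" "s' < h" "0 < t'" "t' < h"
    "f (x + h *\<^sub>R v + h *\<^sub>R u) - f (x + h *\<^sub>R v) - f (x + h *\<^sub>R u) + f x
      = h\<^sup>2 * ?A (x + s' *\<^sub>R v + t' *\<^sub>R u)"
    using second_difference[OF f h sub'] by blast
  have "h\<^sup>2 * ?B (x + s *\<^sub>R u + t *\<^sub>R v) = h\<^sup>2 * ?A (x + t' *\<^sub>R u + s' *\<^sub>R v)"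
    using 1(5) 2(5) by (simp add: algebra_simps)
  then have eq: "?B (x + s *\<^sub>R u + t *\<^sub>R v) = ?A (x + t' *\<^sub>R u + s' *\<^sub>R v)" using h by simp
  have "dist (?B (x + s *\<^sub>R u + t *\<^sub>R v)) (?B x) < ?e"
    by (rule d(4)) (use dist[of s t] 1 in \<open>auto simp: d_def\<close>)
  moreover have "dist (?A (x + t' *\<^sub>R u + s' *\<^sub>R v)) (?A x) < ?e"
    by (rule d(3)) (use dist[of t' s'] 2 in \<open>auto simp: d_def\<close>)
  ultimately show False
    unfolding eq using dist_triangle_half_l[of "?A x" _ "?e * 2" "?B x"]
    by (metis dist_commute dist_triangle_half_r less_irrefl nonzero_mult_div_cancel_right
        mult.commute times_divide_eq_left zero_neq_numeral)
qed

lemma second_derivative_symmetric: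
  fixes f :: "'a::real_normed_vector \<Rightarrow> 'c::euclidean_space"
  assumes S: "open S" and f: "smooth_on S f" and x: "x \<in> S"
  shows "nderiv [u, v] f x = nderiv [v, u] f x"
proof (rule euclidean_eqI)
  fix b :: 'c
  have bl: "bounded_linear (\<lambda>y. y \<bullet> b)" by (rule bounded_linear_inner_left)
  show "nderiv [u, v] f x \<bullet> b = nderiv [v, u] f x \<bullet> b"
    using second_derivative_symmetric_real[OF S smooth_on_bounded_linear[OF S f bl] x, of u v]
      nderiv_bounded_linear[OF S f bl x] by metis
qed

section \<open>Bump functions\<close>

definition flat_exp :: "real \<Rightarrow> real" where
  "flat_exp t = (if t > 0 then exp (- 1 / t) else 0)"

lemma poly_over_exp_tendsto_0: "((\<lambda>s. poly p s * exp (- s)) \<longlongrightarrow> 0) at_top" for p :: "real poly"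
proof -
  have "((\<lambda>s. \<Sum>i\<le>degree p. coeff p i * (s ^ i / exp s)) \<longlongrightarrow> (\<Sum>i\<le>degree p. coeff p i * 0)) at_top"
    by (intro tendsto_sum tendsto_mult tendsto_const tendsto_power_div_exp_0)
  then show ?thesis
    by (simp add: poly_altdef sum_distrib_right exp_minus divide_inverse mult.assoc)
qed

text \<open>The functions equal to p(1/t) exp(-1/t) for t > 0 and to 0 elsewhere, with p a
  polynomial, are closed under differentiation.\<close>

lemma smooth_flat_exp: "smooth_on UNIV flat_exp"
proof (rule smooth_on_coinduct[where
      P="\<lambda>f. \<exists>p::real poly. f = (\<lambda>t. if t > 0 then poly p (1/t) * exp (- 1/t) else 0)"])
  show "\<exists>p::real poly. flat_exp = (\<lambda>t. if t > 0 then poly p (1/t) * exp (- 1/t) else 0)"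
    by (rule exI[where x="[:1:]"]) (simp add: flat_exp_def fun_eq_iff)
  fix f :: "real \<Rightarrow> real"
  assume "\<exists>p::real poly. f = (\<lambda>t. if t > 0 then poly p (1/t) * exp (- 1/t) else 0)"
  then obtain p :: "real poly" where f: "f = (\<lambda>t. if t > 0 then poly p (1/t) * exp (- 1/t) else 0)" by blast
  \<comment> \<open>The derivative of p(1/t) exp(-1/t) is (p - p')(1/t) exp(-1/t) / t^2, and
    \<open>[:0,0,1:]\<close> supplies the factor 1/t^2.\<close>
  define q where "q = [:0,0,1:] * (p - pderiv p)"
  define f' where "f' = (\<lambda>t. if t > 0 then poly q (1/t) * exp (- 1/t) else 0)"
  have der: "(f has_real_derivative f' t) (at t)" for t
  proof -
    consider "t > 0" | "t < 0" | "t = 0" by linarith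
    then show ?thesis
    proof cases
      case 1
      have "((\<lambda>t. poly p (1/t) * exp (- 1/t)) has_real_derivative f' t) (at t)"
        using 1 by (auto intro!: derivative_eq_intros poly_DERIV[THEN DERIV_chain2]
            simp: f'_def q_def field_simps power2_eq_square)
      then show ?thesis
        by (rule has_field_derivative_transform_within_open[where S="{0<..}"]) (use 1 f in auto)
    next
      case 2
      have "((\<lambda>t::real. 0) has_real_derivative f' t) (at t)" using 2 by (simp add: f'_def)
      then show ?thesis
        by (rule has_field_derivative_transform_within_open[where S="{..<0}"]) (use 2 f in auto)
    next
      case 3
      \<comment> \<open>At 0 the difference quotient from the right is \<open>f t / t\<close>;
        division by t multiplies the polynomial in 1/t by its variable, which is
        \<open>pCons 0 p\<close>.\<close>
      have "((\<lambda>t. poly (pCons 0 p) (1/t) * exp (- (1/t))) \<longlongrightarrow> 0) (at_right 0)"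
        using filterlim_compose[OF poly_over_exp_tendsto_0[of "pCons 0 p"] filterlim_inverse_at_top_right]
        by (simp add: inverse_eq_divide)
      then have "((\<lambda>t. f t / t) \<longlongrightarrow> 0) (at_right 0)"
        by (rule Lim_transform_eventually)
           (auto simp: f eventually_at_filter)
      moreover have "((\<lambda>t. f t / t) \<longlongrightarrow> 0) (at_left 0)"
        by (rule tendsto_eventually) (auto simp: f eventually_at_filter)
      ultimately have "((\<lambda>t. f t / t) \<longlongrightarrow> 0) (at 0)" by (simp add: filterlim_split_at)
      then show ?thesis using 3 by (simp add: f'_def has_field_derivative_iff f)
    qed
  qed
  show "\<exists>D. (\<forall>x\<in>UNIV. (f has_derivative D x) (at x)) \<and>
     (\<forall>v. \<exists>g. (\<exists>p::real poly. g = (\<lambda>t. if t > 0 then poly p (1/t) * exp (- 1/t) else 0)) \<and> (\<forall>x\<in>UNIV. D x v = g x))"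
  proof (intro exI[where x="\<lambda>x v. f' x * v"] conjI ballI allI)
    show "(f has_derivative (*) (f' x)) (at x)" for x
      using der[of x] by (simp add: has_field_derivative_def)
    show "\<exists>g. (\<exists>p::real poly. g = (\<lambda>t. if t > 0 then poly p (1/t) * exp (- 1/t) else 0)) \<and> (\<forall>x\<in>UNIV. f' x * v = g x)" for v
      by (intro exI[where x="\<lambda>x. f' x * v"] conjI exI[where x="smult v q"])
         (auto simp: f'_def fun_eq_iff)
  qed
qed simp

text \<open>The factor \<open>n\<close> steepens the walls: \<open>flat_exp (n * c)\<close> tends to
  1 for each \<open>c > 0\<close>, so the bumps approximate the indicator of the open box while
  their support stays in the fixed closed box.\<close>

definition box_bump :: "nat \<Rightarrow> 'a::euclidean_space \<Rightarrow> 'a \<Rightarrow> 'a \<Rightarrow> real" where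
  "box_bump n a b x = (\<Prod>i\<in>Basis. flat_exp (real n * (x \<bullet> i - a \<bullet> i)) * flat_exp (real n * (b \<bullet> i - x \<bullet> i)))"

lemma smooth_box_bump: "smooth_on UNIV (box_bump n a b)"
proof -
  have lin: "smooth_on UNIV (\<lambda>x::'a. real n * (x \<bullet> i - a \<bullet> i))" "smooth_on UNIV (\<lambda>x::'a. real n * (b \<bullet> i - x \<bullet> i))" for i
  proof -
    have s: "smooth_on UNIV (\<lambda>x::'a. c * (x \<bullet> i) + d)" for c d
      by (intro smooth_on_add smooth_on_const smooth_on_bounded_linear_id open_UNIV
          bounded_linear_const_mult bounded_linear_inner_left)
    show "smooth_on UNIV (\<lambda>x::'a. real n * (x \<bullet> i - a \<bullet> i))" "smooth_on UNIV (\<lambda>x::'a. real n * (b \<bullet> i - x \<bullet> i))"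
      using s[of "real n" "- real n * (a \<bullet> i)"] s[of "- real n" "real n * (b \<bullet> i)"]
      by (simp_all add: algebra_simps)
  qed
  show ?thesis
    unfolding box_bump_def[abs_def]
    by (intro smooth_on_prod smooth_on_mult open_UNIV
        smooth_on_compose[OF open_UNIV lin(1) _ smooth_flat_exp]
        smooth_on_compose[OF open_UNIV lin(2) _ smooth_flat_exp]) auto
qed

lemma flat_exp_simps: "0 \<le> flat_exp t" "flat_exp t \<le> 1" "flat_exp t > 0 \<longleftrightarrow> t > 0"
  by (auto simp: flat_exp_def)

lemma box_bump_nonneg: "0 \<le> box_bump n a b x"
  unfolding box_bump_def by (intro prod_nonneg mult_nonneg_nonneg) (auto simp: flat_exp_simps)

lemma box_bump_le_1: "box_bump n a b x \<le> 1"
  unfolding box_bump_def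
  by (intro prod_le_1 conjI mult_le_one mult_nonneg_nonneg) (auto simp: flat_exp_simps)

lemma box_bump_pos: "n > 0 \<Longrightarrow> x \<in> box a b \<Longrightarrow> 0 < box_bump n a b x"
  unfolding box_bump_def
  by (intro prod_pos mult_pos_pos) (auto simp: flat_exp_simps box_def)

lemma box_bump_zero: "x \<notin> box a b \<Longrightarrow> box_bump n a b x = 0"
proof -
  assume "x \<notin> box a b"
  then obtain i where i: "i \<in> Basis" "x \<bullet> i \<le> a \<bullet> i \<or> b \<bullet> i \<le> x \<bullet> i"
    by (auto simp: box_def not_less)
  then have "flat_exp (real n * (x \<bullet> i - a \<bullet> i)) * flat_exp (real n * (b \<bullet> i - x \<bullet> i)) = 0"
    by (auto simp: flat_exp_def zero_less_mult_iff)
  with i show ?thesis unfolding box_bump_def by (intro prod_zero) auto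
qed

lemma box_bump_translate: "box_bump n a b (x + e) = box_bump n (a - e) (b - e) x"
  unfolding box_bump_def by (simp add: inner_diff_left inner_add_left algebra_simps)

lemma box_bump_tendsto: "(\<lambda>n. box_bump n a b x) \<longlonglongrightarrow> indicator (box a b) x"
proof (cases "x \<in> box a b")
  case True
  have fl: "(\<lambda>n. flat_exp (real n * c)) \<longlonglongrightarrow> 1" if "c > 0" for c
  proof -
    have "(\<lambda>n. exp (- (1/c) / real n)) \<longlonglongrightarrow> exp 0"
      by (intro tendsto_exp lim_const_over_n)
    then have "(\<lambda>n. exp (- (1/c) / real n)) \<longlonglongrightarrow> 1" by simp
    then show ?thesis
      by (rule Lim_transform_eventually)
         (use that in \<open>auto intro!: eventually_mono[OF eventually_gt_at_top[of 0]] simp: flat_exp_def field_simps\<close>)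
  qed
  have "(\<lambda>n. box_bump n a b x) \<longlonglongrightarrow> (\<Prod>i\<in>(Basis::'a set). 1 * 1)"
    unfolding box_bump_def
    by (intro tendsto_prod tendsto_mult fl) (use True in \<open>auto simp: box_def\<close>)
  then show ?thesis using True by simp
qed (simp add: box_bump_zero)

section \<open>Holomorphic maps are smooth\<close>

definition holomorphic_fun_on :: "(complex^'n) set \<Rightarrow> (complex^'n \<Rightarrow> complex) \<Rightarrow> bool" where
  "holomorphic_fun_on S f \<longleftrightarrow>
     (\<forall>x\<in>S. \<exists>D. (f has_derivative D) (at x) \<and> (\<forall>a v. D (a *s v) = a * D v))"

lemma holomorphic_fun_onD:
  assumes "holomorphic_fun_on S f" "x \<in> S"
  shows "(f has_derivative frechet_derivative f (at x)) (at x)"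
    and "frechet_derivative f (at x) (a *s v) = a * frechet_derivative f (at x) v"
proof -
  obtain D where D: "(f has_derivative D) (at x)" "\<And>a v. D (a *s v) = a * D v"
    using assms unfolding holomorphic_fun_on_def by blast
  have "frechet_derivative f (at x) = D" using frechet_derivative_at[OF D(1)] ..
  then show "(f has_derivative frechet_derivative f (at x)) (at x)"
    "frechet_derivative f (at x) (a *s v) = a * frechet_derivative f (at x) v"
    using D by auto
qed

lemma norm_vector_scalar_mult: "norm (a *s (v::complex^'n::finite)) = norm a * norm v"
  by (simp add: norm_vec_def norm_mult L2_set_right_distrib)

lemma bounded_linear_complex_smult: "bounded_linear (\<lambda>a. a *s (v::complex^'n::finite))"
  by (rule bounded_linear_intro[where K="norm v"])
     (auto simp: vec_eq_iff algebra_simps norm_vector_scalar_mult)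

lemma holomorphic_fun_on_line:
  assumes "holomorphic_fun_on S f" "x + \<zeta> *s v \<in> S"
  shows "((\<lambda>\<zeta>. f (x + \<zeta> *s v)) has_field_derivative frechet_derivative f (at (x + \<zeta> *s v)) v) (at \<zeta>)"
proof -
  have "((\<lambda>\<zeta>. x + \<zeta> *s v) has_derivative (\<lambda>h. h *s v)) (at \<zeta>)"
    using has_derivative_add[OF has_derivative_const[of x]
        bounded_linear.has_derivative[OF bounded_linear_complex_smult has_derivative_ident]] by simp
  from has_derivative_compose[OF this holomorphic_fun_onD(1)[OF assms]]
  show ?thesis
    unfolding has_field_derivative_def
    by (simp add: holomorphic_fun_onD(2)[OF assms] mult_commute_abs)
qed

text \<open>Cauchy's formula for the derivative, on the complex line through \<open>x\<close> in
  direction \<open>v\<close>. The circle is the same for all \<open>x\<close> near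
  \<open>x0\<close>, so the derivative becomes a parameter integral over \<open>f\<close> itself;
  all regularity of holomorphic maps is drawn from this, since their definition asks only for a
  complex linear derivative at each point.\<close>

lemma holomorphic_fun_on_derivative_integral:
  fixes f :: "complex^'n::finite \<Rightarrow> complex"
  assumes S: "open S" and f: "holomorphic_fun_on S f" and x0: "x0 \<in> S"
  obtains d \<gamma> K where "d > 0" "ball x0 d \<subseteq> S" "continuous_on {0..1} \<gamma>" "continuous_on {0..1} K"
    "\<And>x t. x \<in> ball x0 d \<Longrightarrow> t \<in> {0..1} \<Longrightarrow> x + \<gamma> t *s v \<in> S"
    "\<And>x. x \<in> ball x0 d \<Longrightarrow> frechet_derivative f (at x) v = integral {0..1} (\<lambda>t. f (x + \<gamma> t *s v) * K (t::real))"
proof -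
  obtain e where e: "e > 0" "ball x0 e \<subseteq> S" using S x0 openE by blast
  define d where "d = e / 2"
  \<comment> \<open>The circle moves a point by at most \<open>r * norm v\<close>, which is at most
    \<open>d\<close>, so it stays within the ball of radius \<open>e = 2 * d\<close> about
    \<open>x0\<close>. The summand 1 covers \<open>v = 0\<close>.\<close>
  define r where "r = d / (1 + norm v)"
  have d: "d > 0" and r: "r > 0" using e by (auto simp: d_def r_def intro!: divide_pos_pos add_pos_nonneg)
  have in_S: "x + \<zeta> *s v \<in> S" if "x \<in> ball x0 d" "norm \<zeta> \<le> r" for x \<zeta>
  proof -
    have "norm (\<zeta> *s v) \<le> r * norm v"
      using that by (simp add: norm_vector_scalar_mult mult_right_mono)
    also have "\<dots> \<le> r * (1 + norm v)" using r by (simp add: algebra_simps)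
    also have "\<dots> = d" unfolding r_def using norm_ge_zero[of v] by (simp add: add_nonneg_eq_0_iff)
    finally have "dist x0 (x + \<zeta> *s v) < e"
      using that(1) dist_triangle[of x0 "x + \<zeta> *s v" x] by (auto simp: d_def dist_norm)
    then show ?thesis using e by auto
  qed
  define \<gamma> where "\<gamma> = circlepath 0 r"
  define K where "K t = vector_derivative \<gamma> (at t) / (2 * of_real pi * \<i> * (\<gamma> t)\<^sup>2)" for t
  have nz: "\<gamma> t \<noteq> 0" for t using r by (simp add: \<gamma>_def circlepath)
  have ng: "norm (\<gamma> t) = r" for t
    using r by (simp add: \<gamma>_def circlepath norm_mult norm_exp_eq_Re)
  have cont\<gamma>: "continuous_on {0..1} \<gamma>"
    by (simp add: \<gamma>_def flip: path_def)
  have vd: "vector_derivative \<gamma> (at t) = 2 * of_real pi * \<i> * r * exp (2 * of_real pi * \<i> * t)" for t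
    by (simp add: \<gamma>_def vector_derivative_circlepath)
  have contK: "continuous_on {0..1} K"
    unfolding K_def vd by (intro continuous_intros cont\<gamma>) (use nz in auto)
  show thesis
  proof (rule that[OF d _ cont\<gamma> contK])
    show "ball x0 d \<subseteq> S" using e by (auto simp: d_def)
    show "x + \<gamma> t *s v \<in> S" if "x \<in> ball x0 d" "t \<in> {0..1}" for x t
      by (rule in_S[OF that(1)]) (simp add: ng)
    fix x assume x: "x \<in> ball x0 d"
    let ?F = "\<lambda>\<zeta>. f (x + \<zeta> *s v)"
    have der: "(?F has_field_derivative frechet_derivative f (at (x + \<zeta> *s v)) v) (at \<zeta>)" if "norm \<zeta> \<le> r" for \<zeta>
      by (rule holomorphic_fun_on_line[OF f in_S[OF x that]])
    have "(?F has_field_derivative (1 / (2 * of_real pi * \<i>) * contour_integral \<gamma> (\<lambda>u. ?F u / (u - 0)\<^sup>2))) (at 0)"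
      unfolding \<gamma>_def
    proof (rule Cauchy_derivative_integral_circlepath)
      show "continuous_on (cball 0 r) ?F"
        using der by (auto intro!: continuous_at_imp_continuous_on DERIV_isCont)
      show "?F holomorphic_on ball 0 r"
        by (rule holomorphic_onI) (use der field_differentiable_at_within field_differentiable_def in force)
    qed (use r in auto)
    with der[of 0] r have "frechet_derivative f (at x) v
        = 1 / (2 * of_real pi * \<i>) * contour_integral \<gamma> (\<lambda>u. ?F u / u\<^sup>2)"
      by (auto dest: DERIV_unique)
    also have "\<dots> = integral {0..1} (\<lambda>t. ?F (\<gamma> t) * K t)"
      unfolding contour_integral_integral K_def integral_mult_right[symmetric]
      by (intro integral_cong) (simp add: field_simps)
    finally show "frechet_derivative f (at x) v = integral {0..1} (\<lambda>t. ?F (\<gamma> t) * K t)" .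
  qed
qed

lemma holomorphic_fun_on_continuous: "holomorphic_fun_on S f \<Longrightarrow> continuous_on S f"
  by (intro continuous_at_imp_continuous_on ballI has_derivative_continuous[OF holomorphic_fun_onD(1)])

lemma continuous_on_line_param:
  fixes \<gamma> :: "real \<Rightarrow> complex"
  assumes "continuous_on S g" "continuous_on {0..1} \<gamma>"
    and "\<And>x t. x \<in> U \<Longrightarrow> t \<in> {0..1} \<Longrightarrow> x + \<gamma> t *s v \<in> S"
  shows "continuous_on (U \<times> {0..1}) (\<lambda>(x, t). g (x + \<gamma> t *s v))"
proof -
  have "continuous_on (U \<times> {0..1}) (\<lambda>p. \<gamma> (snd p))"
    by (rule continuous_on_compose2[OF assms(2)]) (auto intro!: continuous_intros)
  then have "continuous_on (U \<times> {0..1}) (\<lambda>p. fst p + \<gamma> (snd p) *s v)"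
    by (intro continuous_intros bounded_linear.continuous_on[OF bounded_linear_complex_smult])
  then show ?thesis
    unfolding split_beta by (rule continuous_on_compose2[OF assms(1)]) (use assms(3) in auto)
qed

text \<open>Continuity of the derivative is what the Leibniz rule needs in the next step; it follows
  because the Cauchy integral depends continuously on its parameter.\<close>

lemma holomorphic_fun_on_continuous_derivative:
  assumes S: "open S" and f: "holomorphic_fun_on S f"
  shows "continuous_on S (\<lambda>x. frechet_derivative f (at x) v)"
proof (rule continuous_at_imp_continuous_on, rule ballI)
  fix x0 assume "x0 \<in> S"
  then obtain d \<gamma> K where d: "d > 0" "ball x0 d \<subseteq> S" and c: "continuous_on {0..1} \<gamma>" "continuous_on {0..1} K"
    and sub: "\<And>x t. x \<in> ball x0 d \<Longrightarrow> t \<in> {0..1} \<Longrightarrow> x + \<gamma> t *s v \<in> S"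
    and eq: "\<And>x. x \<in> ball x0 d \<Longrightarrow> frechet_derivative f (at x) v = integral {0..1} (\<lambda>t. f (x + \<gamma> t *s v) * K (t::real))"
    by (rule holomorphic_fun_on_derivative_integral[OF S f, of x0 v]) (blast intro: that)
  have "continuous_on (ball x0 d \<times> {0..1}) (\<lambda>(x, t). f (x + \<gamma> t *s v) * K t)"
    using continuous_on_mult[OF
        continuous_on_line_param[OF holomorphic_fun_on_continuous[OF f] c(1) sub, of "ball x0 d"]
        continuous_on_compose2[OF c(2) continuous_on_snd[OF continuous_on_id], of "ball x0 d \<times> {0..1}"]]
    by (simp add: split_beta)
  then have "continuous_on (ball x0 d) (\<lambda>x. integral (cbox 0 1) (\<lambda>t. f (x + \<gamma> t *s v) * K t))"
    by (intro integral_continuous_on_param) simp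
  then have "continuous_on (ball x0 d) (\<lambda>x. frechet_derivative f (at x) v)"
    by (rule continuous_on_eq) (simp add: eq)
  then show "isCont (\<lambda>x. frechet_derivative f (at x) v) x0"
    using d(1) by (simp add: continuous_on_eq_continuous_at)
qed

text \<open>Differentiation under the Cauchy integral. The result is complex linear because the
  derivative of \<open>f\<close> is so at each point of the circle. Holomorphic functions are thus
  closed under directional derivatives, and the coinduction principle applies.\<close>

lemma holomorphic_fun_on_frechet_derivative:
  fixes f :: "complex^'n::finite \<Rightarrow> complex"
  assumes S: "open S" and f: "holomorphic_fun_on S f"
  shows "holomorphic_fun_on S (\<lambda>x. frechet_derivative f (at x) v)"
  unfolding holomorphic_fun_on_def
proof
  fix x0 assume "x0 \<in> S"
  then obtain d \<gamma> K where d: "d > 0" "ball x0 d \<subseteq> S" and c: "continuous_on {0..1} \<gamma>" "continuous_on {0..1} K"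
    and sub: "\<And>x t. x \<in> ball x0 d \<Longrightarrow> t \<in> {0..1} \<Longrightarrow> x + \<gamma> t *s v \<in> S"
    and eq: "\<And>x. x \<in> ball x0 d \<Longrightarrow> frechet_derivative f (at x) v = integral {0..1} (\<lambda>t. f (x + \<gamma> t *s v) * K (t::real))"
    by (rule holomorphic_fun_on_derivative_integral[OF S f, of x0 v]) (blast intro: that)
  let ?U = "ball x0 d"
  define B where "B x t = Blinfun (\<lambda>w. frechet_derivative f (at (x + \<gamma> t *s v)) w * K t)" for x t
  have B: "blinfun_apply (B x t) = (\<lambda>w. frechet_derivative f (at (x + \<gamma> t *s v)) w * K t)"
    if "x \<in> ?U" "t \<in> {0..1}" for x t
    unfolding B_def
    by (intro bounded_linear_Blinfun_apply bounded_linear_mult_const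
        has_derivative_bounded_linear[OF holomorphic_fun_onD(1)[OF f sub[OF that]]])
  have cK: "continuous_on (?U \<times> {0..1}) (\<lambda>p. K (snd p))"
    by (rule continuous_on_compose2[OF c(2)]) (auto intro!: continuous_intros)
  have cB: "continuous_on (?U \<times> cbox 0 1) (\<lambda>(x, t). B x t)"
  proof (rule continuous_on_blinfun_componentwise)
    fix i :: "complex^'n"
    have "continuous_on (?U \<times> {0..1}) (\<lambda>p. frechet_derivative f (at (fst p + \<gamma> (snd p) *s v)) i * K (snd p))"
      using continuous_on_line_param[OF holomorphic_fun_on_continuous_derivative[OF S f] c(1) sub, of ?U i]
      by (auto simp: split_beta intro!: continuous_on_mult cK)
    then show "continuous_on (?U \<times> cbox 0 1) (\<lambda>x. blinfun_apply (case x of (x, t) \<Rightarrow> B x t) i)"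
      by (subst continuous_on_cong[OF refl, where g="\<lambda>p. frechet_derivative f (at (fst p + \<gamma> (snd p) *s v)) i * K (snd p)"])
         (auto simp: B)
  qed
  have der: "((\<lambda>x. integral (cbox 0 1) (\<lambda>t. f (x + \<gamma> t *s v) * K t)) has_derivative
      blinfun_apply (integral (cbox 0 1) (B x0))) (at x0 within ?U)"
  proof (rule leibniz_rule[OF _ _ cB])
    fix x t assume xt: "x \<in> ?U" "t \<in> cbox (0::real) 1"
    have "((\<lambda>x. f (x + \<gamma> t *s v)) has_derivative frechet_derivative f (at (x + \<gamma> t *s v))) (at x)"
    proof -
      have "((\<lambda>x. x + \<gamma> t *s v) has_derivative (\<lambda>h. h)) (at x)"
        by (auto intro!: derivative_eq_intros)
      from has_derivative_compose[OF this holomorphic_fun_onD(1)[OF f sub[of x t]]] xt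
      show ?thesis by simp
    qed
    then have "((\<lambda>x. f (x + \<gamma> t *s v) * K t) has_derivative blinfun_apply (B x t)) (at x)"
      using xt by (simp add: B has_derivative_mult_left)
    then show "((\<lambda>x. f (x + \<gamma> t *s v) * K t) has_derivative blinfun_apply (B x t)) (at x within ?U)"
      by (rule has_derivative_at_withinI)
  next
    fix x assume x: "x \<in> ?U"
    have "continuous_on {0..1} (\<lambda>t. f (x + \<gamma> t *s v))"
      using sub[OF x] by (intro continuous_on_compose2[OF holomorphic_fun_on_continuous[OF f]]
        continuous_intros bounded_linear.continuous_on[OF bounded_linear_complex_smult] c) auto
    then show "(\<lambda>t. f (x + \<gamma> t *s v) * K t) integrable_on cbox 0 1"
      by (auto intro!: integrable_continuous_interval continuous_on_mult c)
  qed (use d in auto)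
  have Bint: "B x0 integrable_on cbox 0 1"
  proof -
    have "continuous_on (cbox 0 1) (\<lambda>t. case (x0, t) of (x, t) \<Rightarrow> B x t)"
      by (rule continuous_on_compose2[OF cB]) (use d in \<open>auto intro!: continuous_intros\<close>)
    then show ?thesis by (intro integrable_continuous) simp
  qed
  let ?D = "blinfun_apply (integral (cbox 0 1) (B x0))"
  have "((\<lambda>x. frechet_derivative f (at x) v) has_derivative ?D) (at x0)"
  proof (rule has_derivative_transform_within_open[where s="?U"])
    show "((\<lambda>x. integral (cbox 0 1) (\<lambda>t. f (x + \<gamma> t *s v) * K t)) has_derivative ?D) (at x0)"
      using der d(1) at_within_open[of x0 ?U] by simp
  qed (use d eq in auto)
  moreover have "?D (a *s w) = a * ?D w" for a w
  proof -
    have eq: "?D w = integral {0..1} (\<lambda>t. frechet_derivative f (at (x0 + \<gamma> t *s v)) w * K t)" for w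
      unfolding blinfun_apply_integral[OF Bint] unfolding cbox_interval
      by (rule integral_cong) (use d in \<open>simp add: B\<close>)
    show ?thesis
      unfolding eq integral_mult_right[symmetric]
      by (rule integral_cong) (use holomorphic_fun_onD(2)[OF f sub] d in auto)
  qed
  ultimately show "\<exists>D. ((\<lambda>x. frechet_derivative f (at x) v) has_derivative D) (at x0) \<and> (\<forall>a v. D (a *s v) = a * D v)"
    by blast
qed

lemma holomorphic_fun_on_smooth:
  assumes "open S" "holomorphic_fun_on S f"
  shows "smooth_on S f"
proof (rule smooth_on_coinduct[where P="holomorphic_fun_on S", OF assms])
  fix f :: "complex^'a \<Rightarrow> complex" assume f: "holomorphic_fun_on S f"
  show "\<exists>D. (\<forall>x\<in>S. (f has_derivative D x) (at x)) \<and> (\<forall>v. \<exists>g. holomorphic_fun_on S g \<and> (\<forall>x\<in>S. D x v = g x))"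
    using holomorphic_fun_onD(1)[OF f] holomorphic_fun_on_frechet_derivative[OF assms(1) f]
    by (intro exI[where x="\<lambda>x. frechet_derivative f (at x)"]) blast
qed

lemma holomorphic_map_onD:
  assumes "holomorphic_map_on S f" "x \<in> S"
  shows "(f has_derivative frechet_derivative f (at x)) (at x)"
    and "frechet_derivative f (at x) (a *s v) = a *s frechet_derivative f (at x) v"
proof -
  obtain D where D: "(f has_derivative D) (at x)" "\<And>a v. D (a *s v) = a *s D v"
    using assms unfolding holomorphic_map_on_def by blast
  have "frechet_derivative f (at x) = D" using frechet_derivative_at[OF D(1)] ..
  then show "(f has_derivative frechet_derivative f (at x)) (at x)"
    "frechet_derivative f (at x) (a *s v) = a *s frechet_derivative f (at x) v"
    using D by auto
qed

lemma holomorphic_map_on_component: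
  assumes "holomorphic_map_on S f"
  shows "holomorphic_fun_on S (\<lambda>x. f x $ j)"
  unfolding holomorphic_fun_on_def
proof
  fix x assume x: "x \<in> S"
  show "\<exists>D. ((\<lambda>x. f x $ j) has_derivative D) (at x) \<and> (\<forall>a v. D (a *s v) = a * D v)"
    by (rule exI[where x="\<lambda>v. frechet_derivative f (at x) v $ j"])
       (auto simp: holomorphic_map_onD(2)[OF assms x]
         intro!: bounded_linear.has_derivative[OF bounded_linear_vec_nth] holomorphic_map_onD(1)[OF assms x])
qed

lemma holomorphic_map_on_smooth:
  "open S \<Longrightarrow> holomorphic_map_on S f \<Longrightarrow> smooth_on S f"
  by (rule smooth_on_vec) (auto intro: holomorphic_fun_on_smooth holomorphic_map_on_component)

section \<open>Countable Borel partitions\<close>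

text \<open>The hereditary Lindelof property as a predicate on types: the type of the manifold
  carries only the Hausdorff class, and the property is derived for it later from a finite cover by
  charts.\<close>

definition countably_coverable :: "'a::topological_space itself \<Rightarrow> bool" where
  "countably_coverable _ \<longleftrightarrow> (\<forall>\<F>::'a set set. (\<forall>U\<in>\<F>. open U) \<longrightarrow> (\<exists>\<F>'\<subseteq>\<F>. countable \<F>' \<and> \<Union>\<F>' = \<Union>\<F>))"

lemma countably_coverable_second_countable:
  "countably_coverable TYPE('a::second_countable_topology)"
  unfolding countably_coverable_def by (metis Lindelof)

lemma countable_open_cover:
  fixes S :: "'a::topological_space set"
  assumes "countably_coverable TYPE('a)"
    and "\<And>y. y \<in> S \<Longrightarrow> \<exists>U. open U \<and> y \<in> U \<and> P U"
  obtains U :: "nat \<Rightarrow> 'a set" where "\<And>i. open (U i)" "S \<subseteq> (\<Union>i. U i)" "\<And>i. U i = {} \<or> P (U i)"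
proof -
  obtain \<F> where F: "\<F> \<subseteq> {U. open U \<and> P U}" "countable \<F>" "\<Union>\<F> = \<Union>{U. open U \<and> P U}"
    using assms(1)[unfolded countably_coverable_def, rule_format, of "{U. open U \<and> P U}"] by auto
  define U where "U = from_nat_into (insert {} \<F>)"
  have r: "range U = insert {} \<F>" unfolding U_def using F(2) by (intro range_from_nat_into) auto
  show thesis
  proof (rule that[of U])
    fix i
    have "U i \<in> insert {} \<F>" using r by auto
    then show "open (U i)" "U i = {} \<or> P (U i)" using F(1) by auto
  next
    have "(\<Union>i. U i) = \<Union>(insert {} \<F>)" using r by metis
    then show "S \<subseteq> (\<Union>i. U i)" using assms(2) F(3) by fastforce
  qed
qed

text \<open>This turns a local statement on measures into a global one by countable additivity. The
  parts are not open, so \<open>P\<close> is recorded for an open set around each of them.\<close>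

lemma countable_borel_partition:
  fixes S :: "'a::topological_space set"
  assumes "countably_coverable TYPE('a)"
    and "\<And>y. y \<in> S \<Longrightarrow> \<exists>U. open U \<and> y \<in> U \<and> P U"
  obtains A :: "nat \<Rightarrow> 'a set" where "\<And>i. A i \<in> sets borel" "disjoint_family A" "S \<subseteq> (\<Union>i. A i)"
    "\<And>i. A i = {} \<or> (\<exists>U. open U \<and> P U \<and> A i \<subseteq> U)"
proof -
  obtain U :: "nat \<Rightarrow> 'a set" where U: "\<And>i. open (U i)" "S \<subseteq> (\<Union>i. U i)" "\<And>i. U i = {} \<or> P (U i)"
    using countable_open_cover[OF assms] by blast
  show thesis
  proof (rule that[of "disjointed U"])
    show "disjointed U i \<in> sets borel" for i
      using U(1) by (intro sets.range_disjointed_sets[of U borel, THEN subsetD]) auto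
    show "disjoint_family (disjointed U)" by (rule disjoint_family_disjointed)
    show "S \<subseteq> (\<Union>i. disjointed U i)" using U(2) by (simp add: UN_disjointed_eq)
    show "disjointed U i = {} \<or> (\<exists>V. open V \<and> P V \<and> disjointed U i \<subseteq> V)" for i
      using U(1,3)[of i] disjointed_subset[of U i] by blast
  qed
qed

section \<open>Measures annihilating a directional derivative\<close>

lemma taylor_second_order:
  fixes f :: "'a::real_normed_vector \<Rightarrow> real"
  assumes f: "smooth_on UNIV f" and C: "\<And>x. \<bar>nderiv [e, e] f x\<bar> \<le> C" and h: "h > 0"
  shows "\<bar>f (x + h *\<^sub>R e) - f x - h * frechet_derivative f (at x) e\<bar> \<le> C * h\<^sup>2"
proof -
  let ?D = "\<lambda>y. frechet_derivative f (at y) e"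
  have 1: "((\<lambda>s. f (x + s *\<^sub>R e)) has_real_derivative ?D (x + s *\<^sub>R e)) (at s)" for s
    using smooth_on_line_derivative[OF f, of x s e]
    by (simp add: has_real_derivative_iff_has_vector_derivative)
  have 2: "((\<lambda>s. ?D (x + s *\<^sub>R e)) has_real_derivative nderiv [e, e] f (x + s *\<^sub>R e)) (at s)" for s
    using smooth_on_line_derivative[OF smooth_on_frechet_derivative[OF f], of x s e]
    by (simp add: has_real_derivative_iff_has_vector_derivative)
  obtain s where s: "0 < s" "s < h" "f (x + h *\<^sub>R e) - f x = h * ?D (x + s *\<^sub>R e)"
    using MVT2[OF h 1] by auto
  obtain t where t: "0 < t" "t < s" "?D (x + s *\<^sub>R e) - ?D x = s * nderiv [e, e] f (x + t *\<^sub>R e)"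
    using MVT2[OF s(1) 2] by auto
  have "f (x + h *\<^sub>R e) - f x - h * ?D x = h * (s * nderiv [e, e] f (x + t *\<^sub>R e))"
    unfolding s(3) t(3)[symmetric] by (simp add: algebra_simps)
  then have "\<bar>f (x + h *\<^sub>R e) - f x - h * ?D x\<bar> = h * (s * \<bar>nderiv [e, e] f (x + t *\<^sub>R e)\<bar>)"
    using h s by (simp add: abs_mult)
  also have "\<dots> \<le> h * (h * C)"
    using h s C[of "x + t *\<^sub>R e"] by (intro mult_left_mono mult_mono) auto
  finally show ?thesis by (simp add: power2_eq_square mult_ac)
qed

lemma box_bump_nderiv_zero:
  assumes "x \<notin> cbox a b"
  shows "nderiv vs (box_bump n a b) x = 0"
proof -
  have "nderiv vs (box_bump n a b) x = nderiv vs (\<lambda>_. 0) x"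
  proof (rule nderiv_cong_open[of "- cbox a b"])
    show "box_bump n a b y = 0" if "y \<in> - cbox a b" for y
      by (rule box_bump_zero) (use that box_subset_cbox[of a b] in blast)
  qed (use assms in \<open>auto simp: closed_cbox\<close>)
  also have "nderiv vs (\<lambda>_::'a. 0::real) = (\<lambda>_. 0)" by (induction vs) auto
  finally show ?thesis by simp
qed

lemma box_bump_nderiv_bounded:
  fixes a b :: "'a::euclidean_space"
  obtains C where "C \<ge> 0" "\<And>x. \<bar>nderiv vs (box_bump n a b) x\<bar> \<le> C"
proof -
  have "continuous_on (cbox a b) (nderiv vs (box_bump n a b))"
    by (rule smooth_on_continuous_on[OF smooth_on_subset[OF smooth_on_nderiv[OF smooth_box_bump]]]) simp
  then have "bounded (nderiv vs (box_bump n a b) ` cbox a b)"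
    by (intro compact_imp_bounded compact_continuous_image) auto
  then obtain C where C: "\<And>x. x \<in> cbox a b \<Longrightarrow> \<bar>nderiv vs (box_bump n a b) x\<bar> \<le> C"
    by (auto simp: bounded_iff)
  show thesis
  proof (rule that[of "max C 0"])
    show "\<bar>nderiv vs (box_bump n a b) x\<bar> \<le> max C 0" for x
      using C[of x] box_bump_nderiv_zero[of x a b vs n] by (cases "x \<in> cbox a b") auto
  qed simp
qed

lemma borel_measurable_smooth: "smooth_on UNIV f \<Longrightarrow> f \<in> borel_measurable borel"
  by (intro borel_measurable_continuous_onI smooth_on_continuous_on)

text \<open>The vector \<open>e\<close> has two roles: the derivative along it is annihilated, and
  translation by \<open>e\<close> itself is the resulting symmetry. Convexity of \<open>D\<close>
  keeps the intermediate translates inside \<open>D\<close>.\<close>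

locale derivative_null_measure =
  fixes m :: "'a::euclidean_space measure" and D :: "'a set" and e :: 'a
  assumes sets_m [measurable_cong]: "sets m = sets borel"
    and D: "open D" "convex D"
    and finite_compact: "\<And>K. compact K \<Longrightarrow> K \<subseteq> D \<Longrightarrow> emeasure m K < \<infinity>"
    and null: "\<And>n a b. cbox a b \<subseteq> D \<Longrightarrow> (\<integral>x. frechet_derivative (box_bump n a b) (at x) e \<partial>m) = 0"
begin

lemma integrable_bump_nderiv:
  assumes "cbox a b \<subseteq> D"
  shows "integrable m (nderiv vs (box_bump n a b))"
proof -
  obtain C where C: "C \<ge> 0" "\<And>x. \<bar>nderiv vs (box_bump n a b) x\<bar> \<le> C"
    using box_bump_nderiv_bounded by blast
  have [measurable]: "nderiv vs (box_bump n a b) \<in> borel_measurable borel"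
    by (rule borel_measurable_smooth[OF smooth_on_nderiv[OF smooth_box_bump]])
  have "integrable m (\<lambda>x. C * indicator (cbox a b) x :: real)"
    using finite_compact[OF compact_cbox assms] by (intro integrable_mult_right integrable_real_indicator) auto
  then show ?thesis
    by (rule Bochner_Integration.integrable_bound)
       (use C box_bump_nderiv_zero[of _ a b vs n] in \<open>auto simp: indicator_def\<close>)
qed

text \<open>The integral \<open>G s\<close> of the bump translated by \<open>s *\<^sub>R e\<close>
  has vanishing derivative. Quantitatively, the first order term of the Taylor expansion integrates
  to 0, which leaves an error of order h^2 for a step of length h.\<close>

lemma bump_integral_translate:
  assumes "cbox a b \<subseteq> D" "cbox (a - e) (b - e) \<subseteq> D"
  shows "(\<integral>x. box_bump n a b x \<partial>m) = (\<integral>x. box_bump n (a - e) (b - e) x \<partial>m)"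
proof -
  define f where "f = box_bump n a b"
  define G where "G s = (\<integral>x. f (x + s *\<^sub>R e) \<partial>m)" for s
  define B where "B s = cbox (a - s *\<^sub>R e) (b - s *\<^sub>R e)" for s
  have shift: "x \<in> B s \<longleftrightarrow> x + s *\<^sub>R e \<in> cbox a b" for x s
    unfolding B_def mem_box by (simp add: inner_diff_left inner_add_left algebra_simps)
  \<comment> \<open>A point of an intermediate box is a convex combination of a point of
    \<open>cbox a b\<close> and its translate by \<open>- e\<close>.\<close>
  have sub: "B s \<subseteq> D" if "0 \<le> s" "s \<le> 1" for s
  proof
    fix x assume "x \<in> B s"
    then have y: "x + s *\<^sub>R e \<in> cbox a b" using shift by blast
    then have "x + s *\<^sub>R e - e \<in> B 1" unfolding shift by simp
    then have "x + s *\<^sub>R e - e \<in> D" "x + s *\<^sub>R e \<in> D" using assms y by (auto simp: B_def)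
    then have "(1 - s) *\<^sub>R (x + s *\<^sub>R e) + s *\<^sub>R (x + s *\<^sub>R e - e) \<in> D"
      using D(2) that by (intro convexD) auto
    then show "x \<in> D" by (simp add: algebra_simps)
  qed
  \<comment> \<open>The compact union of all intermediate boxes: it has finite mass and carries
    every integrand, so one bound serves all steps.\<close>
  define K where "K = (\<lambda>(s, y). y - s *\<^sub>R e) ` ({0..1} \<times> cbox a b)"
  have "compact K"
    unfolding K_def by (intro compact_continuous_image compact_Times continuous_intros)
      (auto simp: split_beta intro!: continuous_intros)
  moreover have BK: "x \<in> K" if "0 \<le> s" "s \<le> 1" "x \<in> B s" for s x
    unfolding K_def using that shift by (intro image_eqI[of _ _ "(s, x + s *\<^sub>R e)"]) auto
  moreover have KD: "K \<subseteq> D"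
  proof
    fix x assume "x \<in> K"
    then obtain s y where "x = y - s *\<^sub>R e" "0 \<le> s" "s \<le> 1" "y \<in> cbox a b" by (auto simp: K_def)
    then show "x \<in> D" using sub[of s] shift[of x s] by auto
  qed
  ultimately have Kfin: "emeasure m K < \<infinity>" and [measurable]: "K \<in> sets m"
    using finite_compact[of K] by (auto simp: sets_m borel_compact)
  have fs: "f (x + s *\<^sub>R e) = box_bump n (a - s *\<^sub>R e) (b - s *\<^sub>R e) x" for x s
    unfolding f_def by (rule box_bump_translate)
  have int: "integrable m (\<lambda>x. f (x + s *\<^sub>R e))" if "0 \<le> s" "s \<le> 1" for s
    unfolding fs using integrable_bump_nderiv[of "a - s *\<^sub>R e" "b - s *\<^sub>R e" "[]" n] sub[OF that] by (simp add: B_def)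
  have fr: "frechet_derivative f (at (x + s *\<^sub>R e)) e
      = frechet_derivative (box_bump n (a - s *\<^sub>R e) (b - s *\<^sub>R e)) (at x) e" for x s
  proof -
    have "((\<lambda>x. x + s *\<^sub>R e) has_derivative (\<lambda>h. h)) (at x)" by (auto intro!: derivative_eq_intros)
    from has_derivative_compose[OF this smooth_on_has_derivative[OF smooth_box_bump], of n a b]
    have "((\<lambda>x. f (x + s *\<^sub>R e)) has_derivative frechet_derivative f (at (x + s *\<^sub>R e))) (at x)"
      unfolding f_def by simp
    from frechet_derivative_at[OF this] show ?thesis unfolding fs by metis
  qed
  have intd: "integrable m (\<lambda>x. frechet_derivative f (at (x + s *\<^sub>R e)) e)"
    and nulld: "(\<integral>x. frechet_derivative f (at (x + s *\<^sub>R e)) e \<partial>m) = 0" if "0 \<le> s" "s \<le> 1" for s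
    unfolding fr using integrable_bump_nderiv[of "a - s *\<^sub>R e" "b - s *\<^sub>R e" "[e]" n] sub[OF that]
      null[of "a - s *\<^sub>R e" "b - s *\<^sub>R e" n] by (simp_all add: B_def)
  obtain C where C: "C \<ge> 0" "\<And>x. \<bar>nderiv [e, e] f x\<bar> \<le> C"
    unfolding f_def using box_bump_nderiv_bounded by blast
  have step: "\<bar>G (s + h) - G s\<bar> \<le> C * measure m K * h\<^sup>2" if s: "0 \<le> s" "h > 0" "s + h \<le> 1" for s h
  proof -
    let ?g = "\<lambda>x. f (x + (s + h) *\<^sub>R e) - f (x + s *\<^sub>R e) - h * frechet_derivative f (at (x + s *\<^sub>R e)) e"
    have 01: "0 \<le> s" "s \<le> 1" "0 \<le> s + h" using s by auto
    have "G (s + h) - G s = (\<integral>x. ?g x \<partial>m)"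
      unfolding G_def using int[OF 01(3) s(3)] int[OF 01(1,2)] intd[OF 01(1,2)] nulld[OF 01(1,2)] by simp
    also have "\<bar>\<dots>\<bar> \<le> (\<integral>x. C * h\<^sup>2 * indicator K x \<partial>m)"
    proof (rule integral_abs_bound_integral)
      show "integrable m ?g" using int[OF 01(3) s(3)] int[OF 01(1,2)] intd[OF 01(1,2)] by auto
      show "integrable m (\<lambda>x. C * h\<^sup>2 * indicator K x :: real)"
        using Kfin by (intro integrable_mult_right integrable_real_indicator) auto
      fix x
      show "\<bar>?g x\<bar> \<le> C * h\<^sup>2 * indicator K x"
      proof (cases "x \<in> K")
        case True
        have "f (x + s *\<^sub>R e + h *\<^sub>R e) = f (x + (s + h) *\<^sub>R e)" by (simp add: algebra_simps)
        then show ?thesis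
          using taylor_second_order[of f e C h "x + s *\<^sub>R e"] C s True smooth_box_bump[of n a b] by (simp add: f_def)
      next
        case False
        then have "x \<notin> B s" "x \<notin> B (s + h)" using BK s by (auto dest: BK[OF 01(1,2)] BK[OF 01(3) s(3)])
        then have "x + s *\<^sub>R e \<notin> cbox a b" "x + (s + h) *\<^sub>R e \<notin> cbox a b" by (auto simp: shift)
        then have "f (x + s *\<^sub>R e) = 0" "f (x + (s + h) *\<^sub>R e) = 0"
            "frechet_derivative f (at (x + s *\<^sub>R e)) e = 0"
          unfolding f_def using box_bump_nderiv_zero[of _ a b "[]" n] box_bump_nderiv_zero[of _ a b "[e]" n]
          by (simp_all only: nderiv.simps)
        then show ?thesis using False by simp
      qed
    qed
    also have "\<dots> = C * measure m K * h\<^sup>2" by simp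
    finally show ?thesis .
  qed
  \<comment> \<open>N steps of length 1/N, each with an error of order 1/N^2, leave a total error of
    order 1/N.\<close>
  have "\<bar>G 1 - G 0\<bar> \<le> C * measure m K / real N" if N: "N > 0" for N :: nat
  proof -
    have "G 1 - G 0 = (\<Sum>i<N. G (real (Suc i) / real N) - G (real i / real N))"
      using N sum_lessThan_telescope[of "\<lambda>i. G (real i / real N)" N] by simp
    also have "\<bar>\<dots>\<bar> \<le> (\<Sum>i<N. C * measure m K * (1 / real N)\<^sup>2)"
    proof (rule order.trans[OF sum_abs sum_mono])
      fix i assume "i \<in> {..<N}"
      then show "\<bar>G (real (Suc i) / real N) - G (real i / real N)\<bar> \<le> C * measure m K * (1 / real N)\<^sup>2"
        using step[of "real i / real N" "1 / real N"] N by (auto simp: field_simps)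
    qed
    also have "\<dots> = C * measure m K / real N" using N by (simp add: power2_eq_square)
    finally show ?thesis .
  qed
  then have "\<bar>G 1 - G 0\<bar> \<le> 0"
    by (intro LIMSEQ_le[OF tendsto_const lim_const_over_n[of "C * measure m K"]]) (auto intro!: exI[of _ 1])
  then show ?thesis by (simp add: G_def f_def box_bump_translate)
qed

text \<open>The steepness \<open>n\<close> tends to infinity, with the indicator of the closed box
  as dominating function.\<close>

lemma measure_box_translate:
  assumes "cbox a b \<subseteq> D" "cbox (a - e) (b - e) \<subseteq> D"
  shows "emeasure m (box a b) = emeasure m (box (a - e) (b - e))"
proof -
  have lim: "(\<lambda>n. \<integral>x. box_bump n a b x \<partial>m) \<longlonglongrightarrow> measure m (box a b)" if "cbox a b \<subseteq> D" for a b
  proof -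
    have [measurable]: "box_bump n a b \<in> borel_measurable borel" for n
      by (rule borel_measurable_smooth[OF smooth_box_bump])
    have "(\<lambda>n. \<integral>x. box_bump n a b x \<partial>m) \<longlonglongrightarrow> (\<integral>x. indicator (box a b) x \<partial>m)"
    proof (rule integral_dominated_convergence[where w="indicator (cbox a b)"])
      show "integrable m (indicator (cbox a b) :: _ \<Rightarrow> real)"
        using finite_compact[OF compact_cbox that] by (intro integrable_real_indicator) auto
      show "AE x in m. norm (box_bump n a b x) \<le> indicator (cbox a b) x" for n
        using box_subset_cbox[of a b] box_bump_le_1[of n a b] box_bump_nonneg[of n a b] box_bump_zero[of _ a b n]
        by (intro AE_I2) (fastforce simp: indicator_def)
    qed (auto simp: box_bump_tendsto)
    then show ?thesis by simp
  qed
  have "measure m (box a b) = measure m (box (a - e) (b - e))"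
    using LIMSEQ_unique[OF lim[OF assms(1)]] lim[OF assms(2)] bump_integral_translate[OF assms] by simp
  moreover have "emeasure m (box a b) < \<infinity>" if "cbox a b \<subseteq> D" for a b
    using emeasure_mono[of "box a b" "cbox a b" m] box_subset_cbox finite_compact[OF compact_cbox that]
    by (auto simp: sets_m intro: le_less_trans)
  ultimately show ?thesis
    using assms by (simp add: emeasure_eq_ennreal_measure less_top)
qed

text \<open>The open boxes are an intersection-stable generator of the Borel sets. Restriction to
  \<open>box a b\<close> makes the masses finite.\<close>

lemma measure_translate_in_box:
  assumes B: "cbox a b \<subseteq> D" "cbox (a - e) (b - e) \<subseteq> D" and Y: "Y \<in> sets borel" "Y \<subseteq> box a b"
  shows "emeasure m ((\<lambda>x. x + e) -` Y) = emeasure m Y"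
proof -
  have shift: "(\<lambda>x. x + e) -` box c d = box (c - e) (d - e)" for c d
    by (auto simp: mem_box inner_diff_left inner_add_left algebra_simps)
  define M1 where "M1 = density m (indicator (box a b))"
  define M2 where "M2 = distr (density m (indicator (box (a - e) (b - e)))) borel (\<lambda>x. x + e)"
  have M1: "emeasure M1 Z = emeasure m (box a b \<inter> Z)" if "Z \<in> sets borel" for Z
    unfolding M1_def using that by (subst emeasure_density) (auto simp: sets_m indicator_inter_arith[symmetric])
  have M2: "emeasure M2 Z = emeasure m ((\<lambda>x. x + e) -` (box a b \<inter> Z))" if [measurable]: "Z \<in> sets borel" for Z
  proof -
    have [measurable]: "(\<lambda>x. x + e) -` Z \<in> sets borel"
      using measurable_sets[of "\<lambda>x. x + e" borel borel Z] by simp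
    have "emeasure M2 Z = emeasure m (box (a - e) (b - e) \<inter> (\<lambda>x. x + e) -` Z)"
      unfolding M2_def
      by (subst emeasure_distr) (auto simp: emeasure_density sets_m indicator_inter_arith[symmetric] space_borel
         sets_eq_imp_space_eq[OF sets_m])
    then show ?thesis by (simp add: vimage_Int shift)
  qed
  have "M1 = M2"
  proof (rule measure_eqI_generator_eq[where E="range (\<lambda>(c, d). box c d :: 'a set)" and \<Omega>=UNIV
        and A="\<lambda>i. box (- (real i *\<^sub>R One)) (real i *\<^sub>R One)"])
    show "Int_stable (range (\<lambda>(c, d). box c d :: 'a set))"
      by (auto simp: Int_stable_def box_Int_box)
    have "sets borel = sigma_sets UNIV (range (\<lambda>(c, d). box c d :: 'a set))"
      unfolding borel_eq_box by (rule sets_measure_of) auto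
    then show "sets M1 = sigma_sets UNIV (range (\<lambda>(c, d). box c d))" "sets M2 = sigma_sets UNIV (range (\<lambda>(c, d). box c d))"
      by (simp_all add: M1_def M2_def sets_m)
    fix X assume "X \<in> range (\<lambda>(c, d). box c d :: 'a set)"
    then obtain c d where X: "X = box c d" by auto
    \<comment> \<open>These are the corners of the box \<open>box a b \<inter> box c d\<close>,
      which together with its translate still lies in \<open>D\<close>.\<close>
    let ?c = "\<Sum>i\<in>Basis. max (a\<bullet>i) (c\<bullet>i) *\<^sub>R i" and ?d = "\<Sum>i\<in>Basis. min (b\<bullet>i) (d\<bullet>i) *\<^sub>R i"
    have "cbox ?c ?d \<subseteq> cbox a b" "cbox (?c - e) (?d - e) \<subseteq> cbox (a - e) (b - e)"
      by (rule subset_box_imp(1), simp add: inner_diff_left)+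
    then have "emeasure m (box ?c ?d) = emeasure m (box (?c - e) (?d - e))"
      using B by (intro measure_box_translate) auto
    then show "emeasure M1 X = emeasure M2 X"
      by (simp add: X M1 M2 box_Int_box shift)
  next
    fix i
    have "emeasure M1 (box (- (real i *\<^sub>R One)) (real i *\<^sub>R One)) \<le> emeasure m (cbox a b)"
      unfolding M1[OF borel_open[OF open_box]] using box_subset_cbox[of a b] by (intro emeasure_mono) (auto simp: sets_m)
    then show "emeasure M1 (box (- (real i *\<^sub>R One)) (real i *\<^sub>R One)) \<noteq> \<infinity>"
      using finite_compact[OF compact_cbox B(1)] by (auto simp: top_unique)
  qed (auto simp: UN_box_eq_UNIV)
  moreover have "box a b \<inter> Y = Y" using Y by blast
  ultimately show ?thesis using M1[OF Y(1)] M2[OF Y(1)] by simp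
qed

text \<open>Countably many Borel parts of \<open>Y\<close> each fit into a box to which the
  preceding lemma applies; both sides may be infinite.\<close>

lemma measure_translate:
  assumes Y: "Y \<in> sets borel" "Y \<subseteq> D" "(\<lambda>x. x + e) -` Y \<subseteq> D"
  shows "emeasure m ((\<lambda>x. x + e) -` Y) = emeasure m Y"
proof -
  define P where "P U \<longleftrightarrow> (\<exists>a b. U = box a b \<and> cbox a b \<subseteq> D \<and> cbox (a - e) (b - e) \<subseteq> D)" for U
  have "\<exists>U. open U \<and> y \<in> U \<and> P U" if "y \<in> Y" for y
  proof -
    have op: "open (D \<inter> (\<lambda>x. x - e) -` D)"
      using D(1) by (intro open_Int open_vimage continuous_intros)
    have "y \<in> D \<inter> (\<lambda>x. x - e) -` D" using Y that by auto
    from open_contains_cbox[OF op this]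
    obtain a b where ab: "cbox a b \<subseteq> D \<inter> (\<lambda>x. x - e) -` D" "y \<in> box a b" .
    have "cbox (a - e) (b - e) \<subseteq> D"
    proof
      fix x assume "x \<in> cbox (a - e) (b - e)"
      then have "x + e \<in> cbox a b" by (auto simp: mem_box inner_diff_left inner_add_left algebra_simps)
      then show "x \<in> D" using ab(1) by auto
    qed
    then show ?thesis using ab by (intro exI[of _ "box a b"]) (auto simp: P_def)
  qed
  then obtain A :: "nat \<Rightarrow> 'a set" where A: "\<And>i. A i \<in> sets borel" "disjoint_family A" "Y \<subseteq> (\<Union>i. A i)"
    "\<And>i. A i = {} \<or> (\<exists>U. open U \<and> P U \<and> A i \<subseteq> U)"
    using countable_borel_partition[OF countably_coverable_second_countable, of Y P] by metis
  have eq: "emeasure m ((\<lambda>x. x + e) -` (Y \<inter> A i)) = emeasure m (Y \<inter> A i)" for i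
  proof (cases "A i = {}")
    case False
    then obtain a b where "A i \<subseteq> box a b" "cbox a b \<subseteq> D" "cbox (a - e) (b - e) \<subseteq> D"
      using A(4)[of i] by (auto simp: P_def)
    then show ?thesis using A(1)[of i] Y by (intro measure_translate_in_box[of a b]) auto
  qed simp
  have dis: "disjoint_family (\<lambda>i. Y \<inter> A i)" "disjoint_family (\<lambda>i. (\<lambda>x. x + e) -` (Y \<inter> A i))"
    using A(2) by (auto simp: disjoint_family_on_def)
  have meas: "Y \<inter> A i \<in> sets m" "(\<lambda>x. x + e) -` (Y \<inter> A i) \<in> sets m" for i
    using Y A(1) measurable_sets[of "\<lambda>x. x + e" borel borel "Y \<inter> A i"] by (auto simp: sets_m)
  have "emeasure m Y = (\<Sum>i. emeasure m (Y \<inter> A i))"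
    using A(3) meas dis(1) by (subst suminf_emeasure) (auto intro!: arg_cong[where f="emeasure m"])
  also have "\<dots> = (\<Sum>i. emeasure m ((\<lambda>x. x + e) -` (Y \<inter> A i)))" by (simp only: eq)
  also have "\<dots> = emeasure m (\<Union>i. (\<lambda>x. x + e) -` (Y \<inter> A i))"
    using meas dis(2) by (subst suminf_emeasure) auto
  also have "(\<Union>i. (\<lambda>x. x + e) -` (Y \<inter> A i)) = (\<lambda>x. x + e) -` Y"
    using A(3) by fastforce
  finally show ?thesis ..
qed

end

text \<open>The usual uniqueness argument for Haar measure.\<close>

lemma translation_invariant_on_ball:
  fixes \<mu> :: "'a::euclidean_space measure"
  assumes sets_mu [measurable_cong]: "sets \<mu> = sets borel" and fin: "emeasure \<mu> (ball 0 R) < \<infinity>"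
    and inv: "\<And>W y. W \<in> sets borel \<Longrightarrow> W \<subseteq> ball 0 R \<Longrightarrow> (\<lambda>x. x + y) -` W \<subseteq> ball 0 R \<Longrightarrow>
       emeasure \<mu> ((\<lambda>x. x + y) -` W) = emeasure \<mu> W"
    and W [measurable]: "W \<in> sets borel" and \<delta>: "0 < \<delta>" "\<delta> \<le> R" and sub: "W \<subseteq> ball 0 (R - \<delta>)"
  shows "emeasure \<mu> W * emeasure lborel (ball 0 \<delta> :: 'a set) = emeasure \<mu> (ball 0 \<delta>) * emeasure lborel W"
proof -
  \<comment> \<open>The truncation to the large ball is a finite measure, as Fubini's theorem
    demands.\<close>
  define M where "M = density \<mu> (indicator (ball 0 R))"
  have [measurable_cong]: "sets M = sets borel" by (simp add: M_def sets_mu)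
  have M: "emeasure M Z = emeasure \<mu> Z" if "Z \<in> sets borel" "Z \<subseteq> ball 0 R" for Z
  proof -
    have "emeasure M Z = emeasure \<mu> (ball 0 R \<inter> Z)"
      unfolding M_def using that
      by (subst emeasure_density) (auto simp: sets_mu indicator_inter_arith[symmetric] intro!: borel_measurable_indicator)
    with that show ?thesis by (simp add: Int_absorb1)
  qed
  have "emeasure M (space M) = emeasure \<mu> (ball 0 R)"
    unfolding M_def using sets_eq_imp_space_eq[OF sets_mu]
    by (subst emeasure_density) (auto simp: sets_mu intro!: borel_measurable_indicator)
  then interpret M: finite_measure M using fin by (intro finite_measureI) auto
  interpret P: pair_sigma_finite M lborel
    by (intro pair_sigma_finite.intro M.sigma_finite_measure_axioms lborel.sigma_finite_measure_axioms)
  interpret P': pair_sigma_finite lborel M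
    by (intro pair_sigma_finite.intro M.sigma_finite_measure_axioms lborel.sigma_finite_measure_axioms)
  have vim [measurable]: "(\<lambda>x. x + y) -` W \<in> sets borel" for y
    using measurable_sets[of "\<lambda>x. x + y" borel borel W] by simp
  have g1: "(\<lambda>p::'a \<times> 'a. indicator (ball 0 \<delta>) (snd p) * indicator W (fst p + snd p) :: ennreal)
      \<in> borel_measurable (borel \<Otimes>\<^sub>M borel)"
    by (intro borel_measurable_times_ennreal measurable_compose[OF measurable_snd borel_measurable_indicator]
        measurable_compose[OF _ borel_measurable_indicator[OF W]] borel_measurable_add) auto
  have g2: "(\<lambda>p::'a \<times> 'a. indicator (ball 0 \<delta>) (fst p - snd p) * indicator W (fst p) :: ennreal)
      \<in> borel_measurable (borel \<Otimes>\<^sub>M borel)"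
    by (intro borel_measurable_times_ennreal measurable_compose[OF measurable_fst borel_measurable_indicator]
        measurable_compose[OF _ borel_measurable_indicator[of "ball 0 \<delta>" borel]] borel_measurable_diff) auto
  have pair_sets: "sets (M \<Otimes>\<^sub>M lborel) = sets (borel \<Otimes>\<^sub>M borel)" "sets (lborel \<Otimes>\<^sub>M M) = sets (borel \<Otimes>\<^sub>M borel)"
    by (intro sets_pair_measure_cong; simp add: M_def sets_mu)+
  have subW: "W \<subseteq> ball 0 R" using sub \<delta> by (auto simp: subset_iff)
  \<comment> \<open>The margin \<open>\<delta>\<close> is spent here: translates of \<open>W\<close>
    by vectors shorter than \<open>\<delta>\<close> stay in the ball of radius
    \<open>R\<close>.\<close>
  have trW: "emeasure M ((\<lambda>x. x + y) -` W) = emeasure \<mu> W" if "y \<in> ball 0 \<delta>" for y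
  proof -
    have "(\<lambda>x. x + y) -` W \<subseteq> ball 0 R"
    proof
      fix x assume "x \<in> (\<lambda>x. x + y) -` W"
      then have "norm (x + y) < R - \<delta>" using sub by auto
      moreover have "norm x \<le> norm (x + y) + norm y" using norm_triangle_ineq4[of "x + y" y] by simp
      ultimately show "x \<in> ball 0 R" using that by auto
    qed
    then show ?thesis using M[OF vim] inv[OF W subW] by simp
  qed
  \<comment> \<open>Both sides are the double integral of
    \<open>indicator (ball 0 \<delta>) y * indicator W (x + y)\<close>. Integrating first over
    \<open>x\<close> uses the invariance of \<open>W\<close>; substituting \<open>w = x + y\<close>
    first uses the invariance of the ball around \<open>w\<close>.\<close>
  have "emeasure \<mu> W * emeasure lborel (ball 0 \<delta> :: 'a set)
      = (\<integral>\<^sup>+y. emeasure \<mu> W * indicator (ball 0 \<delta> :: 'a set) y \<partial>lborel)"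
    by (simp add: nn_integral_cmult_indicator)
  also have "\<dots> = (\<integral>\<^sup>+y. \<integral>\<^sup>+x. indicator (ball 0 \<delta>) y * indicator W (x + y) \<partial>M \<partial>lborel)"
  proof (intro nn_integral_cong)
    fix y :: 'a
    have "(\<integral>\<^sup>+x. indicator (ball 0 \<delta>) y * indicator W (x + y) \<partial>M)
        = indicator (ball 0 \<delta>) y * (\<integral>\<^sup>+x. indicator ((\<lambda>x. x + y) -` W) x \<partial>M)"
      by (subst nn_integral_cmult[symmetric]) (auto intro!: nn_integral_cong simp: indicator_def)
    also have "\<dots> = indicator (ball 0 \<delta>) y * emeasure M ((\<lambda>x. x + y) -` W)"
      by (subst nn_integral_indicator) auto
    finally show "emeasure \<mu> W * indicator (ball 0 \<delta>) y
        = (\<integral>\<^sup>+x. indicator (ball 0 \<delta>) y * indicator W (x + y) \<partial>M)"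
      using trW[of y] by (auto simp: indicator_def)
  qed
  also have "\<dots> = (\<integral>\<^sup>+x. \<integral>\<^sup>+y. indicator (ball 0 \<delta>) y * indicator W (x + y) \<partial>lborel \<partial>M)"
    by (rule P.Fubini') (use g1 in \<open>simp add: pair_sets split_beta cong: measurable_cong_sets\<close>)
  also have "\<dots> = (\<integral>\<^sup>+x. \<integral>\<^sup>+w. indicator (ball 0 \<delta>) (w - x) * indicator W w \<partial>lborel \<partial>M)"
  proof (rule nn_integral_cong)
    fix x :: 'a
    have g3: "(\<lambda>w::'a. indicator (ball 0 \<delta>) (w - x) * indicator W w :: ennreal) \<in> borel_measurable borel"
      by (intro borel_measurable_times_ennreal borel_measurable_indicator W
          measurable_compose[OF _ borel_measurable_indicator[of "ball 0 \<delta>" borel]] borel_measurable_diff) auto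
    have "(\<integral>\<^sup>+w. indicator (ball 0 \<delta>) (w - x) * indicator W w \<partial>distr lborel borel ((+) x))
       = (\<integral>\<^sup>+y. indicator (ball 0 \<delta>) y * indicator W (x + y) \<partial>lborel)"
      by (subst nn_integral_distr) (use g3 in auto)
    then show "(\<integral>\<^sup>+y. indicator (ball 0 \<delta>) y * indicator W (x + y) \<partial>lborel)
       = (\<integral>\<^sup>+w. indicator (ball 0 \<delta>) (w - x) * indicator W w \<partial>lborel)"
      by (simp add: lborel_distr_plus)
  qed
  also have "\<dots> = (\<integral>\<^sup>+w. \<integral>\<^sup>+x. indicator (ball 0 \<delta>) (w - x) * indicator W w \<partial>M \<partial>lborel)"
    by (rule P'.Fubini') (use g2 in \<open>simp add: pair_sets split_beta cong: measurable_cong_sets\<close>)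
  also have "\<dots> = (\<integral>\<^sup>+w. emeasure \<mu> (ball 0 \<delta>) * indicator W w \<partial>lborel)"
  proof (intro nn_integral_cong)
    fix w :: 'a
    have "emeasure M (ball w \<delta>) = emeasure \<mu> (ball 0 \<delta>)" if "w \<in> W"
    proof -
      have "norm w < R - \<delta>" using that sub by auto
      have b: "ball w \<delta> \<subseteq> ball 0 R"
      proof
        fix x assume "x \<in> ball w \<delta>"
        then show "x \<in> ball 0 R"
          using norm_triangle_ineq[of w "x - w"] \<open>norm w < R - \<delta>\<close> by (simp add: dist_norm norm_minus_commute)
      qed
      have "(\<lambda>x. x + w) -` ball w \<delta> = ball 0 \<delta>" "ball 0 \<delta> \<subseteq> (ball 0 R :: 'a set)"
        using \<delta> by (auto simp: dist_norm)
      then show ?thesis using inv[of "ball w \<delta>" w] b \<delta> M[of "ball w \<delta>"] by simp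
    qed
    moreover have "(\<integral>\<^sup>+x. indicator (ball 0 \<delta>) (w - x) * indicator W w \<partial>M)
        = indicator W w * emeasure M (ball w \<delta>)"
    proof -
      have "(\<integral>\<^sup>+x. indicator (ball 0 \<delta>) (w - x) * indicator W w \<partial>M)
          = (\<integral>\<^sup>+x. indicator W w * indicator (ball w \<delta>) x \<partial>M)"
        by (intro nn_integral_cong) (auto simp: indicator_def dist_norm norm_minus_commute)
      then show ?thesis by (simp add: nn_integral_cmult_indicator)
    qed
    ultimately show "(\<integral>\<^sup>+x. indicator (ball 0 \<delta>) (w - x) * indicator W w \<partial>M)
       = emeasure \<mu> (ball 0 \<delta>) * indicator W w" by (auto simp: indicator_def)
  qed
  also have "\<dots> = emeasure \<mu> (ball 0 \<delta>) * emeasure lborel W"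
    by (simp add: nn_integral_cmult_indicator)
  finally show ?thesis .
qed

section \<open>Measures on flow boxes\<close>

definition polydisc :: "(complex^'n) set" where
  "polydisc = {x. \<forall>j. cmod (x $ j) < 1}"

text \<open>The space of plaques of a flow box is modelled by the slice where the leaf coordinate is
  0, which avoids a second coordinate type with one index fewer.\<close>

definition transverse :: "'n \<Rightarrow> complex^'n \<Rightarrow> complex^'n" where
  "transverse k x = (\<chi> j. if j = k then 0 else x $ j)"

definition cylinder :: "'n \<Rightarrow> complex set \<Rightarrow> (complex^'n) set \<Rightarrow> (complex^'n) set" where
  "cylinder k W Q = {x. x $ k \<in> W \<and> transverse k x \<in> Q}"

lemma same_transverse_iff: "same_transverse k x y \<longleftrightarrow> transverse k x = transverse k y"
  by (auto simp: same_transverse_def transverse_def vec_eq_iff)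

lemma transverse_nth [simp]: "transverse k x $ j = (if j = k then 0 else x $ j)"
  by (simp add: transverse_def)

lemma transverse_add_axis [simp]: "transverse k (x + axis k w) = transverse k x"
  by (simp add: vec_eq_iff axis_def)

lemma continuous_on_transverse [continuous_intros]:
  fixes f :: "'a::topological_space \<Rightarrow> complex^'n::finite"
  assumes "continuous_on S f"
  shows "continuous_on S (\<lambda>x. transverse k (f x))"
proof -
  have "continuous_on S (\<lambda>x. if j = k then 0 else f x $ j)" for j
    using assms by (cases "j = k") (auto intro!: continuous_intros)
  then show ?thesis unfolding transverse_def by (rule continuous_on_vec_lambda)
qed

lemma polydisc_eq_INT: "polydisc = (\<Inter>j. (\<lambda>x::complex^'n. x $ j) -` ball 0 1)"
  by (auto simp: polydisc_def)

lemma open_polydisc: "open (polydisc :: (complex^'n::finite) set)"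
  unfolding polydisc_eq_INT by (intro open_INT ballI open_vimage continuous_intros) auto

lemma convex_polydisc: "convex (polydisc :: (complex^'n::finite) set)"
  unfolding polydisc_eq_INT
  by (intro convex_INT convex_linear_vimage bounded_linear.linear bounded_linear_vec_nth convex_ball)

lemma compact_closed_polydisc: "compact {x::complex^'n::finite. \<forall>j. cmod (x $ j) \<le> r}"
proof -
  have "norm x \<le> (\<Sum>j\<in>(UNIV::'n set). r)" if "\<forall>j. cmod (x $ j) \<le> r" for x :: "complex^'n"
    unfolding norm_vec_def by (rule order.trans[OF L2_set_le_sum sum_mono]) (use that in auto)
  then have "bounded {x::complex^'n. \<forall>j. cmod (x $ j) \<le> r}" unfolding bounded_iff by blast
  moreover have "closed {x::complex^'n. \<forall>j. cmod (x $ j) \<le> r}"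
    by (intro closed_Collect_all closed_Collect_le continuous_intros)
  ultimately show ?thesis by (simp add: compact_eq_bounded_closed)
qed

lemma borel_measurable_transverse [measurable]:
  "(transverse k :: complex^'n::finite \<Rightarrow> _) \<in> borel_measurable borel"
  using continuous_on_transverse[of UNIV "\<lambda>x. x" k] by (intro borel_measurable_continuous_onI) auto

lemma borel_measurable_vec_nth' [measurable]:
  "(\<lambda>x::complex^'n::finite. x $ k) \<in> borel_measurable borel"
  by (intro borel_measurable_continuous_onI continuous_intros)

lemma cylinder_borel [measurable]:
  fixes Q :: "(complex^'n::finite) set"
  assumes [measurable]: "W \<in> sets borel" "Q \<in> sets borel"
  shows "cylinder k W Q \<in> sets borel"
proof -
  have "cylinder k W Q = ((\<lambda>x. x $ k) -` W \<inter> space borel) \<inter> (transverse k -` Q \<inter> space borel)"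
    by (auto simp: cylinder_def)
  also have "\<dots> \<in> sets borel" by measurable
  finally show ?thesis .
qed

lemma cylinder_subset_polydisc: "W \<subseteq> ball 0 1 \<Longrightarrow> Q \<subseteq> polydisc \<Longrightarrow> cylinder k W Q \<subseteq> polydisc"
  unfolding cylinder_def polydisc_def by (force split: if_splits)

lemma emeasure_lborel_complex_ball:
  "\<rho> \<ge> 0 \<Longrightarrow> emeasure lborel (ball (b::complex) \<rho>) = ennreal (\<rho>\<^sup>2) * ennreal (unit_ball_vol 2)"
  by (subst emeasure_ball) (auto simp: ennreal_mult'[symmetric] unit_ball_vol_nonneg mult.commute)

text \<open>For fixed \<open>Q\<close>, the mass of \<open>cylinder k W Q\<close> as a function of
  \<open>W\<close> is a measure on the disc that is invariant under translations staying in a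
  smaller disc, hence proportional to area there. The discs of radius \<rho> and 1/2 have area ratio
  \<open>4 * \<rho>\<^sup>2\<close>. The bound \<open>r < 1\<close> keeps the cylinder in a compact
  part of the polydisc, where \<open>m\<close> is finite.\<close>

lemma cylinder_measure_bounded:
  fixes m :: "(complex^'n::finite) measure"
  assumes dnull: "\<And>w. derivative_null_measure m polydisc (axis k w)"
    and Q [measurable]: "Q \<in> sets borel" and r: "r < 1" "\<And>x j. x \<in> Q \<Longrightarrow> cmod (x $ j) \<le> r"
    and b: "cmod b + \<rho> < 1" "\<rho> > 0"
  shows "emeasure m (cylinder k (ball b \<rho>) Q) = ennreal (4 * \<rho>\<^sup>2) * emeasure m (cylinder k (ball 0 (1/2)) Q)"
proof -
  interpret derivative_null_measure m polydisc "axis k 0" by (rule dnull)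
  define \<mu> where "\<mu> = distr (density m (indicator (transverse k -` Q))) borel (\<lambda>x. x $ k)"
  have vQ [measurable]: "transverse k -` Q \<in> sets borel"
    using measurable_sets[OF borel_measurable_transverse Q, of k] by simp
  have \<mu>: "emeasure \<mu> W = emeasure m (cylinder k W Q)" if [measurable]: "W \<in> sets borel" for W
  proof -
    have [measurable]: "(\<lambda>x::complex^'n. x $ k) -` W \<in> sets borel"
      using measurable_sets[OF borel_measurable_vec_nth' that, of k] by simp
    have "emeasure \<mu> W = emeasure m ((transverse k -` Q) \<inter> (\<lambda>x. x $ k) -` W)"
      unfolding \<mu>_def
      by (subst emeasure_distr)
         (auto simp: emeasure_density sets_m indicator_inter_arith[symmetric] sets_eq_imp_space_eq[OF sets_m])
    also have "(transverse k -` Q) \<inter> (\<lambda>x. x $ k) -` W = cylinder k W Q" by (auto simp: cylinder_def)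
    finally show ?thesis .
  qed
  have QD: "Q \<subseteq> polydisc" by (auto simp: polydisc_def intro: le_less_trans[OF r(2) r(1)])
  \<comment> \<open>\<open>R\<close> lies halfway between 1 and the radius needed to contain both
    discs; \<open>\<delta>\<close> is the margin left over for the Haar argument.\<close>
  define R where "R = (1 + max (cmod b + \<rho>) (1/2)) / 2"
  define \<delta> where "\<delta> = R - max (cmod b + \<rho>) (1/2)"
  have R: "R < 1" "0 < \<delta>" "\<delta> \<le> R" "cmod b + \<rho> \<le> R - \<delta>" "1/2 \<le> R - \<delta>"
    using b by (auto simp: R_def \<delta>_def max_def field_simps)
  have fin: "emeasure \<mu> (ball 0 R) < \<infinity>"
  proof -
    have "cylinder k (ball 0 R) Q \<subseteq> {x. \<forall>j. cmod (x $ j) \<le> max R r}"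
    proof
      fix x assume x: "x \<in> cylinder k (ball 0 R) Q"
      have "cmod (x $ j) \<le> max R r" for j
      proof (cases "j = k")
        case True then show ?thesis using x by (auto simp: cylinder_def)
      next
        case False then show ?thesis using x r(2)[of "transverse k x" j] by (auto simp: cylinder_def)
      qed
      then show "x \<in> {x. \<forall>j. cmod (x $ j) \<le> max R r}" by blast
    qed
    then have "emeasure m (cylinder k (ball 0 R) Q) \<le> emeasure m {x. \<forall>j. cmod (x $ j) \<le> max R r}"
      by (intro emeasure_mono) (auto simp: sets_m borel_compact[OF compact_closed_polydisc])
    also have "\<dots> < \<infinity>"
    proof (rule finite_compact[OF compact_closed_polydisc])
      have "max R r < 1" using R r(1) by simp
      then show "{x. \<forall>j. cmod (x $ j) \<le> max R r} \<subseteq> polydisc"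
        unfolding polydisc_def by (blast intro: le_less_trans)
    qed
    finally show ?thesis by (simp add: \<mu>)
  qed
  have inv: "emeasure \<mu> ((\<lambda>x. x + y) -` W) = emeasure \<mu> W"
    if [measurable]: "W \<in> sets borel" and sub: "W \<subseteq> ball 0 R" "(\<lambda>x. x + y) -` W \<subseteq> ball 0 R" for W y
  proof -
    have [measurable]: "(\<lambda>x. x + y) -` W \<in> sets borel"
      using measurable_sets[of "\<lambda>x. x + y" borel borel W] by simp
    have eq: "cylinder k ((\<lambda>x. x + y) -` W) Q = (\<lambda>x. x + axis k y) -` cylinder k W Q"
      by (auto simp: cylinder_def)
    interpret y: derivative_null_measure m polydisc "axis k y" by (rule dnull)
    have W1: "W \<subseteq> ball 0 1" and W2: "(\<lambda>x. x + y) -` W \<subseteq> ball 0 1"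
      using sub subset_ball[of R 1 "0::complex"] R by (meson less_imp_le subset_trans)+
    have "emeasure m (cylinder k ((\<lambda>x. x + y) -` W) Q) = emeasure m (cylinder k W Q)"
      unfolding eq
      by (rule y.measure_translate)
         (use cylinder_subset_polydisc[OF W1 QD, of k] cylinder_subset_polydisc[OF W2 QD, of k] in \<open>auto simp: eq\<close>)
    then show ?thesis by (simp add: \<mu>)
  qed
  have sets: "sets \<mu> = sets borel" by (simp add: \<mu>_def)
  have haar: "emeasure \<mu> W * emeasure lborel (ball (0::complex) \<delta>) = emeasure \<mu> (ball 0 \<delta>) * emeasure lborel W"
    if "W \<in> sets borel" "W \<subseteq> ball 0 (R - \<delta>)" for W
    by (rule translation_invariant_on_ball[OF sets fin _ that(1) R(2,3) that(2)]) (rule inv)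
  define L where "L = emeasure lborel (ball (0::complex) \<delta>)"
  define U where "U = ennreal (unit_ball_vol 2)"
  have sub: "ball b \<rho> \<subseteq> ball 0 (R - \<delta>)" "ball (0::complex) (1/2) \<subseteq> ball 0 (R - \<delta>)"
    using R b by (auto simp: ball_subset_ball_iff dist_norm)
  have 1: "emeasure \<mu> (ball b \<rho>) * L = emeasure \<mu> (ball 0 \<delta>) * (ennreal (\<rho>\<^sup>2) * U)"
    and 2: "emeasure \<mu> (ball 0 (1/2)) * L = emeasure \<mu> (ball 0 \<delta>) * (ennreal ((1/2)\<^sup>2) * U)"
    using haar[OF _ sub(1)] haar[OF _ sub(2)] b emeasure_lborel_complex_ball[of \<rho> b]
      emeasure_lborel_complex_ball[of "1/2" 0] unfolding L_def U_def by simp_all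
  have "ennreal (4 * \<rho>\<^sup>2) * ennreal ((1/2)\<^sup>2) = ennreal (\<rho>\<^sup>2)"
    by (simp add: ennreal_mult'[symmetric] power2_eq_square)
  then have "(ennreal (4 * \<rho>\<^sup>2) * emeasure \<mu> (ball 0 (1/2))) * L = emeasure \<mu> (ball 0 \<delta>) * (ennreal (\<rho>\<^sup>2) * U)"
    unfolding mult.assoc 2 by (metis mult.assoc mult.left_commute)
  then have "emeasure \<mu> (ball b \<rho>) * L = (ennreal (4 * \<rho>\<^sup>2) * emeasure \<mu> (ball 0 (1/2))) * L"
    using 1 by simp
  moreover have "L \<noteq> 0" "L \<noteq> \<infinity>"
    using emeasure_lborel_complex_ball[of \<delta> 0] R(2) emeasure_lborel_ball_finite[of 0 \<delta>] unit_ball_vol_2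
    by (auto simp: L_def ennreal_mult_eq_top_iff)
  ultimately show ?thesis by (auto simp: \<mu> mult.commute[of _ L] ennreal_mult_cancel_left)
qed

text \<open>Exhaustion of \<open>Q\<close> by sets that stay away from the boundary of the polydisc;
  both sides are continuous from below, so infinite values are allowed.\<close>

theorem cylinder_measure:
  fixes m :: "(complex^'n::finite) measure"
  assumes dnull: "\<And>w. derivative_null_measure m polydisc (axis k w)"
    and Q [measurable]: "Q \<in> sets borel" and QD: "Q \<subseteq> polydisc"
    and b: "cmod b + \<rho> < 1" "\<rho> > 0"
  shows "emeasure m (cylinder k (ball b \<rho>) Q) = ennreal (4 * \<rho>\<^sup>2) * emeasure m (cylinder k (ball 0 (1/2)) Q)"
proof -
  interpret derivative_null_measure m polydisc "axis k 0" by (rule dnull)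
  define P where "P i = Q \<inter> {x. \<forall>j. cmod (x $ j) \<le> 1 - 1 / real (Suc i)}" for i
  have [measurable]: "P i \<in> sets borel" for i
    unfolding P_def by (intro sets.Int Q borel_compact compact_closed_polydisc)
  have inc: "incseq P"
    unfolding incseq_def P_def by (auto intro: order.trans simp: frac_le)
  have QP: "Q = (\<Union>i. P i)"
  proof -
    have "\<exists>i. x \<in> P i" if x: "x \<in> Q" for x
    proof -
      have "finite (range (\<lambda>j. cmod (x $ j)))" by simp
      moreover define M where "M = Max (range (\<lambda>j. cmod (x $ j)))"
      ultimately have "M \<in> range (\<lambda>j. cmod (x $ j))" and M: "\<And>j. cmod (x $ j) \<le> M"
        unfolding M_def by (auto intro: Max_in)
      then have "M < 1" using x QD by (auto simp: polydisc_def)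
      then obtain i where "1 / real (Suc i) < 1 - M" using nat_approx_posE[of "1 - M"] by auto
      then have "cmod (x $ j) \<le> 1 - 1 / real (Suc i)" for j using M[of j] by linarith
      then show ?thesis using x by (auto simp: P_def)
    qed
    then show ?thesis by (auto simp: P_def)
  qed
  have cyl: "emeasure m (cylinder k W Q) = (SUP i. emeasure m (cylinder k W (P i)))" if [measurable]: "W \<in> sets borel" for W
  proof -
    have "cylinder k W Q = (\<Union>i. cylinder k W (P i))" using QP by (auto simp: cylinder_def)
    moreover have "incseq (\<lambda>i. cylinder k W (P i))"
      using inc unfolding incseq_def cylinder_def by blast
    moreover have "range (\<lambda>i. cylinder k W (P i)) \<subseteq> sets m" by (auto simp: sets_m)
    ultimately show ?thesis by (simp add: SUP_emeasure_incseq)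
  qed
  have eq: "emeasure m (cylinder k (ball b \<rho>) (P i)) = ennreal (4 * \<rho>\<^sup>2) * emeasure m (cylinder k (ball 0 (1/2)) (P i))" for i
    by (rule cylinder_measure_bounded[where r="1 - 1 / real (Suc i)", OF dnull _ _ _ b]) (auto simp: P_def)
  show ?thesis
    by (simp add: cyl eq SUP_mult_left_ennreal[symmetric])
qed

section \<open>Dolbeault operators on functions\<close>

lemma complex_smult_eq: "(a::complex) *s v = Re a *\<^sub>R v + Im a *\<^sub>R (\<i> *s v)"
proof -
  have "a * x = Re a *\<^sub>R x + Im a *\<^sub>R (\<i> * x)" for x
    by (subst complex_eq[of a]) (simp add: scaleR_conv_of_real algebra_simps)
  then show ?thesis by (simp add: vec_eq_iff)
qed

lemma d01_add:
  assumes "f differentiable (at x)"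
  shows "d01 f x (v + w) = d01 f x v + d01 f x w"
proof -
  interpret linear "frechet_derivative f (at x)"
    using assms by (simp add: linear_frechet_derivative)
  show ?thesis by (simp add: d01_def vector_add_ldistrib add algebra_simps add_divide_distrib)
qed

lemma d01_smult:
  assumes "f differentiable (at x)"
  shows "d01 f x (a *s v) = cnj a * d01 f x v"
proof -
  let ?D = "frechet_derivative f (at x)"
  interpret linear ?D
    using assms by (simp add: linear_frechet_derivative)
  have 1: "?D (a *s v) = of_real (Re a) * ?D v + of_real (Im a) * ?D (\<i> *s v)" for a v
    unfolding complex_smult_eq[of a v] add scale by (simp add: scaleR_conv_of_real)
  have 2: "\<i> *s (a *s v) = (\<i> * a) *s v" by simp
  have cn: "cnj a = of_real (Re a) - \<i> * of_real (Im a)" by (simp add: complex_eq_iff)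
  show ?thesis
    unfolding d01_def 2 1[of a] 1[of "\<i> * a"] cn by (simp add: algebra_simps diff_divide_distrib add_divide_distrib)
qed

lemma vec_complex_expansion: "(v::complex^'n::finite) = (\<Sum>j\<in>UNIV. v $ j *s axis j 1)"
  by (simp add: vec_eq_iff axis_def if_distrib sum.delta cong: if_cong)

lemma d01_sum:
  assumes "f differentiable (at x)"
  shows "d01 f x (\<Sum>i\<in>I. v i) = (\<Sum>i\<in>I. d01 f x (v i))"
proof (induction I rule: infinite_finite_induct)
  case (insert i I) then show ?case by (simp add: d01_add[OF assms])
qed (use d01_smult[OF assms, of 0] in auto)

lemma d01_components:
  assumes "f differentiable (at x)"
  shows "d01 f x v = (\<Sum>j\<in>UNIV. d01 f x (axis j 1) * cnj (v $ j))"
proof -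
  have "d01 f x (\<Sum>j\<in>UNIV. v $ j *s axis j 1) = (\<Sum>j\<in>UNIV. d01 f x (axis j 1) * cnj (v $ j))"
    by (simp only: d01_sum[OF assms] d01_smult[OF assms] mult.commute)
  then show ?thesis by (simp only: vec_complex_expansion[symmetric])
qed

lemma d01_cong_open:
  "open S \<Longrightarrow> x \<in> S \<Longrightarrow> (\<And>y. y \<in> S \<Longrightarrow> f y = g y) \<Longrightarrow> d01 f x v = d01 g x v"
  unfolding d01_def using frechet_derivative_cong_open[of S x f g] by simp

lemma d10_cong_open:
  "open S \<Longrightarrow> x \<in> S \<Longrightarrow> (\<And>y. y \<in> S \<Longrightarrow> f y = g y) \<Longrightarrow> d10 f x v = d10 g x v"
  unfolding d10_def using frechet_derivative_cong_open[of S x f g] by simp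

lemma d01_zero [simp]: "d01 (\<lambda>x. 0) x v = 0" and d10_zero [simp]: "d10 (\<lambda>x. 0) x v = 0"
  by (simp_all add: d01_def d10_def)

lemma d01_holomorphic:
  assumes "holomorphic_fun_on S f" "x \<in> S"
  shows "d01 f x v = 0"
  unfolding d01_def using holomorphic_fun_onD(2)[OF assms, of \<i>] by simp

lemma frechet_derivative_diff:
  assumes "f differentiable (at x)" "g differentiable (at x)"
  shows "frechet_derivative (\<lambda>x. f x - g x) (at x) v = frechet_derivative f (at x) v - frechet_derivative g (at x) v"
proof -
  have "((\<lambda>x. f x - g x) has_derivative (\<lambda>v. frechet_derivative f (at x) v - frechet_derivative g (at x) v)) (at x)"
    using assms by (intro has_derivative_diff) (simp_all add: frechet_derivative_works)
  from fun_cong[OF frechet_derivative_at[OF this], of v] show ?thesis by simp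
qed

lemma frechet_derivative_mult:
  fixes f g :: "_ \<Rightarrow> complex"
  assumes "f differentiable (at x)" "g differentiable (at x)"
  shows "frechet_derivative (\<lambda>x. f x * g x) (at x) v
    = f x * frechet_derivative g (at x) v + frechet_derivative f (at x) v * g x"
proof -
  have "((\<lambda>x. f x * g x) has_derivative (\<lambda>v. f x * frechet_derivative g (at x) v + frechet_derivative f (at x) v * g x)) (at x)"
    using assms by (intro has_derivative_mult) (simp_all add: frechet_derivative_works)
  from fun_cong[OF frechet_derivative_at[OF this], of v] show ?thesis by simp
qed

lemma d01_diff:
  assumes "f differentiable (at x)" "g differentiable (at x)"
  shows "d01 (\<lambda>x. f x - g x) x v = d01 f x v - d01 g x v"
  by (simp add: d01_def frechet_derivative_diff[OF assms] algebra_simps diff_divide_distrib add_divide_distrib)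

lemma d01_mult_holomorphic:
  assumes "f differentiable (at x)" "holomorphic_fun_on S g" "x \<in> S"
  shows "d01 (\<lambda>x. f x * g x) x v = d01 f x v * g x"
proof -
  have g: "g differentiable (at x)" using holomorphic_fun_onD(1)[OF assms(2,3)] by (rule differentiableI)
  have "d01 (\<lambda>x. f x * g x) x v = d01 f x v * g x + f x * d01 g x v"
    by (simp add: d01_def frechet_derivative_mult[OF assms(1) g] algebra_simps add_divide_distrib)
  then show ?thesis by (simp add: d01_holomorphic[OF assms(2,3)])
qed

lemma smooth_on_d01:
  fixes f :: "complex^'n::finite \<Rightarrow> complex"
  assumes "open S" "smooth_on S f"
  shows "smooth_on S (\<lambda>x. d01 f x v)"
proof -
  have "smooth_on S (\<lambda>x. (1/2) * (frechet_derivative f (at x) v + \<i> * frechet_derivative f (at x) (\<i> *s v)))"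
    by (intro smooth_on_mult smooth_on_add smooth_on_const smooth_on_frechet_derivative assms)
  then show ?thesis by (simp add: d01_def)
qed

text \<open>This is delbar squared = 0 on functions, reduced to the symmetry of the real second
  derivatives.\<close>

lemma d01_d01_symmetric:
  fixes f :: "complex^'n::finite \<Rightarrow> complex"
  assumes S: "open S" and f: "smooth_on S f" and x: "x \<in> S"
  shows "d01 (\<lambda>x. d01 f x v) x u = d01 (\<lambda>x. d01 f x u) x v"
proof -
  have fr: "frechet_derivative (\<lambda>x. d01 f x v) (at x) u
      = (nderiv [u, v] f x + \<i> * nderiv [u, \<i> *s v] f x) / 2" for u v
  proof -
    have d: "((\<lambda>x. frechet_derivative f (at x) w) has_derivative (\<lambda>u. nderiv [u, w] f x)) (at x)" for w
      using smooth_on_has_derivative[OF smooth_on_frechet_derivative[OF f] x] by simp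
    have "((\<lambda>x. d01 f x v) has_derivative (\<lambda>u. (nderiv [u, v] f x + \<i> * nderiv [u, \<i> *s v] f x) / 2)) (at x)"
      using has_derivative_mult_right[OF has_derivative_add[OF d[of v] has_derivative_mult_right[OF d, of \<i>]], of "1/2"]
      by (simp add: d01_def)
    from fun_cong[OF frechet_derivative_at[OF this], of u] show ?thesis by simp
  qed
  have sym: "nderiv [u, v] f x = nderiv [v, u] f x" for u v
    by (rule second_derivative_symmetric[OF S f x])
  show ?thesis
    unfolding d01_def[of "\<lambda>x. d01 f x _"] fr
    by (subst sym[of u v], subst sym[of u "\<i> *s v"], subst sym[of "\<i> *s u" v], subst sym[of "\<i> *s u" "\<i> *s v"])
       (simp add: algebra_simps add_divide_distrib)
qed

section \<open>Charts of a compact complex manifold\<close>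

locale compact_complex_manifold =
  fixes A :: "('a::t2_space, 'n::finite) chart set"
  assumes complex_structure: "complex_structure A"
    and compact_UNIV: "compact (UNIV :: 'a set)"
begin

lemma chart_is_chart: "c \<in> A \<Longrightarrow> is_chart c"
  using complex_structure by (simp add: complex_structure_def)

lemma chart_open: "c \<in> A \<Longrightarrow> open (fst c)" "c \<in> A \<Longrightarrow> open (snd c ` fst c)"
  using chart_is_chart by (auto simp: is_chart_def)

lemma chart_homeomorphism:
  assumes "c \<in> A"
  shows "homeomorphism (fst c) (snd c ` fst c) (snd c) (inv_into (fst c) (snd c))"
proof -
  obtain g where g: "homeomorphism (fst c) (snd c ` fst c) (snd c) g"
    using chart_is_chart[OF assms] by (auto simp: is_chart_def)
  then have inv: "g (snd c p) = p" if "p \<in> fst c" for p using that unfolding homeomorphism_def by blast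
  then have inj: "inj_on (snd c) (fst c)" by (rule inj_on_inverseI)
  have "inv_into (fst c) (snd c) y = g y" if "y \<in> snd c ` fst c" for y
    using that inv inj by (elim imageE) (simp add: inv_into_f_f)
  then show ?thesis by (intro homeomorphism_cong[OF g]) auto
qed

lemma chart_continuous: "c \<in> A \<Longrightarrow> continuous_on (fst c) (snd c)"
  using chart_homeomorphism unfolding homeomorphism_def by blast

lemma chart_inj:
  assumes "c \<in> A" shows "inj_on (snd c) (fst c)"
proof (rule inj_on_inverseI)
  show "inv_into (fst c) (snd c) (snd c p) = p" if "p \<in> fst c" for p
    using chart_homeomorphism[OF assms] that unfolding homeomorphism_def by blast
qed

lemma chart_inv [simp]: "c \<in> A \<Longrightarrow> p \<in> fst c \<Longrightarrow> inv_into (fst c) (snd c) (snd c p) = p"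
  using chart_inj by (simp add: inv_into_f_f)

lemma chart_open_image:
  assumes "c \<in> A" "open U" "U \<subseteq> fst c"
  shows "open (snd c ` U)"
  by (rule openin_open_trans[OF homeomorphism_imp_open_map[OF chart_homeomorphism[OF assms(1)]
        open_subset[OF assms(3,2)]] chart_open(2)[OF assms(1)]])

lemma chart_open_preimage:
  assumes "c \<in> A" "open V"
  shows "open {p \<in> fst c. snd c p \<in> V}"
proof -
  have "open (fst c \<inter> snd c -` V)"
    by (rule continuous_open_preimage[OF chart_continuous[OF assms(1)] chart_open(1)[OF assms(1)] assms(2)])
  moreover have "fst c \<inter> snd c -` V = {p \<in> fst c. snd c p \<in> V}" by auto
  ultimately show ?thesis by simp
qed

lemma chart_compact_preimage:
  assumes "c \<in> A" "compact K" "K \<subseteq> snd c ` fst c"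
  shows "compact {p \<in> fst c. snd c p \<in> K}"
proof -
  have eq: "{p \<in> fst c. snd c p \<in> K} = inv_into (fst c) (snd c) ` K" (is "?L = ?R")
  proof
    show "?L \<subseteq> ?R"
    proof
      fix p assume p: "p \<in> ?L"
      then have "p = inv_into (fst c) (snd c) (snd c p)" using chart_inv[OF assms(1)] by simp
      with p show "p \<in> ?R" by blast
    qed
    show "?R \<subseteq> ?L"
    proof
      fix p assume "p \<in> ?R"
      then obtain y where y: "y \<in> K" "p = inv_into (fst c) (snd c) y" by blast
      then have "y \<in> snd c ` fst c" using assms(3) by blast
      then show "p \<in> ?L"
        using inv_into_into[of y "snd c" "fst c"] f_inv_into_f[of y "snd c" "fst c"] y by simp
    qed
  qed
  have "continuous_on (snd c ` fst c) (inv_into (fst c) (snd c))"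
    using chart_homeomorphism[OF assms(1)] unfolding homeomorphism_def by blast
  then show ?thesis
    unfolding eq using assms(2,3) by (intro compact_continuous_image) (rule continuous_on_subset)
qed

lemma chart_at: "chart_at A p \<in> A" "p \<in> fst (chart_at A p)"
proof -
  have "\<exists>c. c \<in> A \<and> p \<in> fst c" using complex_structure unfolding complex_structure_def by blast
  from someI_ex[OF this] show "chart_at A p \<in> A" "p \<in> fst (chart_at A p)"
    unfolding chart_at_def by auto
qed

abbreviation overlap :: "('a, 'n) chart \<Rightarrow> ('a, 'n) chart \<Rightarrow> (complex^'n) set" where
  "overlap c c' \<equiv> snd c ` (fst c \<inter> fst c')"

lemma open_overlap: "c \<in> A \<Longrightarrow> c' \<in> A \<Longrightarrow> open (overlap c c')"
  by (intro chart_open_image) (auto intro: chart_open)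

lemma trans_map_apply: "c \<in> A \<Longrightarrow> p \<in> fst c \<Longrightarrow> trans_map c c' (snd c p) = snd c' p"
  by (simp add: trans_map_def)

lemma trans_map_holomorphic: "c \<in> A \<Longrightarrow> c' \<in> A \<Longrightarrow> holomorphic_map_on (overlap c c') (trans_map c c')"
  using complex_structure unfolding complex_structure_def compatible_def by blast

lemma trans_map_smooth: "c \<in> A \<Longrightarrow> c' \<in> A \<Longrightarrow> smooth_on (overlap c c') (trans_map c c')"
  by (intro holomorphic_map_on_smooth open_overlap trans_map_holomorphic)

lemma trans_map_has_derivative:
  "c \<in> A \<Longrightarrow> c' \<in> A \<Longrightarrow> x \<in> overlap c c' \<Longrightarrow> (trans_map c c' has_derivative dtrans c c' x) (at x)"
  unfolding dtrans_def by (rule holomorphic_map_onD(1)[OF trans_map_holomorphic])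

lemma dtrans_smult:
  "c \<in> A \<Longrightarrow> c' \<in> A \<Longrightarrow> x \<in> overlap c c' \<Longrightarrow> dtrans c c' x (a *s v) = a *s dtrans c c' x v"
  unfolding dtrans_def by (rule holomorphic_map_onD(2)[OF trans_map_holomorphic])

lemma dtrans_linear: "c \<in> A \<Longrightarrow> c' \<in> A \<Longrightarrow> x \<in> overlap c c' \<Longrightarrow> linear (dtrans c c' x)"
  using trans_map_has_derivative has_derivative_linear by blast

lemma dtrans_cocycle:
  assumes "c \<in> A" "c' \<in> A" "c'' \<in> A" "p \<in> fst c" "p \<in> fst c'" "p \<in> fst c''"
  shows "dtrans c' c'' (snd c' p) (dtrans c c' (snd c p) v) = dtrans c c'' (snd c p) v"
proof -
  let ?O = "snd c ` (fst c \<inter> fst c' \<inter> fst c'')"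
  have op: "open ?O" using assms by (intro chart_open_image) (auto intro: chart_open)
  have "(trans_map c c' has_derivative dtrans c c' (snd c p)) (at (snd c p))"
    using assms by (intro trans_map_has_derivative) auto
  moreover have "(trans_map c' c'' has_derivative dtrans c' c'' (snd c' p)) (at (trans_map c c' (snd c p)))"
    using assms trans_map_has_derivative[of c' c'' "snd c' p"] by (auto simp: trans_map_apply)
  ultimately have "((\<lambda>x. trans_map c' c'' (trans_map c c' x)) has_derivative
      (\<lambda>v. dtrans c' c'' (snd c' p) (dtrans c c' (snd c p) v))) (at (snd c p))"
    by (rule has_derivative_compose)
  then have "(trans_map c c'' has_derivative
      (\<lambda>v. dtrans c' c'' (snd c' p) (dtrans c c' (snd c p) v))) (at (snd c p))"
    by (rule has_derivative_transform_within_open[OF _ op]) (use assms in \<open>auto simp: trans_map_apply\<close>)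
  from fun_cong[OF frechet_derivative_at[OF this], of v] show ?thesis unfolding dtrans_def by simp
qed

lemma dtrans_self:
  assumes "c \<in> A" "p \<in> fst c"
  shows "dtrans c c (snd c p) v = v"
proof -
  have "((\<lambda>x. x) has_derivative (\<lambda>v. v)) (at (snd c p))" by (rule has_derivative_ident)
  then have "(trans_map c c has_derivative (\<lambda>v. v)) (at (snd c p))"
    by (rule has_derivative_transform_within_open[OF _ chart_open(2)[OF assms(1)]])
       (use assms in \<open>auto simp: trans_map_apply\<close>)
  from fun_cong[OF frechet_derivative_at[OF this], of v] show ?thesis unfolding dtrans_def by simp
qed

section \<open>Forms supported in a chart\<close>

text \<open>The (1,1)-form \<open>(\<Sum>j. a j * cnj dz\<^sub>j) \<and> dz\<^sub>k\<close> in the coordinates of the chart \<open>c\<close>,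
  extended by zero.\<close>

definition chart_form :: "('a, 'n) chart \<Rightarrow> 'n \<Rightarrow> ('n \<Rightarrow> complex^'n \<Rightarrow> complex) \<Rightarrow> ('a, 'n) form" where
  "chart_form c k a p vs =
     (if p \<in> fst c \<and> length vs = 2 then
        \<Sum>j\<in>UNIV. a j (snd c p) *
          (cnj (dtrans (chart_at A p) c (snd (chart_at A p) p) (vs ! 0) $ j) *
             dtrans (chart_at A p) c (snd (chart_at A p) p) (vs ! 1) $ k -
           cnj (dtrans (chart_at A p) c (snd (chart_at A p) p) (vs ! 1) $ j) *
             dtrans (chart_at A p) c (snd (chart_at A p) p) (vs ! 0) $ k)
      else 0)"

lemma wedge_dz_two:
  "wedge_dz [i] [j] [v, w] = v $ i * cnj (w $ j) - w $ i * cnj (v $ j)"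
proof -
  have "{..<2} = {0, 1::nat}" by auto
  then have "{\<sigma>. \<sigma> permutes {..<length [v, w]}} = {id, Transposition.transpose 0 1}"
    by (auto simp: permutes_doubleton_iff numeral_2_eq_2)
  moreover have "id \<noteq> Transposition.transpose 0 (1::nat)"
    by (metis id_apply transpose_apply_first zero_neq_one)
  ultimately show ?thesis
    unfolding wedge_dz_def by (simp add: sign_swap_id Transposition.transpose_def)
qed

lemma sum_singleton_lists:
  fixes f :: "'b list \<Rightarrow> complex"
  shows "(\<Sum>I | length I = 1. f I) = (\<Sum>i\<in>UNIV. f [i])"
proof -
  have "{I :: 'b list. length I = 1} = range (\<lambda>i. [i])" by (auto simp: length_Suc_conv)
  then have "(\<Sum>I | length I = (1::nat). f I) = (\<Sum>I\<in>range (\<lambda>i. [i]). f I)" by simp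
  also have "\<dots> = (\<Sum>i\<in>UNIV. f [i])" by (subst sum.reindex) (auto simp: inj_on_def)
  finally show ?thesis .
qed

lemma list_length_two: "length vs = 2 \<Longrightarrow> vs = [vs ! 0, vs ! 1]"
  by (auto simp: numeral_2_eq_2 length_Suc_conv)

lemma chart_form_covectors:
  assumes "c \<in> A"
  shows "chart_form c k a p \<in> covectors 1 1"
proof (cases "p \<in> fst c")
  case False
  then have "chart_form c k a p = (\<lambda>vs. 0)" by (auto simp: chart_form_def)
  then show ?thesis unfolding covectors_def by (auto intro!: exI[of _ "\<lambda>I J. 0"])
next
  case True
  define L where "L = dtrans (chart_at A p) c (snd (chart_at A p) p)"
  have sm: "L (x *s v) = x *s L v" and lin: "linear L" for x v
    unfolding L_def using True assms chart_at[of p] by (auto intro!: dtrans_smult dtrans_linear)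
  have Lc: "L v $ j = (\<Sum>i\<in>UNIV. v $ i * L (axis i 1) $ j)" for v j
  proof -
    have "L (\<Sum>i\<in>UNIV. v $ i *s axis i 1) = (\<Sum>i\<in>UNIV. v $ i *s L (axis i 1))"
      by (simp only: linear_sum[OF lin] sm)
    then have "L v = (\<Sum>i\<in>UNIV. v $ i *s L (axis i 1))"
      by (simp only: vec_complex_expansion[symmetric])
    then show ?thesis by simp
  qed
  \<comment> \<open>The minus sign reorders \<open>cnj dz\<^sub>j \<and> dz\<^sub>k\<close> into the
    order \<open>dz \<and> cnj dz\<close> of \<open>wedge_dz\<close>; \<open>hd\<close> reads the
    only index of a list of length one.\<close>
  define b where "b I J = - (\<Sum>j\<in>UNIV. a j (snd c p) * cnj (L (axis (hd J) 1) $ j)) * L (axis (hd I) 1) $ k" for I J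
  have two: "chart_form c k a p vs = (\<Sum>I | length I = 1. \<Sum>J | length J = 1. b I J * wedge_dz I J vs)"
    if "length vs = 2" for vs
  proof -
    define v w where "v = vs ! 0" and "w = vs ! 1"
    then have vs: "vs = [v, w]" using list_length_two[OF that] by simp
    have cn: "(\<Sum>j\<in>UNIV. a j (snd c p) * cnj (L v $ j)) =
        (\<Sum>l\<in>UNIV. cnj (v $ l) * (\<Sum>j\<in>UNIV. a j (snd c p) * cnj (L (axis l 1) $ j)))" for v
    proof -
      have "(\<Sum>j\<in>UNIV. a j (snd c p) * cnj (L v $ j)) = (\<Sum>j\<in>UNIV. \<Sum>l\<in>UNIV. cnj (v $ l) * (a j (snd c p) * cnj (L (axis l 1) $ j)))"
        by (subst Lc) (simp add: sum_distrib_left mult_ac)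
      also have "\<dots> = (\<Sum>l\<in>UNIV. \<Sum>j\<in>UNIV. cnj (v $ l) * (a j (snd c p) * cnj (L (axis l 1) $ j)))"
        by (rule sum.swap)
      finally show ?thesis by (simp add: sum_distrib_left)
    qed
    have "chart_form c k a p vs = (\<Sum>j\<in>UNIV. a j (snd c p) * cnj (L v $ j)) * L w $ k
        - (\<Sum>j\<in>UNIV. a j (snd c p) * cnj (L w $ j)) * L v $ k"
      using True by (simp add: chart_form_def vs L_def sum_distrib_left sum_distrib_right sum_subtractf algebra_simps)
    also have "\<dots> = (\<Sum>i\<in>UNIV. \<Sum>l\<in>UNIV. b [i] [l] * (v $ i * cnj (w $ l) - w $ i * cnj (v $ l)))"
    proof -
      define C where "C l = (\<Sum>j\<in>UNIV. a j (snd c p) * cnj (L (axis l 1) $ j))" for l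
      define K where "K i = L (axis i 1) $ k" for i
      have "(\<Sum>l\<in>UNIV. cnj (v $ l) * C l) * (\<Sum>i\<in>UNIV. w $ i * K i)
          - (\<Sum>l\<in>UNIV. cnj (w $ l) * C l) * (\<Sum>i\<in>UNIV. v $ i * K i)
          = (\<Sum>i\<in>UNIV. w $ i * K i) * (\<Sum>l\<in>UNIV. cnj (v $ l) * C l)
          - (\<Sum>i\<in>UNIV. v $ i * K i) * (\<Sum>l\<in>UNIV. cnj (w $ l) * C l)"
        by (simp only: mult.commute)
      also have "\<dots> = (\<Sum>i\<in>UNIV. \<Sum>l\<in>UNIV. - C l * K i * (v $ i * cnj (w $ l) - w $ i * cnj (v $ l)))"
        unfolding sum_product sum_subtractf[symmetric]
        by (intro sum.cong refl) (simp add: algebra_simps)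
      finally show ?thesis unfolding cn[of v] cn[of w] Lc[of v k] Lc[of w k] b_def C_def K_def by simp
    qed
    finally show ?thesis unfolding sum_singleton_lists unfolding vs wedge_dz_two .
  qed
  have "\<forall>vs. chart_form c k a p vs = (if length vs = 1 + 1
      then \<Sum>I | length I = 1. \<Sum>J | length J = 1. b I J * wedge_dz I J vs else 0)"
  proof
    fix vs
    show "chart_form c k a p vs = (if length vs = 1 + 1
      then \<Sum>I | length I = 1. \<Sum>J | length J = 1. b I J * wedge_dz I J vs else 0)"
    proof (cases "length vs = 2")
      case True
      then show ?thesis unfolding one_add_one two[OF True] by (simp only: if_True simp_thms)
    next
      case False
      then show ?thesis unfolding one_add_one chart_form_def by (simp only: if_False conj_absorb simp_thms)
    qed
  qed
  then show ?thesis unfolding covectors_def by blast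
qed

text \<open>By the cocycle rule the preferred chart at the point drops out, and what remains is the
  pullback along the transition map from \<open>c'\<close> to \<open>c\<close>.\<close>

lemma form_in_chart_form:
  assumes c: "c \<in> A" "c' \<in> A" and p: "p \<in> fst c'"
  shows "form_in A c' (chart_form c k a) (snd c' p) vs =
     (if p \<in> fst c \<and> length vs = 2 then
        \<Sum>j\<in>UNIV. a j (trans_map c' c (snd c' p)) *
          (cnj (dtrans c' c (snd c' p) (vs ! 0) $ j) * dtrans c' c (snd c' p) (vs ! 1) $ k -
           cnj (dtrans c' c (snd c' p) (vs ! 1) $ j) * dtrans c' c (snd c' p) (vs ! 0) $ k)
      else 0)"
  using assms chart_at[of p]
  by (simp add: form_in_def chart_form_def dtrans_cocycle trans_map_apply)

lemma smooth_on_dtrans: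
  assumes "c \<in> A" "c' \<in> A"
  shows "smooth_on (overlap c c') (\<lambda>x. dtrans c c' x v $ j)"
  unfolding dtrans_def
  by (intro smooth_on_bounded_linear[OF open_overlap[OF assms] _ bounded_linear_vec_nth]
      smooth_on_frechet_derivative trans_map_smooth assms)

text \<open>The compact support is closed in the Hausdorff manifold. Any other chart is therefore
  covered by two open sets: one where the formula in \<open>c\<close> is valid, and one where the
  form is 0. Smoothness of the extension by zero is checked on each.\<close>

lemma chart_split:
  assumes c: "c \<in> A" "c' \<in> A" and K: "compact K" "K \<subseteq> snd c ` fst c"
  defines "N \<equiv> snd c' ` (fst c' - {p \<in> fst c. snd c p \<in> K})"
  shows "open N" "snd c' ` fst c' = overlap c' c \<union> N"
proof -
  have "closed {p \<in> fst c. snd c p \<in> K}" by (intro compact_imp_closed chart_compact_preimage assms)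
  then show "open N" unfolding N_def by (intro chart_open_image c open_Diff chart_open(1)) auto
  show "snd c' ` fst c' = overlap c' c \<union> N" by (auto simp: N_def)
qed

lemma chart_form_outside:
  assumes c: "c \<in> A" "c' \<in> A" and K: "\<And>j x. x \<notin> K \<Longrightarrow> a j x = 0"
    and y: "y \<in> snd c' ` (fst c' - {p \<in> fst c. snd c p \<in> K})"
  shows "form_in A c' (chart_form c k a) y vs = 0"
proof -
  obtain p where p: "y = snd c' p" "p \<in> fst c'" "p \<notin> fst c \<or> snd c p \<notin> K" using y by auto
  then show ?thesis using K by (auto simp: form_in_chart_form[OF c p(2)] trans_map_apply[OF c(2) p(2)])
qed

lemma chart_form_forms:
  assumes c: "c \<in> A" and K: "compact K" "K \<subseteq> snd c ` fst c" "\<And>j x. x \<notin> K \<Longrightarrow> a j x = 0"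
    and a: "\<And>j. smooth_on UNIV (a j)"
  shows "chart_form c k a \<in> forms A 1 1"
  unfolding forms_def
proof (intro CollectI conjI allI ballI)
  fix z show "chart_form c k a z \<in> covectors 1 1" by (rule chart_form_covectors[OF c])
next
  fix c' vs assume c': "c' \<in> A"
  let ?f = "\<lambda>x. form_in A c' (chart_form c k a) x vs"
  let ?N = "snd c' ` (fst c' - {p \<in> fst c. snd c p \<in> K})"
  have op: "open (overlap c' c)" by (rule open_overlap[OF c' c])
  have "smooth_on ?N ?f"
    by (rule smooth_on_cong_open[OF chart_split(1)[OF c c' K(1,2)] _ smooth_on_const[OF chart_split(1)[OF c c' K(1,2)]]])
       (use chart_form_outside[OF c c' K(3)] in auto)
  moreover have "smooth_on (overlap c' c) ?f"
  proof (cases "length vs = 2")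
    case True
    have cn: "smooth_on (overlap c' c) (\<lambda>x. cnj (dtrans c' c x v $ j))" for v j
      by (rule smooth_on_bounded_linear[OF op smooth_on_dtrans[OF c' c] bounded_linear_cnj])
    have "smooth_on (overlap c' c) (\<lambda>x. \<Sum>j\<in>UNIV. a j (trans_map c' c x) *
          (cnj (dtrans c' c x (vs ! 0) $ j) * dtrans c' c x (vs ! 1) $ k +
           (-1) * (cnj (dtrans c' c x (vs ! 1) $ j) * dtrans c' c x (vs ! 0) $ k)))"
      by (intro smooth_on_sum smooth_on_mult smooth_on_add smooth_on_const op cn smooth_on_dtrans[OF c' c]
          smooth_on_compose[OF op trans_map_smooth[OF c' c] _ a]) auto
    then show ?thesis
      by (rule smooth_on_cong_open[OF op, rotated])
         (use True in \<open>auto simp: form_in_chart_form[OF c c']\<close>)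
  next
    case False
    then show ?thesis
      by (intro smooth_on_cong_open[OF op _ smooth_on_const[OF op]])
         (auto simp: form_in_chart_form[OF c c'])
  qed
  ultimately show "smooth_on (snd c' ` fst c') ?f"
    unfolding chart_split(2)[OF c c' K(1,2)] by (intro smooth_on_Un)
qed

text \<open>In the coordinates of \<open>c'\<close> the form is (delbar \<open>\<psi>\<close>) wedge
  \<open>h\<close>, where \<open>\<psi>\<close> is the pullback of \<open>\<phi>\<close> and
  \<open>h\<close> that of \<open>dz\<^sub>k\<close>. It is closed since delbar squared is 0 and
  \<open>h\<close> has holomorphic coefficients.\<close>

lemma delbar_closed:
  assumes c: "c \<in> A" "c' \<in> A" and \<phi>: "smooth_on UNIV \<phi>" and x: "x \<in> overlap c' c"
  shows "delbar (form_in A c' (chart_form c k (\<lambda>j y. d01 \<phi> y (axis j 1)))) x vs = 0"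
proof -
  let ?O = "overlap c' c" and ?\<Phi> = "trans_map c' c"
  let ?\<Theta> = "form_in A c' (chart_form c k (\<lambda>j y. d01 \<phi> y (axis j 1)))"
  define \<psi> where "\<psi> = (\<lambda>x. \<phi> (?\<Phi> x))"
  define h where "h = (\<lambda>w x. dtrans c' c x w $ k)"
  have op: "open ?O" by (rule open_overlap[OF c(2,1)])
  have \<psi>: "smooth_on ?O \<psi>"
    unfolding \<psi>_def by (rule smooth_on_compose[OF op trans_map_smooth[OF c(2,1)] _ \<phi>]) simp
  have h: "holomorphic_fun_on ?O (h w)" for w
  proof -
    have "h w x = frechet_derivative (\<lambda>x. ?\<Phi> x $ k) (at x) w" if "x \<in> ?O" for x
      using fun_cong[OF frechet_derivative_at[OF bounded_linear.has_derivative[OF bounded_linear_vec_nth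
          trans_map_has_derivative[OF c(2,1) that]]], of w k] unfolding h_def by simp
    moreover have "holomorphic_fun_on ?O (\<lambda>x. frechet_derivative (\<lambda>x. ?\<Phi> x $ k) (at x) w)"
      by (intro holomorphic_fun_on_frechet_derivative op holomorphic_map_on_component trans_map_holomorphic c)
    ultimately show ?thesis
      unfolding holomorphic_fun_on_def
      using has_derivative_cong_open[OF op, of _ "h w" "\<lambda>x. frechet_derivative (\<lambda>x. ?\<Phi> x $ k) (at x) w"] by simp
  qed
  have chain: "d01 \<psi> y v = (\<Sum>j\<in>UNIV. d01 \<phi> (?\<Phi> y) (axis j 1) * cnj (dtrans c' c y v $ j))" if "y \<in> ?O" for y v
  proof -
    have d: "(\<phi> has_derivative frechet_derivative \<phi> (at (?\<Phi> y))) (at (?\<Phi> y))"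
      by (rule smooth_on_has_derivative[OF \<phi>]) simp
    have "(\<psi> has_derivative (\<lambda>v. frechet_derivative \<phi> (at (?\<Phi> y)) (dtrans c' c y v))) (at y)"
      unfolding \<psi>_def by (rule has_derivative_compose[OF trans_map_has_derivative[OF c(2,1) that] d])
    from fun_cong[OF frechet_derivative_at[OF this]]
    have fr: "frechet_derivative \<psi> (at y) u = frechet_derivative \<phi> (at (?\<Phi> y)) (dtrans c' c y u)" for u
      by (rule sym)
    have "d01 \<psi> y v = d01 \<phi> (?\<Phi> y) (dtrans c' c y v)"
      unfolding d01_def fr dtrans_smult[OF c(2,1) that] ..
    then show ?thesis by (rule trans[OF _ d01_components[OF differentiableI[OF d]]])
  qed
  have \<Theta>: "?\<Theta> y [v, w] = d01 \<psi> y v * h w y - d01 \<psi> y w * h v y" if y: "y \<in> ?O" for y v w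
  proof -
    obtain p where p: "y = snd c' p" "p \<in> fst c'" "p \<in> fst c" using y by blast
    then show ?thesis
      unfolding chain[OF y]
      by (simp add: form_in_chart_form[OF c p(2)] h_def sum_distrib_left sum_distrib_right sum_subtractf algebra_simps)
  qed
  have \<Theta>0: "?\<Theta> y us = 0" if y: "y \<in> ?O" "length us \<noteq> 2" for y us
  proof -
    obtain p where "y = snd c' p" "p \<in> fst c'" using y by blast
    then show ?thesis using y(2) by (simp add: form_in_chart_form[OF c])
  qed
  have diff: "(\<lambda>x. d01 \<psi> x v) differentiable (at x)" for v
    by (rule smooth_on_differentiable[OF smooth_on_d01[OF op \<psi>] x])
  have hd: "h v differentiable (at x)" for v
    using holomorphic_fun_onD(1)[OF h x] by (rule differentiableI)
  have d\<Theta>: "d01 (\<lambda>y. ?\<Theta> y [v, w]) x u =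
      d01 (\<lambda>y. d01 \<psi> y v) x u * h w x - d01 (\<lambda>y. d01 \<psi> y w) x u * h v x" for u v w
  proof -
    have "d01 (\<lambda>y. ?\<Theta> y [v, w]) x u = d01 (\<lambda>y. d01 \<psi> y v * h w y - d01 \<psi> y w * h v y) x u"
      by (rule d01_cong_open[OF op x]) (rule \<Theta>)
    also have "\<dots> = d01 (\<lambda>y. d01 \<psi> y v * h w y) x u - d01 (\<lambda>y. d01 \<psi> y w * h v y) x u"
      by (intro d01_diff differentiable_mult diff hd)
    finally show ?thesis unfolding d01_mult_holomorphic[OF diff h x] .
  qed
  show ?thesis
  proof (cases "length vs = 3")
    case True
    then obtain u v w where vs: "vs = [u, v, w]"
      by (auto simp: numeral_3_eq_3 length_Suc_conv)
    \<comment> \<open>The alternating sum over \<open>u, v, w\<close> has six terms, each a second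
      derivative of \<open>\<psi>\<close> times a value of \<open>h\<close>; they cancel in pairs by
      this symmetry.\<close>
    have sym: "d01 (\<lambda>x. d01 \<psi> x v) x u = d01 (\<lambda>x. d01 \<psi> x u) x v" for u v
      by (rule d01_d01_symmetric[OF op \<psi> x])
    show ?thesis
      by (simp add: delbar_def vs lessThan_Suc d\<Theta> sym[of u v] sym[of u w] sym[of v w] algebra_simps)
  next
    case False
    have "d01 (\<lambda>y. ?\<Theta> y (take i vs @ drop (Suc i) vs)) x (vs ! i) = 0" if "i < length vs" for i
    proof -
      have "length (take i vs @ drop (Suc i) vs) \<noteq> 2" using that False by simp
      then have "d01 (\<lambda>y. ?\<Theta> y (take i vs @ drop (Suc i) vs)) x (vs ! i) = d01 (\<lambda>y. 0) x (vs ! i)"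
        by (intro d01_cong_open[OF op x] \<Theta>0)
      then show ?thesis by simp
    qed
    then show ?thesis by (simp add: delbar_def)
  qed
qed

text \<open>The form is \<open>\<partial>\<close>-bar of \<open>\<phi> * dz\<^sub>k\<close>.\<close>

lemma ddc_delbar_form_zero:
  assumes c: "c \<in> A" and \<phi>: "smooth_on UNIV \<phi>" and K: "compact K" "K \<subseteq> snd c ` fst c" "\<And>x. x \<notin> K \<Longrightarrow> \<phi> x = 0"
  shows "ddc A (chart_form c k (\<lambda>j y. d01 \<phi> y (axis j 1))) = (\<lambda>p vs. 0)"
proof (intro ext)
  fix p vs
  let ?c = "chart_at A p"
  let ?\<Theta> = "form_in A ?c (chart_form c k (\<lambda>j y. d01 \<phi> y (axis j 1)))"
  let ?N = "snd ?c ` (fst ?c - {p \<in> fst c. snd c p \<in> K})"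
  note c' = chart_at(1)[of p]
  have opN: "open ?N" and un: "snd ?c ` fst ?c = overlap ?c c \<union> ?N"
    using chart_split[OF c c' K(1,2)] by auto
  have a0: "d01 \<phi> y (axis j 1) = 0" if "y \<notin> K" for j y
  proof -
    have "d01 \<phi> y (axis j 1) = d01 (\<lambda>x. 0) y (axis j 1)"
      by (rule d01_cong_open[of "- K"]) (use K that compact_imp_closed in auto)
    then show ?thesis by simp
  qed
  \<comment> \<open>Vanishing is needed on the whole image of the chart and not just at the point,
    because \<open>del\<close> differentiates the result.\<close>
  have db: "delbar ?\<Theta> x us = 0" if "x \<in> snd ?c ` fst ?c" for x us
  proof (cases "x \<in> overlap ?c c")
    case True then show ?thesis by (rule delbar_closed[OF c c' \<phi>])
  next
    case False
    then have x: "x \<in> ?N" using that un by blast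
    have "d01 (\<lambda>y. ?\<Theta> y us) x v = d01 (\<lambda>y. 0) x v" for us v
      by (rule d01_cong_open[OF opN x]) (rule chart_form_outside[OF c c' a0])
    then show ?thesis by (simp add: delbar_def)
  qed
  have "d10 (\<lambda>y. delbar ?\<Theta> y us) (snd ?c p) v = d10 (\<lambda>y. 0) (snd ?c p) v" for us v
    by (rule d10_cong_open[OF chart_open(2)[OF c'] _ db]) (use chart_at(2) in auto)
  then show "ddc A (chart_form c k (\<lambda>j y. d01 \<phi> y (axis j 1))) p vs = 0"
    by (simp add: ddc_def del_def)
qed

end

section \<open>Leafwise measures of a closed directed current\<close>

text \<open>\<open>leaf_speed c c'\<close> is the derivative along the leaves of the leaf coordinate of \<open>c'\<close> with
  respect to that of \<open>c\<close>.\<close>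

definition leaf_speed :: "'n \<Rightarrow> ('a, 'n::finite) chart \<Rightarrow> ('a, 'n) chart \<Rightarrow> 'a \<Rightarrow> complex" where
  "leaf_speed k c c' p = dtrans c c' (snd c p) (axis k 1) $ k"

text \<open>The value 0 outside the chart lies in the polydisc, but is never charged by the measures below.\<close>

definition chart_ext :: "('a, 'n::finite) chart \<Rightarrow> 'a \<Rightarrow> complex^'n" where
  "chart_ext c p = (if p \<in> fst c then snd c p else 0)"

locale pluriexact_foliation = compact_complex_manifold A
  for A :: "('a::t2_space, 'n::finite) chart set" +
  fixes k :: 'n and F :: "('a, 'n) chart set"
  assumes foliation: "foliation A k F" and pluriexact: "pluriexact A k F"
begin

lemma box_in_A: "c \<in> F \<Longrightarrow> c \<in> A"
  using foliation by (auto simp: foliation_def)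

lemma box_cover: "\<exists>c\<in>F. p \<in> fst c"
  using foliation unfolding foliation_def by blast

lemma box_image: "c \<in> F \<Longrightarrow> snd c ` fst c = polydisc"
  using foliation unfolding foliation_def polydisc_def by blast

lemma chart_ext_measurable [measurable]:
  assumes "c \<in> A"
  shows "chart_ext c \<in> borel_measurable borel"
  unfolding chart_ext_def
  by (rule borel_measurable_continuous_on_if[OF borel_open[OF chart_open(1)[OF assms]] chart_continuous[OF assms]])
     (rule continuous_on_const)

end

text \<open>The witnesses of pluriexactness are fixed here, and exactness is kept as
  \<open>T_closed\<close>. The field \<open>\<xi>\<close> is a pointwise choice of directing vectors
  without any measurability.\<close>

locale directed_current = pluriexact_foliation A k F
  for A :: "('a::t2_space, 'n::finite) chart set" and k F +
  fixes T :: "('a, 'n) current" and M :: "'a measure"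
    and \<tau> :: "'a \<Rightarrow> ((complex^'n) list \<Rightarrow> complex) \<Rightarrow> complex"
    and \<xi> :: "'a \<Rightarrow> complex^'n"
  assumes sets_M [measurable_cong]: "sets M = sets borel"
    and T_integrable: "\<And>\<omega>. \<omega> \<in> forms A 1 1 \<Longrightarrow> integrable M (\<lambda>z. \<tau> z (\<omega> z))"
    and T_integral: "\<And>\<omega>. \<omega> \<in> forms A 1 1 \<Longrightarrow> T \<omega> = (LINT z|M. \<tau> z (\<omega> z))"
    and T_directed: "AE z in M. \<xi> z \<in> leaf_tangent A k F z \<and> \<xi> z \<noteq> 0 \<and> \<tau> z = bivector (\<xi> z)"
    and T_closed: "\<And>\<omega>. \<omega> \<in> forms A 1 1 \<Longrightarrow> ddc A \<omega> = (\<lambda>p vs. 0) \<Longrightarrow> T \<omega> = 0"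
    and T_nonzero: "\<exists>\<omega>\<in>forms A 1 1. T \<omega> \<noteq> 0"
begin

definition good :: "'a \<Rightarrow> bool" where
  "good z \<longleftrightarrow> \<xi> z \<in> leaf_tangent A k F z \<and> \<xi> z \<noteq> 0 \<and> \<tau> z = bivector (\<xi> z)"

lemma AE_good: "AE z in M. good z"
  using T_directed by (simp add: good_def)

definition speed :: "('a, 'n) chart \<Rightarrow> 'a \<Rightarrow> complex" where
  "speed c z = dtrans (chart_at A z) c (snd (chart_at A z) z) (\<xi> z) $ k"

lemma good_direction:
  assumes "good z" "c \<in> F" "z \<in> fst c"
  shows "dtrans (chart_at A z) c (snd (chart_at A z) z) (\<xi> z) = axis k (speed c z)"
proof -
  have "same_transverse k (dtrans (chart_at A z) c (snd (chart_at A z) z) (\<xi> z)) 0"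
    using assms unfolding good_def leaf_tangent_def by blast
  then show ?thesis by (simp add: vec_eq_iff axis_def speed_def same_transverse_def)
qed

lemma speed_nonzero:
  assumes "good z" "c \<in> F" "z \<in> fst c"
  shows "speed c z \<noteq> 0"
proof
  assume "speed c z = 0"
  then have 0: "dtrans (chart_at A z) c (snd (chart_at A z) z) (\<xi> z) = 0"
    using good_direction[OF assms] by (simp add: vec_eq_iff axis_def)
  note cA = box_in_A[OF assms(2)] chart_at[of z]
  have "\<xi> z = dtrans c (chart_at A z) (snd c z) (dtrans (chart_at A z) c (snd (chart_at A z) z) (\<xi> z))"
    using dtrans_cocycle[of "chart_at A z" c "chart_at A z" z "\<xi> z"] dtrans_self[of "chart_at A z" z "\<xi> z"] cA assms(3)
    by simp
  also have "\<dots> = 0"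
    unfolding 0 using dtrans_linear[of c "chart_at A z" "snd c z"] cA assms(3) by (simp add: linear_0)
  finally show False using assms(1) by (simp add: good_def)
qed

lemma speed_change:
  assumes "good z" "c \<in> F" "c' \<in> F" "z \<in> fst c" "z \<in> fst c'"
  shows "speed c' z = leaf_speed k c c' z * speed c z"
proof -
  note cA = box_in_A[OF assms(2)] box_in_A[OF assms(3)] chart_at[of z]
  have "axis k (speed c z) = speed c z *s axis k 1" by (simp add: vec_eq_iff axis_def)
  then have "dtrans (chart_at A z) c' (snd (chart_at A z) z) (\<xi> z) = speed c z *s dtrans c c' (snd c z) (axis k 1)"
    using dtrans_cocycle[of "chart_at A z" c c' z "\<xi> z"] good_direction[OF assms(1,2,4)] cA assms(4,5)
      dtrans_smult[of c c' "snd c z" "speed c z" "axis k 1"] by simp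
  then show ?thesis by (simp add: speed_def[of c'] leaf_speed_def)
qed

text \<open>The directing vector has only the leaf component s = \<open>speed c z\<close>, so the
  coefficients with index other than \<open>k\<close> are lost. The 2-form
  \<open>cnj dz\<^sub>k \<and> dz\<^sub>k\<close> takes the value 2i |s|^2 on s and i s.\<close>

lemma tau_chart_form:
  assumes "good z" "c \<in> F"
  shows "\<tau> z (chart_form c k a z) =
    (if z \<in> fst c then 2 * \<i> * a k (snd c z) * of_real ((cmod (speed c z))\<^sup>2) else 0)"
proof (cases "z \<in> fst c")
  case False
  then show ?thesis using assms(1) by (simp add: good_def bivector_def chart_form_def)
next
  case True
  let ?L = "dtrans (chart_at A z) c (snd (chart_at A z) z)"
  have L: "?L (\<xi> z) = axis k (speed c z)" by (rule good_direction[OF assms True])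
  have Li: "?L (\<i> *s \<xi> z) = \<i> *s axis k (speed c z)"
    using dtrans_smult[of "chart_at A z" c "snd (chart_at A z) z" \<i> "\<xi> z"] chart_at[of z] box_in_A[OF assms(2)] True L
    by simp
  have "\<tau> z (chart_form c k a z) = (\<Sum>j\<in>UNIV. a j (snd c z) *
          (cnj (axis k (speed c z) $ j) * (\<i> * speed c z) - cnj (\<i> * axis k (speed c z) $ j) * speed c z))"
    using assms(1) True by (simp add: good_def bivector_def chart_form_def L Li)
  also have "\<dots> = (\<Sum>j\<in>UNIV. if j = k then 2 * \<i> * a k (snd c z) * (cnj (speed c z) * speed c z) else 0)"
    by (intro sum.cong refl) (simp add: axis_def algebra_simps)
  also have "\<dots> = 2 * \<i> * a k (snd c z) * (cnj (speed c z) * speed c z)" by simp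
  also have "cnj (speed c z) * speed c z = of_real ((cmod (speed c z))\<^sup>2)"
    by (simp add: complex_norm_square mult.commute del: of_real_power)
  finally show ?thesis using True by simp
qed

text \<open>The divisor 2i turns \<open>cnj dz\<^sub>k \<and> dz\<^sub>k\<close> into the area form
  of the leaf coordinate, so \<open>\<tau>\<close> yields the bump times the squared modulus of the
  speed.\<close>

definition bump_form :: "('a, 'n) chart \<Rightarrow> complex^'n \<Rightarrow> complex^'n \<Rightarrow> ('a, 'n) form" where
  "bump_form c a b = chart_form c k (\<lambda>j x. of_real (box_bump 1 a b x) / (2 * \<i>))"

lemma bump_form_forms:
  assumes "c \<in> F" "cbox a b \<subseteq> polydisc"
  shows "bump_form c a b \<in> forms A 1 1"
  unfolding bump_form_def
proof (rule chart_form_forms[OF box_in_A[OF assms(1)] compact_cbox])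
  show "cbox a b \<subseteq> snd c ` fst c" using assms box_image by simp
  show "complex_of_real (box_bump 1 a b x) / (2 * \<i>) = 0" if "x \<notin> cbox a b" for x
    using box_bump_nderiv_zero[OF that, of "[]" 1] by simp
  have "bounded_linear (\<lambda>x. complex_of_real x / (2 * \<i>))"
    by (rule bounded_linear_compose[OF bounded_linear_divide bounded_linear_of_real])
  from smooth_on_bounded_linear[OF open_UNIV smooth_box_bump this]
  show "smooth_on UNIV (\<lambda>x. complex_of_real (box_bump 1 a b x) / (2 * \<i>))" .
qed

lemma tau_bump_form:
  assumes "good z" "c \<in> F"
  shows "\<tau> z (bump_form c a b z) =
    (if z \<in> fst c then of_real (box_bump 1 a b (snd c z) * (cmod (speed c z))\<^sup>2) else 0)"
  unfolding bump_form_def tau_chart_form[OF assms] by simp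

text \<open>One countable family of boxes for all flow boxes: at each point of the polydisc some
  bump of the family is positive, and each bump has compact support in the polydisc.\<close>

definition box_seq :: "nat \<Rightarrow> (complex^'n) \<times> (complex^'n)" where
  "box_seq = (SOME B. (\<forall>i. cbox (fst (B i)) (snd (B i)) \<subseteq> polydisc) \<and> polydisc \<subseteq> (\<Union>i. box (fst (B i)) (snd (B i))))"

lemma box_seq:
  "cbox (fst (box_seq i)) (snd (box_seq i)) \<subseteq> polydisc"
  "polydisc \<subseteq> (\<Union>i. box (fst (box_seq i)) (snd (box_seq i)))"
proof -
  let ?P = "\<lambda>U. \<exists>a b. U = box a b \<and> cbox a b \<subseteq> (polydisc :: (complex^'n) set)"
  have "\<exists>U. open U \<and> y \<in> U \<and> ?P U" if "y \<in> polydisc" for y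
    using open_contains_cbox[OF open_polydisc that] open_box by metis
  then obtain U where U: "polydisc \<subseteq> (\<Union>i. U i)" "\<And>i::nat. U i = {} \<or> ?P (U i)"
    using countable_open_cover[OF countably_coverable_second_countable, of polydisc ?P] by metis
  have "\<exists>ab. U i = box (fst ab) (snd ab) \<and> cbox (fst ab) (snd ab) \<subseteq> polydisc" for i
  proof (cases "U i = {}")
    case True
    \<comment> \<open>The countable cover may list the empty set, which still needs a pair of
      corners; reversed corners give an empty box.\<close>
    have e: "box (One::complex^'n) 0 = {}" "cbox (One::complex^'n) 0 = {}"
      by (auto simp: box_eq_empty intro: SOME_Basis)
    show ?thesis by (rule exI[of _ "(One, 0)"]) (simp add: True e)
  next
    case False
    then obtain a b where "U i = box a b" "cbox a b \<subseteq> polydisc" using U(2)[of i] by blast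
    then show ?thesis by (intro exI[of _ "(a, b)"]) simp
  qed
  then obtain B where B: "\<And>i. U i = box (fst (B i)) (snd (B i)) \<and> cbox (fst (B i)) (snd (B i)) \<subseteq> polydisc" by metis
  have "\<exists>B. (\<forall>i::nat. cbox (fst (B i)) (snd (B i)) \<subseteq> (polydisc :: (complex^'n) set)) \<and> polydisc \<subseteq> (\<Union>i. box (fst (B i)) (snd (B i)))"
    by (rule exI[of _ B]) (use B U(1) in auto)
  from someI_ex[OF this] show "cbox (fst (box_seq i)) (snd (box_seq i)) \<subseteq> polydisc"
    "polydisc \<subseteq> (\<Union>i. box (fst (box_seq i)) (snd (box_seq i)))"
    unfolding box_seq_def by auto
qed

text \<open>Almost everywhere this is \<open>(cmod (speed c z))\<^sup>2\<close>, which itself need not be measurable: \<open>\<tau>\<close> takes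
  on \<open>bump_form\<close> the value of the bump function times that density. Off the \<open>i\<close>-th box the
  quotient is \<open>x / 0 = 0\<close>.\<close>

definition dens :: "('a, 'n) chart \<Rightarrow> 'a \<Rightarrow> real" where
  "dens c z = indicator (fst c) z * enn2real (SUP i. ennreal
     (Re (\<tau> z (bump_form c (fst (box_seq i)) (snd (box_seq i)) z)) /
      box_bump 1 (fst (box_seq i)) (snd (box_seq i)) (chart_ext c z)))"

lemma dens_nonneg: "0 \<le> dens c z"
  by (simp add: dens_def indicator_def)

lemma dens_measurable [measurable]:
  assumes "c \<in> F"
  shows "dens c \<in> borel_measurable M"
proof -
  have [measurable]: "fst c \<in> sets M"
    using chart_open(1)[OF box_in_A[OF assms]] by (simp add: sets_M)
  have ce: "chart_ext c \<in> borel_measurable M"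
    using chart_ext_measurable[OF box_in_A[OF assms]] by (simp add: measurable_cong_sets[OF sets_M refl])
  have [measurable]: "(\<lambda>z. box_bump 1 a b (chart_ext c z)) \<in> borel_measurable M" for a b
    by (rule measurable_compose[OF ce borel_measurable_smooth[OF smooth_box_bump]])
  have [measurable]: "(\<lambda>z. \<tau> z (bump_form c (fst (box_seq i)) (snd (box_seq i)) z)) \<in> borel_measurable M" for i
    using T_integrable[OF bump_form_forms[OF assms box_seq(1)]] by (rule borel_measurable_integrable)
  show ?thesis unfolding dens_def[abs_def] by measurable
qed

lemma dens_good:
  assumes "good z" "c \<in> F"
  shows "dens c z = (if z \<in> fst c then (cmod (speed c z))\<^sup>2 else 0)"
proof (cases "z \<in> fst c")
  case True
  let ?b = "\<lambda>i. box_bump 1 (fst (box_seq i)) (snd (box_seq i)) (snd c z)"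
  let ?s = "(cmod (speed c z))\<^sup>2"
  have "snd c z \<in> polydisc" using True assms(2) box_image by blast
  then obtain i where "snd c z \<in> box (fst (box_seq i)) (snd (box_seq i))" using box_seq(2) by blast
  then have i: "?b i > 0" by (intro box_bump_pos) auto
  have "(SUP i. ennreal (?b i * ?s / ?b i)) = ennreal ?s"
  proof (rule antisym)
    show "(SUP i. ennreal (?b i * ?s / ?b i)) \<le> ennreal ?s"
    proof (rule SUP_least)
      fix j show "ennreal (?b j * ?s / ?b j) \<le> ennreal ?s" by (cases "?b j = 0") auto
    qed
    have "ennreal ?s = ennreal (?b i * ?s / ?b i)" using i by simp
    also have "\<dots> \<le> (SUP i. ennreal (?b i * ?s / ?b i))" by (rule SUP_upper) simp
    finally show "ennreal ?s \<le> (SUP i. ennreal (?b i * ?s / ?b i))" .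
  qed
  then show ?thesis using True by (simp add: dens_def tau_bump_form[OF assms] chart_ext_def)
qed (simp add: dens_def)

text \<open>This measure represents the functional sending \<phi> to T(\<phi> dx wedge dy), where x
  + iy is the leaf coordinate of \<open>c\<close>: the mass of \<open>T\<close> weighted by the
  leafwise area that \<open>c\<close> assigns to its bivectors.\<close>

definition leaf_measure :: "('a, 'n) chart \<Rightarrow> 'a measure" where
  "leaf_measure c = density M (\<lambda>z. ennreal (dens c z))"

lemma sets_leaf_measure [measurable_cong]: "sets (leaf_measure c) = sets borel"
  by (simp add: leaf_measure_def sets_M)

lemma space_leaf_measure: "space (leaf_measure c) = UNIV"
  using sets_eq_imp_space_eq[OF sets_leaf_measure] by simp

section \<open>Leafwise measures under a change of flow box, and in coordinates\<close>

lemma leaf_speed_continuous: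
  assumes "c \<in> A" "c' \<in> A"
  shows "continuous_on (fst c \<inter> fst c') (leaf_speed k c c')"
proof -
  have "continuous_on (overlap c c') (\<lambda>x. dtrans c c' x (axis k 1) $ k)"
    by (rule smooth_on_continuous_on[OF smooth_on_dtrans[OF assms]])
  moreover have "continuous_on (fst c \<inter> fst c') (snd c)"
    using chart_continuous[OF assms(1)] by (rule continuous_on_subset) blast
  ultimately show ?thesis
    unfolding leaf_speed_def by (rule continuous_on_compose2) blast
qed

text \<open>The change of variables along a leaf: the Jacobian of a holomorphic map in one variable
  is the squared modulus of its derivative. It follows pointwise from \<open>speed_change\<close> at
  almost every point.\<close>

lemma leaf_measure_change:
  assumes c: "c \<in> F" "c' \<in> F" and Z: "Z \<in> sets borel" "Z \<subseteq> fst c \<inter> fst c'"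
  shows "emeasure (leaf_measure c') Z =
    (\<integral>\<^sup>+z. ennreal ((cmod (leaf_speed k c c' z))\<^sup>2) * indicator Z z \<partial>leaf_measure c)"
proof -
  have op: "open (fst c \<inter> fst c')" using c box_in_A chart_open by (intro open_Int) auto
  \<comment> \<open>The cut-off makes the function Borel: continuity of \<open>leaf_speed\<close> is
    known only on the overlap.\<close>
  have "(\<lambda>z. if z \<in> fst c \<inter> fst c' then leaf_speed k c c' z else 0) \<in> borel_measurable borel"
    using c box_in_A by (intro borel_measurable_continuous_on_if borel_open op leaf_speed_continuous) auto
  then have m: "(\<lambda>z. ennreal ((cmod (if z \<in> fst c \<inter> fst c' then leaf_speed k c c' z else 0))\<^sup>2) * indicator Z z) \<in> borel_measurable M"
    using Z by (intro borel_measurable_times_ennreal measurable_compose[OF _ measurable_ennreal]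
      borel_measurable_power borel_measurable_norm borel_measurable_indicator)
      (auto simp: measurable_cong_sets[OF sets_M refl] sets_M)
  have eq: "(\<lambda>z. ennreal ((cmod (if z \<in> fst c \<inter> fst c' then leaf_speed k c c' z else 0))\<^sup>2) * indicator Z z)
      = (\<lambda>z. ennreal ((cmod (leaf_speed k c c' z))\<^sup>2) * indicator Z z)"
    using Z(2) by (auto simp: fun_eq_iff indicator_def)
  have "emeasure (leaf_measure c') Z = (\<integral>\<^sup>+z. ennreal (dens c' z) * indicator Z z \<partial>M)"
    unfolding leaf_measure_def using dens_measurable[OF c(2)] Z(1)
    by (subst emeasure_density) (auto simp: sets_M intro: measurable_compose[OF _ measurable_ennreal])
  also have "\<dots> = (\<integral>\<^sup>+z. ennreal (dens c z) * (ennreal ((cmod (leaf_speed k c c' z))\<^sup>2) * indicator Z z) \<partial>M)"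
  proof (rule nn_integral_cong_AE)
    show "AE z in M. ennreal (dens c' z) * indicator Z z =
        ennreal (dens c z) * (ennreal ((cmod (leaf_speed k c c' z))\<^sup>2) * indicator Z z)"
      using AE_good
    proof (rule AE_mp, intro AE_I2 impI)
      fix z assume g: "good z"
      show "ennreal (dens c' z) * indicator Z z =
        ennreal (dens c z) * (ennreal ((cmod (leaf_speed k c c' z))\<^sup>2) * indicator Z z)"
      proof (cases "z \<in> Z")
        case True
        then have "z \<in> fst c" "z \<in> fst c'" using Z by auto
        then have "dens c' z = dens c z * (cmod (leaf_speed k c c' z))\<^sup>2"
          using speed_change[OF g c] dens_good[OF g c(1)] dens_good[OF g c(2)]
          by (simp add: norm_mult power_mult_distrib)
        then show ?thesis using True by (simp add: ennreal_mult dens_nonneg)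
      qed simp
    qed
  qed
  also have "\<dots> = (\<integral>\<^sup>+z. ennreal ((cmod (leaf_speed k c c' z))\<^sup>2) * indicator Z z \<partial>leaf_measure c)"
    unfolding leaf_measure_def using m[unfolded eq] dens_measurable[OF c(1)]
    by (subst nn_integral_density) (auto intro: measurable_compose[OF _ measurable_ennreal])
  finally show ?thesis .
qed

definition chart_measure :: "('a, 'n) chart \<Rightarrow> (complex^'n) measure" where
  "chart_measure c = distr (leaf_measure c) borel (chart_ext c)"

lemma chart_ext_measurable_leaf: "c \<in> F \<Longrightarrow> chart_ext c \<in> measurable (leaf_measure c) borel"
  using chart_ext_measurable[OF box_in_A] by (simp add: measurable_cong_sets[OF sets_leaf_measure refl])

lemma emeasure_chart_measure:
  assumes c: "c \<in> F" and Y: "Y \<in> sets borel"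
  shows "emeasure (chart_measure c) Y = emeasure (leaf_measure c) {z \<in> fst c. snd c z \<in> Y}"
proof -
  have f: "fst c \<in> sets borel" using chart_open(1)[OF box_in_A[OF c]] by simp
  have v: "chart_ext c -` Y \<in> sets borel"
    using measurable_sets[OF chart_ext_measurable[OF box_in_A[OF c]] Y] by simp
  have meas: "(\<lambda>z. ennreal (dens c z)) \<in> borel_measurable M"
    using dens_measurable[OF c] by (rule measurable_compose[OF _ measurable_ennreal])
  have "emeasure (chart_measure c) Y = emeasure (leaf_measure c) (chart_ext c -` Y)"
    unfolding chart_measure_def
    by (subst emeasure_distr[OF chart_ext_measurable_leaf[OF c] Y]) (simp add: space_leaf_measure)
  also have "\<dots> = (\<integral>\<^sup>+z. ennreal (dens c z) * indicator (chart_ext c -` Y) z \<partial>M)"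
    unfolding leaf_measure_def using v by (subst emeasure_density[OF meas]) (auto simp: sets_M)
  also have "\<dots> = (\<integral>\<^sup>+z. ennreal (dens c z) * indicator (fst c \<inter> chart_ext c -` Y) z \<partial>M)"
    by (intro nn_integral_cong) (auto simp: dens_def indicator_def)
  also have "\<dots> = emeasure (leaf_measure c) (fst c \<inter> chart_ext c -` Y)"
    unfolding leaf_measure_def using v f by (subst emeasure_density[OF meas]) (auto simp: sets_M)
  also have "fst c \<inter> chart_ext c -` Y = {z \<in> fst c. snd c z \<in> Y}"
    by (auto simp: chart_ext_def)
  finally show ?thesis .
qed

text \<open>Local finiteness of the leafwise measure comes from here: the integral is that of the
  norm of \<open>\<tau>\<close> on a test form, which is integrable by assumption on
  \<open>T\<close>.\<close>

lemma integrable_dens_bump: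
  assumes c: "c \<in> F" and ab: "cbox a b \<subseteq> polydisc"
  shows "(\<integral>\<^sup>+x. ennreal (box_bump 1 a b x) \<partial>chart_measure c) < \<infinity>"
proof -
  have bm: "(\<lambda>x. ennreal (box_bump 1 a b x)) \<in> borel_measurable borel"
    by (rule measurable_compose[OF borel_measurable_smooth[OF smooth_box_bump] measurable_ennreal])
  have meas: "(\<lambda>z. ennreal (dens c z)) \<in> borel_measurable M"
    using dens_measurable[OF c] by (rule measurable_compose[OF _ measurable_ennreal])
  have ce: "chart_ext c \<in> borel_measurable M"
    using chart_ext_measurable[OF box_in_A[OF c]] by (simp add: measurable_cong_sets[OF sets_M refl])
  have "(\<integral>\<^sup>+x. ennreal (box_bump 1 a b x) \<partial>chart_measure c)
      = (\<integral>\<^sup>+z. ennreal (box_bump 1 a b (chart_ext c z)) \<partial>leaf_measure c)"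
    unfolding chart_measure_def by (rule nn_integral_distr[OF chart_ext_measurable_leaf[OF c] ])
      (use bm in simp)
  also have "\<dots> = (\<integral>\<^sup>+z. ennreal (dens c z) * ennreal (box_bump 1 a b (chart_ext c z)) \<partial>M)"
    unfolding leaf_measure_def by (rule nn_integral_density[OF meas measurable_compose[OF ce bm]])
  also have "\<dots> = (\<integral>\<^sup>+z. ennreal (norm (\<tau> z (bump_form c a b z))) \<partial>M)"
  proof (rule nn_integral_cong_AE)
    show "AE z in M. ennreal (dens c z) * ennreal (box_bump 1 a b (chart_ext c z)) =
        ennreal (norm (\<tau> z (bump_form c a b z)))"
      using AE_good
    proof (rule AE_mp, intro AE_I2 impI)
      fix z assume g: "good z"
      show "ennreal (dens c z) * ennreal (box_bump 1 a b (chart_ext c z)) = ennreal (norm (\<tau> z (bump_form c a b z)))"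
        unfolding tau_bump_form[OF g c] dens_good[OF g c]
        by (simp add: chart_ext_def norm_mult norm_power box_bump_nonneg ennreal_mult[symmetric] mult.commute)
    qed
  qed
  also have "\<dots> < \<infinity>"
    using T_integrable[OF bump_form_forms[OF c ab]] by (simp add: integrable_iff_bounded)
  finally show ?thesis .
qed

lemma chart_measure_finite_compact:
  assumes c: "c \<in> F" and K: "compact K" "K \<subseteq> polydisc"
  shows "emeasure (chart_measure c) K < \<infinity>"
proof -
  have sc: "sets (chart_measure c) = sets borel" by (simp add: chart_measure_def)
  have "\<exists>U. open U \<and> x \<in> U \<and> emeasure (chart_measure c) U < \<infinity>" if "x \<in> K" for x
  proof -
    have "x \<in> polydisc" using that K by blast
    from open_contains_cbox[OF open_polydisc this]
    obtain a b where ab: "cbox a b \<subseteq> polydisc" "x \<in> box a b" .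
    \<comment> \<open>With half of the value at \<open>x\<close> as threshold, the bump exceeds
      \<open>t\<close> on a neighbourhood of \<open>x\<close>, whose mass is then bounded by
      Markov's inequality.\<close>
    define t where "t = box_bump 1 a b x / 2"
    have t: "t > 0" unfolding t_def using box_bump_pos[OF _ ab(2), of 1] by simp
    define U where "U = {y. t < box_bump 1 a b y}"
    have "continuous_on UNIV (box_bump 1 a b)" by (rule smooth_on_continuous_on[OF smooth_box_bump])
    then have op: "open U" unfolding U_def by (intro open_Collect_less) auto
    have "x \<in> U" using t by (simp add: U_def t_def)
    have "ennreal t * emeasure (chart_measure c) U = (\<integral>\<^sup>+y. ennreal t * indicator U y \<partial>chart_measure c)"
      using op by (simp add: nn_integral_cmult_indicator sc)
    also have "\<dots> \<le> (\<integral>\<^sup>+x. ennreal (box_bump 1 a b x) \<partial>chart_measure c)"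
      by (intro nn_integral_mono) (auto simp: U_def indicator_def intro: ennreal_leI)
    also have "\<dots> < \<infinity>" by (rule integrable_dens_bump[OF c ab(1)])
    finally have "emeasure (chart_measure c) U < \<infinity>"
      using t by (auto simp: ennreal_mult_less_top)
    with op \<open>x \<in> U\<close> show ?thesis by blast
  qed
  then obtain U where U: "\<And>x. x \<in> K \<Longrightarrow> open (U x) \<and> x \<in> U x \<and> emeasure (chart_measure c) (U x) < \<infinity>" by metis
  obtain D where D: "D \<subseteq> K" "finite D" "K \<subseteq> (\<Union>x\<in>D. U x)"
    by (rule compactE_image[OF K(1), of K U]) (use U in auto)
  have "emeasure (chart_measure c) K \<le> emeasure (chart_measure c) (\<Union>x\<in>D. U x)"
    using D U by (intro emeasure_mono) (auto simp: sc intro!: borel_open open_UN)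
  also have "\<dots> \<le> (\<Sum>x\<in>D. emeasure (chart_measure c) (U x))"
    using D U by (intro emeasure_subadditive_finite) (auto simp: sc intro!: borel_open)
  also have "\<dots> < \<infinity>" using D U by (simp add: subset_iff)
  finally show ?thesis .
qed

text \<open>\<open>T\<close> vanishes on the delbar-exact test form built from the real bump, and
  this integral is, up to a constant, that of the derivative of the bump with respect to the
  conjugate leaf coordinate.\<close>

lemma chart_measure_null:
  assumes c: "c \<in> F" and ab: "cbox a b \<subseteq> polydisc"
  shows "(\<integral>x. frechet_derivative (box_bump n a b) (at x) (axis k w) \<partial>chart_measure c) = 0"
proof -
  let ?\<phi> = "\<lambda>x. complex_of_real (box_bump n a b x)"
  let ?D = "\<lambda>v x. frechet_derivative (box_bump n a b) (at x) v"
  let ?\<omega> = "chart_form c k (\<lambda>j y. d01 ?\<phi> y (axis j 1))"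
  have sm: "smooth_on UNIV ?\<phi>"
    by (rule smooth_on_bounded_linear[OF open_UNIV smooth_box_bump bounded_linear_of_real])
  have D: "frechet_derivative ?\<phi> (at x) v = of_real (?D v x)" for x v
    using nderiv_bounded_linear[OF open_UNIV smooth_box_bump bounded_linear_of_real, of x "[v]" n a b] by simp
  have D0: "?D v x = 0" if "x \<notin> cbox a b" for v x
    using box_bump_nderiv_zero[OF that, of "[v]" n] by simp
  have K: "cbox a b \<subseteq> snd c ` fst c" using ab box_image[OF c] by simp
  have \<omega>: "?\<omega> \<in> forms A 1 1"
  proof (rule chart_form_forms[OF box_in_A[OF c] compact_cbox K])
    show "d01 ?\<phi> x (axis j 1) = 0" if "x \<notin> cbox a b" for x j
      using D0[OF that] by (simp add: d01_def D)
    show "smooth_on UNIV (\<lambda>y. d01 ?\<phi> y (axis j 1))" for j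
      by (rule smooth_on_d01[OF open_UNIV sm])
  qed
  have "ddc A ?\<omega> = (\<lambda>p vs. 0)"
    by (rule ddc_delbar_form_zero[OF box_in_A[OF c] sm compact_cbox K])
       (use box_bump_nderiv_zero[of _ a b "[]" n] in simp)
  then have T0: "T ?\<omega> = 0" by (rule T_closed[OF \<omega>])
  define h where "h v z = dens c z * ?D v (chart_ext c z)" for v z
  let ?e = "axis k 1 :: complex^'n" and ?f = "axis k \<i> :: complex^'n"
  have f: "\<i> *s ?e = ?f" by (simp add: vec_eq_iff axis_def)
  \<comment> \<open>The factor 2i of the bivector meets the 1/2 in \<open>d01\<close>, which leaves
    i. The functions \<open>h ?e\<close> and \<open>h ?f\<close> are real.\<close>
  have ae: "AE z in M. \<tau> z (?\<omega> z) = \<i> * (of_real (h ?e z) + \<i> * of_real (h ?f z))"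
    using AE_good
  proof (rule AE_mp, intro AE_I2 impI)
    fix z assume g: "good z"
    show "\<tau> z (?\<omega> z) = \<i> * (of_real (h ?e z) + \<i> * of_real (h ?f z))"
      unfolding tau_chart_form[OF g c] h_def dens_good[OF g c]
      by (simp add: d01_def D f chart_ext_def algebra_simps add_divide_distrib diff_divide_distrib)
  qed
  have ce: "chart_ext c \<in> borel_measurable M"
    using chart_ext_measurable[OF box_in_A[OF c]] by (simp add: measurable_cong_sets[OF sets_M refl])
  have Dm: "?D v \<in> borel_measurable borel" for v
    using borel_measurable_smooth[OF smooth_on_frechet_derivative[OF smooth_box_bump, of n a b v]] .
  have hm [measurable]: "h v \<in> borel_measurable M" for v
    unfolding h_def using dens_measurable[OF c] measurable_compose[OF ce Dm] by (intro borel_measurable_times)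
  have meas: "(\<lambda>z. \<i> * (of_real (h ?e z) + \<i> * of_real (h ?f z))) \<in> borel_measurable M"
    by measurable
  have int: "integrable M (\<lambda>z. \<i> * (of_real (h ?e z) + \<i> * of_real (h ?f z)))"
    by (rule integrable_cong_AE_imp[OF T_integrable[OF \<omega>] meas ae])
  have I: "(\<integral>z. \<i> * (of_real (h ?e z) + \<i> * of_real (h ?f z)) \<partial>M) = 0"
    using T0 T_integral[OF \<omega>] integral_cong_AE[OF borel_measurable_integrable[OF T_integrable[OF \<omega>]] meas ae]
    by (metis)
  have int1: "integrable M (h ?e)" and int2: "integrable M (h ?f)"
    using integrable_Im[OF int] integrable_Re[OF int] by simp_all
  \<comment> \<open>Real and imaginary parts separate the two real directions of the leaf; every
    other leaf direction is a real combination of them.\<close>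
  have z1: "(\<integral>z. h ?e z \<partial>M) = 0" and z2: "(\<integral>z. h ?f z \<partial>M) = 0"
    using integral_Im[OF int] integral_Re[OF int] unfolding I by simp_all
  have "(\<integral>x. ?D (axis k w) x \<partial>chart_measure c) = (\<integral>z. ?D (axis k w) (chart_ext c z) \<partial>leaf_measure c)"
    unfolding chart_measure_def by (rule integral_distr[OF chart_ext_measurable_leaf[OF c] Dm])
  also have "\<dots> = (\<integral>z. h (axis k w) z \<partial>M)"
    unfolding leaf_measure_def h_def
    by (subst integral_density[OF measurable_compose[OF ce Dm] dens_measurable[OF c]]) (auto simp: dens_nonneg)
  also have "h (axis k w) = (\<lambda>z. Re w * h ?e z + Im w * h ?f z)"
  proof
    fix z
    have "linear (\<lambda>v. ?D v (chart_ext c z))"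
      using has_derivative_linear[OF smooth_on_has_derivative[OF smooth_box_bump UNIV_I]] .
    moreover have "axis k w = Re w *\<^sub>R ?e + Im w *\<^sub>R ?f"
      by (auto simp: vec_eq_iff axis_def complex_eq_iff)
    ultimately show "h (axis k w) z = Re w * h ?e z + Im w * h ?f z"
      by (simp add: h_def linear_add linear_cmul algebra_simps)
  qed
  also have "(\<integral>z. Re w * h ?e z + Im w * h ?f z \<partial>M) = 0"
    using int1 int2 z1 z2 by simp
  finally show ?thesis .
qed

lemma chart_measure_derivative_null:
  assumes "c \<in> F"
  shows "derivative_null_measure (chart_measure c) polydisc (axis k w)"
proof
  show "sets (chart_measure c) = sets borel" by (simp add: chart_measure_def)
  show "open (polydisc :: (complex^'n) set)" "convex (polydisc :: (complex^'n) set)"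
    by (rule open_polydisc convex_polydisc)+
  show "emeasure (chart_measure c) K < \<infinity>" if "compact K" "K \<subseteq> polydisc" for K
    by (rule chart_measure_finite_compact[OF assms that])
  show "(\<integral>x. frechet_derivative (box_bump n a b) (at x) (axis k w) \<partial>chart_measure c) = 0"
    if "cbox a b \<subseteq> polydisc" for n a b
    by (rule chart_measure_null[OF assms that])
qed

text \<open>The density is positive at good points of the box. If all these measures vanished,
  finitely many boxes covering the compact manifold would make \<open>M\<close> null, and
  \<open>T\<close> would be 0.\<close>

lemma chart_measure_nonzero: "\<exists>c\<in>F. emeasure (chart_measure c) polydisc \<noteq> 0"
proof (rule ccontr)
  assume "\<not> ?thesis"
  then have z: "emeasure (chart_measure c) polydisc = 0" if "c \<in> F" for c using that by blast
  obtain G where G: "G \<subseteq> F" "finite G" "UNIV \<subseteq> (\<Union>c\<in>G. fst c)"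
    using compactE_image[OF compact_UNIV, of F fst] box_cover chart_open(1) box_in_A by (metis UNIV_I UN_iff subsetI)
  have "AE z in M. \<not> (good z \<and> z \<in> fst c)" if "c \<in> G" for c
  proof -
    have c: "c \<in> F" using that G by blast
    have f: "fst c \<in> sets M" using chart_open(1)[OF box_in_A[OF c]] by (simp add: sets_M)
    have "{z \<in> fst c. snd c z \<in> polydisc} = fst c" using box_image[OF c] by blast
    then have "emeasure (leaf_measure c) (fst c) = 0"
      using z[OF c] emeasure_chart_measure[OF c borel_open[OF open_polydisc]] by simp
    then have "(\<integral>\<^sup>+z. ennreal (dens c z) * indicator (fst c) z \<partial>M) = 0"
      unfolding leaf_measure_def using dens_measurable[OF c] f
      by (subst (asm) emeasure_density) (auto intro: measurable_compose[OF _ measurable_ennreal])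
    then have "AE z in M. ennreal (dens c z) * indicator (fst c) z = 0"
      using dens_measurable[OF c] f
      by (subst (asm) nn_integral_0_iff_AE) (auto intro!: borel_measurable_times_ennreal measurable_compose[OF _ measurable_ennreal])
    then show ?thesis
    proof (rule AE_mp, intro AE_I2 impI notI)
      fix z assume "ennreal (dens c z) * indicator (fst c) z = 0" "good z \<and> z \<in> fst c"
      then show False using dens_good[of z c] speed_nonzero[of z c] c by simp
    qed
  qed
  then have "AE z in M. \<forall>c\<in>G. \<not> (good z \<and> z \<in> fst c)"
    using G(2) by (intro AE_finite_allI) auto
  then have "AE z in M. False"
    using AE_good
  proof (eventually_elim)
    case (elim z)
    then show ?case using G(3) by blast
  qed
  then have "T \<omega> = 0" if "\<omega> \<in> forms A 1 1" for \<omega>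
  proof -
    have "(LINT z|M. \<tau> z (\<omega> z)) = (LINT z|M. 0)"
      using \<open>AE z in M. False\<close> borel_measurable_integrable[OF T_integrable[OF that]]
      by (intro integral_cong_AE) auto
    then show ?thesis using T_integral[OF that] by simp
  qed
  then show False using T_nonzero by blast
qed

end

section \<open>Transverse measures in flow boxes\<close>

text \<open>Two points of a flow box have the same value exactly when they lie in the same
  plaque.\<close>

definition plaque :: "'n \<Rightarrow> ('a, 'n::finite) chart \<Rightarrow> 'a \<Rightarrow> complex^'n" where
  "plaque k c p = transverse k (snd c p)"

lemma norm_transverse_diff_le: "norm (transverse k x - transverse k y) \<le> norm (x - y :: complex^'n::finite)"
  unfolding norm_vec_def by (intro L2_set_mono) auto

lemma axis_decomposition:
  "transverse k x = transverse k x' \<Longrightarrow> x = x' + axis k (x $ k - x' $ k)"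
  by (auto simp: vec_eq_iff axis_def transverse_def split: if_splits)

lemma transverse_polydisc: "x \<in> polydisc \<Longrightarrow> transverse k x \<in> polydisc"
  by (auto simp: polydisc_def)

lemma axis_real_combination: "axis k w = Re w *\<^sub>R (axis k 1 :: complex^'n) + Im w *\<^sub>R axis k \<i>"
  by (auto simp: vec_eq_iff axis_def complex_eq_iff)

lemma compact_closed_cylinder:
  fixes K :: "(complex^'n::finite) set"
  assumes "compact K" "K \<subseteq> polydisc"
  shows "compact (cylinder k (cball 0 (1/2)) K)" "cylinder k (cball 0 (1/2)) K \<subseteq> polydisc"
proof -
  show sub: "cylinder k (cball 0 (1/2)) K \<subseteq> polydisc"
    by (rule cylinder_subset_polydisc) (use assms in auto)
  have "cylinder k (cball 0 (1/2)) K = (\<lambda>x. x $ k) -` cball 0 (1/2) \<inter> transverse k -` K"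
    by (auto simp: cylinder_def)
  moreover have "closed \<dots>"
    using continuous_on_transverse[of UNIV "\<lambda>x. x" k] compact_imp_closed[OF assms(1)]
    by (intro closed_Int closed_vimage continuous_intros) auto
  ultimately have "closed (cylinder k (cball 0 (1/2)) K)" by simp
  moreover have "bounded (cylinder k (cball 0 (1/2)) K)"
    by (rule bounded_subset[OF compact_imp_bounded[OF compact_closed_polydisc[of 1]]])
       (use sub in \<open>auto simp: polydisc_def subset_iff less_imp_le\<close>)
  ultimately show "compact (cylinder k (cball 0 (1/2)) K)" by (simp add: compact_eq_bounded_closed)
qed

text \<open>A quantitative inverse function argument on complex lines parallel to the leaves: along
  them the derivative of \<open>u\<close> at \<open>x0\<close> is bounded below by \<open>B\<close>
  and changes by at most \<open>B / 2\<close> nearby. It shows that a transversal locally meets each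
  plaque at most once.\<close>

lemma locally_injective_on_lines:
  fixes u :: "complex^'n::finite \<Rightarrow> complex"
  assumes S: "open S" and u: "smooth_on S u" and x0: "x0 \<in> S"
    and inj: "\<And>w. w \<noteq> 0 \<Longrightarrow> frechet_derivative u (at x0) (axis k w) \<noteq> 0"
  obtains d where "d > 0" "ball x0 d \<subseteq> S"
    "\<And>x x'. x \<in> ball x0 d \<Longrightarrow> x' \<in> ball x0 d \<Longrightarrow> transverse k x = transverse k x' \<Longrightarrow> u x = u x' \<Longrightarrow> x = x'"
proof -
  let ?D = "\<lambda>x w. frechet_derivative u (at x) (axis k w)"
  have axl: "bounded_linear (axis k :: complex \<Rightarrow> complex^'n)"
    unfolding linear_conv_bounded_linear[symmetric]
    by (rule linearI) (auto simp: axis_def vec_eq_iff)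
  have Dl: "bounded_linear (?D x)" if "x \<in> S" for x
    using bounded_linear_compose[OF has_derivative_bounded_linear[OF smooth_on_has_derivative[OF u that]] axl] .
  have "inj (?D x0)"
    unfolding linear_injective_0[OF bounded_linear.linear[OF Dl[OF x0]]] using inj by blast
  then obtain B where B: "B > 0" "\<And>w. B * norm w \<le> norm (?D x0 w)"
    using linear_inj_bounded_below_pos[OF bounded_linear.linear[OF Dl[OF x0]]] by blast
  obtain d0 where d0: "d0 > 0" "ball x0 d0 \<subseteq> S" using S x0 openE by blast
  \<comment> \<open>The two real directions 1 and \<i> span the line; an error of
    \<open>B / 4\<close> in each gives \<open>B / 2\<close> in total.\<close>
  have "isCont (\<lambda>x. ?D x 1) x0" "isCont (\<lambda>x. ?D x \<i>) x0"
    by (rule smooth_on_isCont[OF smooth_on_frechet_derivative[OF u] x0])+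
  moreover have "B / 4 > 0" using B by simp
  ultimately obtain d1 d2 where d12: "d1 > 0" "d2 > 0"
    "\<And>x. dist x x0 < d1 \<Longrightarrow> dist (?D x 1) (?D x0 1) < B / 4"
    "\<And>x. dist x x0 < d2 \<Longrightarrow> dist (?D x \<i>) (?D x0 \<i>) < B / 4"
    unfolding continuous_at_eps_delta by blast
  define d where "d = min d0 (min d1 d2)"
  have d: "d > 0" "ball x0 d \<subseteq> S" using d0 d12 by (auto simp: d_def)
  have close: "norm (?D x w - ?D x0 w) \<le> B / 2 * norm w" if x: "x \<in> ball x0 d" for x w
  proof -
    have dx: "dist x x0 < d1" "dist x x0 < d2" using x by (auto simp: d_def dist_commute)
    have xS: "x \<in> S" using x d by blast
    have ex: "?D y w = Re w *\<^sub>R ?D y 1 + Im w *\<^sub>R ?D y \<i>" if "y \<in> S" for y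
      unfolding axis_real_combination[of k w]
      using has_derivative_linear[OF smooth_on_has_derivative[OF u that]] by (simp add: linear_add linear_cmul)
    have "?D x w - ?D x0 w = Re w *\<^sub>R (?D x 1 - ?D x0 1) + Im w *\<^sub>R (?D x \<i> - ?D x0 \<i>)"
      unfolding ex[OF xS] ex[OF x0] by (simp add: algebra_simps)
    also have "norm \<dots> \<le> \<bar>Re w\<bar> * norm (?D x 1 - ?D x0 1) + \<bar>Im w\<bar> * norm (?D x \<i> - ?D x0 \<i>)"
      by (rule norm_triangle_le) simp
    also have "\<dots> \<le> norm w * (B / 4) + norm w * (B / 4)"
      using d12(3)[OF dx(1)] d12(4)[OF dx(2)] abs_Re_le_cmod[of w] abs_Im_le_cmod[of w]
      by (intro add_mono mult_mono) (auto simp: dist_norm)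
    finally show ?thesis by simp
  qed
  show thesis
  proof (rule that[OF d])
    fix x x' assume x: "x \<in> ball x0 d" "x' \<in> ball x0 d" and tr: "transverse k x = transverse k x'" and ux: "u x = u x'"
    define w where "w = x $ k - x' $ k"
    have xw: "x = x' + axis k w" unfolding w_def by (rule axis_decomposition[OF tr])
    define L where "L = (\<lambda>\<zeta>. x' + axis k \<zeta>) -` ball x0 d"
    have a0: "axis k (0::complex) = (0 :: complex^'n)" by (simp add: vec_eq_iff axis_def)
    have "convex L"
    proof -
      have "L = (axis k) -` (ball (x0 - x') d)"
        by (auto simp: L_def dist_norm algebra_simps)
      then show ?thesis using convex_linear_vimage[OF bounded_linear.linear[OF axl] convex_ball] by metis
    qed
    \<comment> \<open>Subtracting the derivative at \<open>x0\<close> leaves a function with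
      derivative of norm at most \<open>B / 2\<close> on the convex set \<open>L\<close>. If
      \<open>u\<close> takes equal values at both points, the lower bound \<open>B\<close> forces
      \<open>w = 0\<close>.\<close>
    let ?f = "\<lambda>\<zeta>. u (x' + axis k \<zeta>) - ?D x0 \<zeta>"
    have "norm (?f w - ?f 0) \<le> B / 2 * norm (w - 0)"
    proof (rule differentiable_bound[OF \<open>convex L\<close>])
      fix \<zeta> assume "\<zeta> \<in> L"
      then have \<zeta>: "x' + axis k \<zeta> \<in> ball x0 d" by (simp add: L_def)
      then have \<zeta>S: "x' + axis k \<zeta> \<in> S" using d by blast
      have "((\<lambda>\<zeta>. x' + axis k \<zeta>) has_derivative axis k) (at \<zeta>)"
        using has_derivative_add[OF has_derivative_const[of x'] bounded_linear_imp_has_derivative[OF axl]] by simp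
      from has_derivative_compose[OF this smooth_on_has_derivative[OF u \<zeta>S]]
      have "((\<lambda>\<zeta>. u (x' + axis k \<zeta>)) has_derivative ?D (x' + axis k \<zeta>)) (at \<zeta>)" .
      then have "(?f has_derivative (\<lambda>h. ?D (x' + axis k \<zeta>) h - ?D x0 h)) (at \<zeta>)"
        by (rule has_derivative_diff[OF _ bounded_linear_imp_has_derivative[OF Dl[OF x0]]])
      then show "(?f has_derivative (\<lambda>h. ?D (x' + axis k \<zeta>) h - ?D x0 h)) (at \<zeta> within L)"
        by (rule has_derivative_at_withinI)
      show "onorm (\<lambda>h. ?D (x' + axis k \<zeta>) h - ?D x0 h) \<le> B / 2"
        by (rule onorm_bound) (use close[OF \<zeta>] B in auto)
    next
      show "w \<in> L" "0 \<in> L" using x xw by (auto simp: L_def a0)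
    qed
    moreover have "u (x' + axis k w) = u x'" using ux xw by simp
    ultimately have "norm (?D x0 w) \<le> B / 2 * norm w"
      using linear_0[OF bounded_linear.linear[OF Dl[OF x0]]] by (simp add: a0)
    with B(2)[of w] have "B / 2 * norm w \<le> 0" by simp
    then have "w = 0" using B(1) by (simp add: mult_le_0_iff)
    then show "x = x'" using xw by (simp add: a0)
  qed
qed

section \<open>Transition maps of flow boxes and compact pieces of transversals\<close>

context pluriexact_foliation
begin

lemma box_overlap_plaques:
  assumes "c \<in> F" "c' \<in> F" "p \<in> fst c" "p \<in> fst c'"
  obtains N where "open N" "snd c p \<in> N" "N \<subseteq> overlap c c'"
    "\<And>y y'. y \<in> N \<Longrightarrow> y' \<in> N \<Longrightarrow> transverse k y = transverse k y' \<Longrightarrow>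
       transverse k (trans_map c c' y) = transverse k (trans_map c c' y')"
proof -
  have "snd c p \<in> overlap c c'" using assms by blast
  then obtain N where "open N" "snd c p \<in> N" "N \<subseteq> overlap c c'"
    "\<forall>y\<in>N. \<forall>y'\<in>N. same_transverse k y y' \<longrightarrow> same_transverse k (trans_map c c' y) (trans_map c c' y')"
    using foliation assms(1,2) unfolding foliation_def by meson
  then show thesis using that[of N] unfolding same_transverse_iff by blast
qed

lemma overlap_point:
  assumes "c \<in> A" "z \<in> fst c" "snd c z \<in> overlap c c'"
  shows "z \<in> fst c'"
proof -
  obtain q where "snd c z = snd c q" "q \<in> fst c" "q \<in> fst c'" using assms(3) by blast
  then show ?thesis using chart_inj[OF assms(1)] assms(2) by (metis inj_onD)
qed

text \<open>The transverse coordinates of the transition map are constant along a plaque near the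
  point, so their derivative in the leaf direction is 0. The leaf component cannot vanish because
  the derivative is invertible.\<close>

lemma dtrans_leaf_direction:
  assumes c: "c \<in> F" "c' \<in> F" and p: "p \<in> fst c" "p \<in> fst c'"
  shows "dtrans c c' (snd c p) (axis k 1) = axis k (leaf_speed k c c' p)" "leaf_speed k c c' p \<noteq> 0"
proof -
  note cA = box_in_A[OF c(1)] box_in_A[OF c(2)]
  let ?x = "snd c p" and ?e = "axis k 1 :: complex^'n"
  obtain N where N: "open N" "?x \<in> N" "N \<subseteq> overlap c c'"
    "\<And>y y'. y \<in> N \<Longrightarrow> y' \<in> N \<Longrightarrow> transverse k y = transverse k y' \<Longrightarrow>
       transverse k (trans_map c c' y) = transverse k (trans_map c c' y')"
    using box_overlap_plaques[OF c p] by blast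
  have "dtrans c c' ?x ?e $ j = 0" if "j \<noteq> k" for j
  proof -
    have line: "((\<lambda>s::real. ?x + s *\<^sub>R ?e) has_derivative (\<lambda>s. s *\<^sub>R ?e)) (at 0)"
      by (auto intro!: derivative_eq_intros)
    have tm: "(trans_map c c' has_derivative dtrans c c' ?x) (at (?x + 0 *\<^sub>R ?e))"
      using trans_map_has_derivative[OF cA, of ?x] p by auto
    have d1: "((\<lambda>s. trans_map c c' (?x + s *\<^sub>R ?e) $ j) has_derivative (\<lambda>s. dtrans c c' ?x (s *\<^sub>R ?e) $ j)) (at 0)"
      by (rule bounded_linear.has_derivative[OF bounded_linear_vec_nth has_derivative_compose[OF line tm]])
    have op: "open ((\<lambda>s::real. ?x + s *\<^sub>R ?e) -` N)"
      by (intro open_vimage N(1) continuous_intros)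
    have eq: "trans_map c c' ?x $ j = trans_map c c' (?x + s *\<^sub>R ?e) $ j" if s: "s \<in> (\<lambda>s::real. ?x + s *\<^sub>R ?e) -` N" for s
    proof -
      have "transverse k ?x = transverse k (?x + s *\<^sub>R ?e)" by (simp add: vec_eq_iff axis_def)
      then have "transverse k (trans_map c c' ?x) = transverse k (trans_map c c' (?x + s *\<^sub>R ?e))"
        using s by (intro N(4) N(2)) simp_all
      then have "transverse k (trans_map c c' ?x) $ j = transverse k (trans_map c c' (?x + s *\<^sub>R ?e)) $ j" by simp
      then show ?thesis using \<open>j \<noteq> k\<close> by simp
    qed
    have "((\<lambda>s. trans_map c c' ?x $ j) has_derivative (\<lambda>s::real. 0)) (at 0)" by simp
    then have d2: "((\<lambda>s. trans_map c c' (?x + s *\<^sub>R ?e) $ j) has_derivative (\<lambda>s::real. 0)) (at 0)"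
      by (rule has_derivative_transform_within_open[OF _ op _ eq]) (use N(2) in simp_all)
    from fun_cong[OF has_derivative_unique[OF d1 d2], of 1] show ?thesis by simp
  qed
  then show eq: "dtrans c c' ?x ?e = axis k (leaf_speed k c c' p)"
    by (auto simp: vec_eq_iff axis_def leaf_speed_def)
  show "leaf_speed k c c' p \<noteq> 0"
  proof
    assume "leaf_speed k c c' p = 0"
    then have 0: "dtrans c c' ?x ?e = 0" unfolding eq by (simp add: vec_eq_iff axis_def)
    have "?e = dtrans c' c (snd c' p) (dtrans c c' ?x ?e)"
      using dtrans_cocycle[OF cA cA(1) p p(1), of ?e] dtrans_self[OF cA(1) p(1), of ?e] by simp
    also have "\<dots> = 0"
      unfolding 0 using p by (intro linear_0 dtrans_linear cA) auto
    finally show False by (simp add: vec_eq_iff axis_def split: if_splits)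
  qed
qed

lemma plaque_continuous: "c \<in> A \<Longrightarrow> continuous_on (fst c) (plaque k c)"
  unfolding plaque_def by (intro continuous_on_transverse chart_continuous)

lemma plaque_polydisc: "c \<in> F \<Longrightarrow> p \<in> fst c \<Longrightarrow> plaque k c p \<in> polydisc"
  unfolding plaque_def using box_image by (intro transverse_polydisc) blast

text \<open>By compactness the injective continuous map \<open>plaque k c\<close> is a homeomorphism
  from \<open>C\<close> onto its image, so it carries Borel subsets of \<open>C\<close> to Borel
  sets and compact sets back to compact sets.\<close>

definition piece :: "('a, 'n) chart \<Rightarrow> 'a set \<Rightarrow> bool" where
  "piece c C \<longleftrightarrow> c \<in> F \<and> compact C \<and> C \<subseteq> fst c \<and> inj_on (plaque k c) C"

lemma piece_continuous: "piece c C \<Longrightarrow> continuous_on C (plaque k c)"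
  unfolding piece_def by (elim conjE, rule continuous_on_subset[OF plaque_continuous[OF box_in_A]])

lemma piece_inverse_continuous:
  assumes "piece c C"
  shows "continuous_on (plaque k c ` C) (inv_into C (plaque k c))"
  using assms by (intro continuous_on_inv piece_continuous) (auto simp: piece_def)

lemma piece_image_borel:
  assumes C: "piece c C" and E: "E \<in> sets borel" "E \<subseteq> C"
  shows "plaque k c ` E \<in> sets borel"
proof -
  let ?g = "inv_into C (plaque k c)"
  have inj: "inj_on (plaque k c) C" using C by (simp add: piece_def)
  have img: "plaque k c ` C \<in> sets borel"
    using C piece_continuous[OF C] by (intro borel_compact compact_continuous_image) (auto simp: piece_def)
  have "?g \<in> borel_measurable (restrict_space borel (plaque k c ` C))"
    by (rule borel_measurable_continuous_on_restrict[OF piece_inverse_continuous[OF C]])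
  from measurable_sets[OF this E(1)]
  have "?g -` E \<inter> plaque k c ` C \<in> sets (restrict_space borel (plaque k c ` C))"
    by (simp add: space_restrict_space)
  moreover have "?g -` E \<inter> plaque k c ` C = plaque k c ` E"
    using E(2) inj by (force simp: inv_into_f_f)
  ultimately show ?thesis using img by (simp add: sets_restrict_space_iff)
qed

text \<open>Finitely many flow boxes cover the compact manifold, and each is homeomorphic to an open
  set of a second countable space.\<close>

lemma countably_coverable_manifold: "countably_coverable TYPE('a)"
  unfolding countably_coverable_def
proof (intro allI impI)
  fix \<U> :: "'a set set" assume op: "\<forall>U\<in>\<U>. open U"
  have "\<exists>G\<subseteq>F. finite G \<and> UNIV \<subseteq> (\<Union>c\<in>G. fst c)"
    by (rule compactE_image[OF compact_UNIV, of F fst]) (use box_cover chart_open(1) box_in_A in auto)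
  then obtain G where G: "G \<subseteq> F" "finite G" "UNIV \<subseteq> (\<Union>c\<in>G. fst c)" by blast
  have "\<exists>\<V>\<subseteq>\<U>. countable \<V> \<and> \<Union>\<U> \<inter> fst c \<subseteq> \<Union>\<V>" if c: "c \<in> G" for c
  proof -
    have cA: "c \<in> A" using c G box_in_A by blast
    let ?im = "\<lambda>U. snd c ` (U \<inter> fst c)"
    have "open W" if W: "W \<in> ?im ` \<U>" for W
    proof -
      obtain U where U: "U \<in> \<U>" "W = ?im U" using W by blast
      show ?thesis unfolding U(2) using U(1) op chart_open(1)[OF cA] by (intro chart_open_image[OF cA]) auto
    qed
    then obtain \<W> where W: "\<W> \<subseteq> ?im ` \<U>" "countable \<W>" "\<Union>\<W> = \<Union>(?im ` \<U>)"
      using Lindelof[of "?im ` \<U>"] by metis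
    obtain \<V> where V: "\<V> \<subseteq> \<U>" "countable \<V>" "\<W> = ?im ` \<V>"
      using W(1,2) countable_subset_image[of \<W> ?im \<U>] by blast
    have "\<Union>\<U> \<inter> fst c \<subseteq> \<Union>\<V>"
    proof
      fix z assume z: "z \<in> \<Union>\<U> \<inter> fst c"
      then have "snd c z \<in> \<Union>(?im ` \<V>)" using W(3) V(3) by blast
      then obtain U q where q: "U \<in> \<V>" "q \<in> U" "q \<in> fst c" "snd c z = snd c q" by blast
      then have "z = q" using chart_inj[OF cA] z by (auto dest: inj_onD)
      then show "z \<in> \<Union>\<V>" using q by blast
    qed
    then show ?thesis using V by blast
  qed
  then obtain \<V> where V: "\<And>c. c \<in> G \<Longrightarrow> \<V> c \<subseteq> \<U> \<and> countable (\<V> c) \<and> \<Union>\<U> \<inter> fst c \<subseteq> \<Union>(\<V> c)" by metis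
  show "\<exists>\<F>'\<subseteq>\<U>. countable \<F>' \<and> \<Union>\<F>' = \<Union>\<U>"
  proof (intro exI[of _ "\<Union>c\<in>G. \<V> c"] conjI)
    show "(\<Union>c\<in>G. \<V> c) \<subseteq> \<U>" using V by blast
    show "countable (\<Union>c\<in>G. \<V> c)" using V G(2) by (intro countable_UN) (auto intro: countable_finite)
    show "\<Union>(\<Union>c\<in>G. \<V> c) = \<Union>\<U>"
    proof
      show "\<Union>(\<Union>c\<in>G. \<V> c) \<subseteq> \<Union>\<U>" using V by blast
      show "\<Union>\<U> \<subseteq> \<Union>(\<Union>c\<in>G. \<V> c)"
      proof
        fix z assume z: "z \<in> \<Union>\<U>"
        obtain c where "c \<in> G" "z \<in> fst c" using G(3) by blast
        then show "z \<in> \<Union>(\<Union>c\<in>G. \<V> c)" using z V[of c] by blast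
      qed
    qed
  qed
qed

text \<open>The transversal is given near \<open>p\<close> by an equation in some box
  \<open>c0\<close>, but the piece is wanted in a prescribed box \<open>c\<close>. Near
  \<open>p\<close>, points on one plaque of \<open>c\<close> lie on one plaque of \<open>c0\<close>,
  where the equation has at most one solution.\<close>

lemma transversal_piece:
  assumes \<Sigma>: "transversal k F \<Sigma>" and p: "p \<in> \<Sigma>" and c: "c \<in> F" "p \<in> fst c"
  shows "\<exists>U. open U \<and> p \<in> U \<and> (\<exists>C. piece c C \<and> C \<subseteq> \<Sigma> \<and> \<Sigma> \<inter> U \<subseteq> C)"
proof -
  obtain c0 V u where c0: "c0 \<in> F" and V: "open V" "p \<in> V" "V \<subseteq> fst c0"
    and u: "smooth_on (snd c0 ` V) (u :: complex^'n \<Rightarrow> complex)"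
    and Du: "\<And>x w. x \<in> snd c0 ` V \<Longrightarrow> w \<noteq> 0 \<Longrightarrow> frechet_derivative u (at x) (axis k w) \<noteq> 0"
    and \<Sigma>V: "\<Sigma> \<inter> V = {q \<in> V. u (snd c0 q) = 0}"
    using \<Sigma> p unfolding transversal_def by meson
  note cA = box_in_A[OF c(1)] box_in_A[OF c0]
  have pc0: "p \<in> fst c0" using V by blast
  have px: "snd c0 p \<in> snd c0 ` V" using V by blast
  obtain d where d: "d > 0" "ball (snd c0 p) d \<subseteq> snd c0 ` V"
    and inj: "\<And>x x'. x \<in> ball (snd c0 p) d \<Longrightarrow> x' \<in> ball (snd c0 p) d \<Longrightarrow> transverse k x = transverse k x' \<Longrightarrow> u x = u x' \<Longrightarrow> x = x'"
    using locally_injective_on_lines[OF chart_open_image[OF cA(2) V(1,3)] u px Du[OF px]] by metis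
  obtain N where N: "open N" "snd c p \<in> N" "N \<subseteq> overlap c c0"
    "\<And>y y'. y \<in> N \<Longrightarrow> y' \<in> N \<Longrightarrow> transverse k y = transverse k y' \<Longrightarrow>
       transverse k (trans_map c c0 y) = transverse k (trans_map c c0 y')"
    using box_overlap_plaques[OF c(1) c0 c(2) pc0] by blast
  \<comment> \<open>On \<open>W\<close> three things hold: the equation of the transversal is valid,
    \<open>u\<close> is injective along plaques of \<open>c0\<close>, and plaques of
    \<open>c\<close> map into plaques of \<open>c0\<close>.\<close>
  define W where "W = V \<inter> {z \<in> fst c0. snd c0 z \<in> ball (snd c0 p) d} \<inter> {z \<in> fst c. snd c z \<in> N}"
  have W: "open W" "p \<in> W" "W \<subseteq> fst c"
    using V d c pc0 N chart_open_preimage[OF cA(1) N(1)] chart_open_preimage[OF cA(2) open_ball]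
    by (auto simp: W_def intro!: open_Int)
  have opW: "open (snd c ` W)" by (rule chart_open_image[OF cA(1) W(1,3)])
  obtain r where r: "r > 0" "cball (snd c p) r \<subseteq> snd c ` W"
    using open_contains_cball[THEN iffD1, OF opW] W(2) by blast
  have Wback: "z \<in> W" if z: "z \<in> fst c" "snd c z \<in> cball (snd c p) r" for z
  proof -
    obtain q where q: "q \<in> W" "snd c z = snd c q" using z(2) r(2) by blast
    then have "z = q" using z(1) W(3) by (intro inj_onD[OF chart_inj[OF cA(1)]]) auto
    then show ?thesis using q by simp
  qed
  define B where "B = {z \<in> fst c. snd c z \<in> cball (snd c p) r}"
  have BW: "B \<subseteq> W" using Wback by (auto simp: B_def)
  have Bc: "compact B"
    unfolding B_def using r(2) W(3) by (intro chart_compact_preimage cA) auto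
  define C where "C = \<Sigma> \<inter> B"
  define U where "U = {z \<in> fst c. snd c z \<in> ball (snd c p) r}"
  have "compact C"
  proof -
    \<comment> \<open>The transversal need not be closed, but inside \<open>V\<close> it is a zero
      set, hence relatively closed; this makes \<open>C\<close> compact.\<close>
    have "C = B \<inter> (\<lambda>z. u (snd c0 z)) -` {0}"
      using BW \<Sigma>V by (auto simp: C_def W_def)
    moreover have "continuous_on B (\<lambda>z. u (snd c0 z))"
    proof (rule continuous_on_compose2[OF smooth_on_continuous_on[OF u]])
      show "continuous_on B (snd c0)"
        by (rule continuous_on_subset[OF chart_continuous[OF cA(2)]]) (use BW V W_def in auto)
      show "snd c0 ` B \<subseteq> snd c0 ` V" using BW by (auto simp: W_def)
    qed
    ultimately have "closed C"
      using continuous_closed_preimage[of B "\<lambda>z. u (snd c0 z)" "{0}"] compact_imp_closed[OF Bc] by simp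
    then show ?thesis using compact_Int_closed[OF compact_UNIV] by simp
  qed
  moreover have "inj_on (plaque k c) C"
  proof (rule inj_onI)
    fix z z' assume z: "z \<in> C" "z' \<in> C" "plaque k c z = plaque k c z'"
    have W2: "z \<in> W" "z' \<in> W" using z BW by (auto simp: C_def)
    have "transverse k (trans_map c c0 (snd c z)) = transverse k (trans_map c c0 (snd c z'))"
      using W2 z(3) by (intro N(4)) (auto simp: W_def plaque_def)
    then have tr: "transverse k (snd c0 z) = transverse k (snd c0 z')"
      using W2 W(3) by (simp add: trans_map_apply[OF cA(1)] subset_iff)
    have u0: "u (snd c0 z) = u (snd c0 z')"
    proof -
      have "z \<in> \<Sigma> \<inter> V" "z' \<in> \<Sigma> \<inter> V" using z W2 by (auto simp: C_def W_def)
      then show ?thesis unfolding \<Sigma>V by simp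
    qed
    have mem: "snd c0 z \<in> ball (snd c0 p) d" "snd c0 z' \<in> ball (snd c0 p) d" "z \<in> fst c0" "z' \<in> fst c0"
      using W2 by (auto simp: W_def)
    show "z = z'"
      by (rule inj_onD[OF chart_inj[OF cA(2)] inj[OF mem(1,2) tr u0] mem(3,4)])
  qed
  ultimately have "piece c C" using c(1) BW W(3) by (auto simp: piece_def C_def)
  moreover have "open U" unfolding U_def by (rule chart_open_preimage[OF cA(1) open_ball])
  moreover have "p \<in> U" using c(2) r(1) by (simp add: U_def)
  moreover have "\<Sigma> \<inter> U \<subseteq> C" by (auto simp: C_def B_def U_def)
  moreover have "C \<subseteq> \<Sigma>" by (simp add: C_def)
  ultimately show ?thesis by blast
qed

end

section \<open>Comparison of the transverse measures of different flow boxes\<close>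

context directed_current
begin

definition tube :: "('a, 'n) chart \<Rightarrow> complex \<Rightarrow> real \<Rightarrow> (complex^'n) set \<Rightarrow> 'a set" where
  "tube c b \<rho> Q = {z \<in> fst c. snd c z \<in> cylinder k (ball b \<rho>) Q}"

text \<open>The mass of the tube of leafwise radius 1/2 over a set of plaques. The radius is a
  normalisation: any tube of radius \<rho> compactly inside the disc has
  \<open>4 * \<rho>\<^sup>2\<close> times this mass.\<close>

definition transverse_measure :: "('a, 'n) chart \<Rightarrow> (complex^'n) measure" where
  "transverse_measure c =
     distr (density (chart_measure c) (indicator (cylinder k (ball 0 (1/2)) UNIV))) borel (transverse k)"

lemma sets_transverse_measure [measurable_cong]: "sets (transverse_measure c) = sets borel"
  by (simp add: transverse_measure_def)

lemma emeasure_transverse_measure: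
  assumes Q [measurable]: "Q \<in> sets borel"
  shows "emeasure (transverse_measure c) Q = emeasure (chart_measure c) (cylinder k (ball 0 (1/2)) Q)"
proof -
  let ?C = "cylinder k (ball 0 (1/2)) UNIV :: (complex^'n) set"
  have sc: "sets (chart_measure c) = sets borel" by (simp add: chart_measure_def)
  have sp: "space (chart_measure c) = UNIV" by (simp add: chart_measure_def)
  have C: "?C \<in> sets borel" by (rule cylinder_borel) auto
  have v: "transverse k -` Q \<in> sets borel"
    using measurable_sets[OF borel_measurable_transverse Q, of k] by simp
  have t: "transverse k \<in> measurable (density (chart_measure c) (indicator ?C)) borel"
    by (simp add: sc cong: measurable_cong_sets)
  have "emeasure (transverse_measure c) Q = emeasure (density (chart_measure c) (indicator ?C)) (transverse k -` Q)"
    unfolding transverse_measure_def by (subst emeasure_distr[OF t Q]) (simp add: sp)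
  also have "\<dots> = (\<integral>\<^sup>+x. indicator ?C x * indicator (transverse k -` Q) x \<partial>chart_measure c)"
    using v C by (intro emeasure_density) (auto simp: sc intro!: borel_measurable_indicator)
  also have "\<dots> = emeasure (chart_measure c) (?C \<inter> transverse k -` Q)"
    using v C by (simp add: indicator_inter_arith[symmetric] sc)
  also have "?C \<inter> transverse k -` Q = cylinder k (ball 0 (1/2)) Q" by (auto simp: cylinder_def)
  finally show ?thesis .
qed

abbreviation plaque_mass :: "('a, 'n) chart \<Rightarrow> 'a set \<Rightarrow> ennreal" where
  "plaque_mass c E \<equiv> emeasure (transverse_measure c) (plaque k c ` E)"

lemma transverse_measure_finite_compact:
  assumes "c \<in> F" "compact K" "K \<subseteq> polydisc"
  shows "emeasure (transverse_measure c) K < \<infinity>"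
proof -
  have "emeasure (transverse_measure c) K \<le> emeasure (chart_measure c) (cylinder k (cball 0 (1/2)) K)"
    unfolding emeasure_transverse_measure[OF borel_compact[OF assms(2)]]
    using borel_compact[OF compact_closed_cylinder(1)[OF assms(2,3)], of k]
    by (intro emeasure_mono) (auto simp: cylinder_def chart_measure_def)
  also have "\<dots> < \<infinity>"
    by (rule chart_measure_finite_compact[OF assms(1) compact_closed_cylinder[OF assms(2,3)]])
  finally show ?thesis .
qed

lemma chart_preimage_borel:
  assumes "c \<in> A" "Y \<in> sets borel"
  shows "{z \<in> fst c. snd c z \<in> Y} \<in> sets borel"
proof -
  have "{z \<in> fst c. snd c z \<in> Y} = fst c \<inter> chart_ext c -` Y" by (auto simp: chart_ext_def)
  also have "\<dots> \<in> sets borel"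
    using measurable_sets[OF chart_ext_measurable[OF assms(1)] assms(2)] chart_open(1)[OF assms(1)]
    by (intro sets.Int) auto
  finally show ?thesis .
qed

lemma tube_borel: "c \<in> F \<Longrightarrow> Q \<in> sets borel \<Longrightarrow> tube c b \<rho> Q \<in> sets borel"
  unfolding tube_def by (intro chart_preimage_borel box_in_A cylinder_borel) auto

lemma leaf_measure_tube:
  assumes "c \<in> F" "Q \<in> sets borel" "Q \<subseteq> polydisc" "cmod b + \<rho> < 1" "\<rho> > 0"
  shows "emeasure (leaf_measure c) (tube c b \<rho> Q) = ennreal (4 * \<rho>\<^sup>2) * emeasure (transverse_measure c) Q"
proof -
  have "cylinder k (ball b \<rho>) Q \<in> sets borel" using assms by (intro cylinder_borel) auto
  then have "emeasure (leaf_measure c) (tube c b \<rho> Q) = emeasure (chart_measure c) (cylinder k (ball b \<rho>) Q)"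
    unfolding tube_def by (rule emeasure_chart_measure[OF assms(1), symmetric])
  then show ?thesis
    unfolding emeasure_transverse_measure[OF assms(2)]
    using cylinder_measure[OF chart_measure_derivative_null[OF assms(1)] assms(2-5)] by simp
qed

text \<open>The tube over \<open>E\<close> of radius \<open>r\<close> in the box \<open>c\<close> is contained in a tube of radius about
  \<open>r * cmod (leaf_speed k c c' p)\<close> in the box \<open>c'\<close>. Comparing their masses shows that the two
  transverse measures agree infinitesimally.\<close>

lemma transverse_measure_compare_local:
  assumes c: "c \<in> F" "c' \<in> F" and p: "p \<in> fst c" "p \<in> fst c'" and \<eta>: "0 < \<eta>" "\<eta> < 1"
  shows "\<exists>U. open U \<and> p \<in> U \<and> (\<forall>E\<subseteq>U. plaque k c ` E \<in> sets borel \<longrightarrow> plaque k c' ` E \<in> sets borel \<longrightarrow>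
     ennreal ((1 - \<eta>)\<^sup>2) * plaque_mass c E
       \<le> ennreal ((1 + \<eta>)\<^sup>2) * plaque_mass c' E)"
proof -
  note cA = box_in_A[OF c(1)] box_in_A[OF c(2)]
  define x0 where "x0 = snd c p"
  define b where "b = snd c' p $ k"
  define K where "K = cmod (leaf_speed k c c' p)"
  let ?e = "axis k 1 :: complex^'n"
  have K: "K > 0" using dtrans_leaf_direction(2)[OF c p] by (simp add: K_def)
  have x0: "x0 \<in> overlap c c'" using p by (auto simp: x0_def)
  obtain N where N: "open N" "x0 \<in> N" "N \<subseteq> overlap c c'"
    "\<And>y y'. y \<in> N \<Longrightarrow> y' \<in> N \<Longrightarrow> transverse k y = transverse k y' \<Longrightarrow>
       transverse k (trans_map c c' y) = transverse k (trans_map c c' y')"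
    using box_overlap_plaques[OF c p] unfolding x0_def by blast
  obtain d1 where d1: "d1 > 0" "ball x0 d1 \<subseteq> N" using N(1,2) openE by blast
  define D where "D u = dtrans c c' x0 u $ k" for u
  have "((\<lambda>x. trans_map c c' x $ k) has_derivative D) (at x0)"
    unfolding D_def by (rule bounded_linear.has_derivative[OF bounded_linear_vec_nth trans_map_has_derivative[OF cA x0]])
  then have Dbl: "bounded_linear D" and
    Dalt: "\<And>e. e > 0 \<Longrightarrow> \<exists>d>0. \<forall>y. norm (y - x0) < d \<longrightarrow>
      norm (trans_map c c' y $ k - trans_map c c' x0 $ k - D (y - x0)) \<le> e * norm (y - x0)"
    unfolding has_derivative_at_alt by auto
  have "\<eta> * K / 4 > 0" using \<eta> K by simp
  from Dalt[OF this] obtain d2 where d2: "d2 > 0" "\<And>y. norm (y - x0) < d2 \<Longrightarrow>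
      norm (trans_map c c' y $ k - trans_map c c' x0 $ k - D (y - x0)) \<le> \<eta> * K / 4 * norm (y - x0)" by blast
  obtain B where B: "B > 0" "\<And>u. norm (D u) \<le> norm u * B"
    using bounded_linear.pos_bounded[OF Dbl] by blast
  have "isCont (\<lambda>x. dtrans c c' x ?e $ k) x0"
    by (rule smooth_on_isCont[OF smooth_on_dtrans[OF cA] x0])
  moreover have "\<eta> * K > 0" using \<eta> K by simp
  \<comment> \<open>This bounds the leaf speed below by \<open>(1 - \<eta>) * K\<close> on the tube,
    which gives the factor on the left of the estimate.\<close>
  ultimately obtain d3 where d3: "d3 > 0"
    "\<And>x. dist x x0 < d3 \<Longrightarrow> dist (dtrans c c' x ?e $ k) (dtrans c c' x0 ?e $ k) < \<eta> * K"
    unfolding continuous_at_eps_delta by blast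
  define d where "d = min d1 (min d2 d3)"
  have d: "d > 0" using d1 d2 d3 by (simp add: d_def)
  have "x0 \<in> polydisc" using p box_image[OF c(1)] unfolding x0_def by blast
  then have x0k: "cmod (x0 $ k) < 1" by (simp add: polydisc_def)
  have "snd c' p \<in> polydisc" using p box_image[OF c(2)] by blast
  then have bk: "cmod b < 1" by (simp add: b_def polydisc_def)
  \<comment> \<open>The three bounds make a tube point stay within \<open>d\<close> of
    \<open>x0\<close>, keep the tube of radius \<open>r\<close> inside the disc of \<open>c\<close>,
    and keep the tube of radius \<open>\<rho>\<close> inside that of \<open>c'\<close>.\<close>
  define r where "r = min (d / 4) (min ((1 - cmod (x0 $ k)) / 2) ((1 - cmod b) / (2 * (1 + \<eta>) * K)))"
  \<comment> \<open>A tube point is displaced in the leaf coordinate of \<open>c'\<close> by less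
    than \<open>K * r\<close> through its leaf component, by at most
    \<open>\<eta> * K * r / 2\<close> through the error of linearisation, and by at most as much
    through its transverse component. The choice of \<open>s\<close> is made for this last bound;
    thus \<open>r\<close> is fixed first and \<open>E\<close> is confined to a thinner ball.\<close>
  define \<rho> where "\<rho> = (1 + \<eta>) * K * r"
  define s where "s = min r (\<eta> * K * r / (2 * B))"
  have r: "r > 0" "r \<le> d / 4" "cmod (x0 $ k) + r < 1"
  proof -
    have "0 < (1 - cmod b) / (2 * (1 + \<eta>) * K)" using bk \<eta> K by (intro divide_pos_pos mult_pos_pos) auto
    then show "r > 0" using d x0k by (simp add: r_def)
    show "r \<le> d / 4" unfolding r_def by (rule min.cobounded1)
    have "r \<le> (1 - cmod (x0 $ k)) / 2" unfolding r_def by (rule min.coboundedI2[OF min.cobounded1])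
    then have "r * 2 \<le> 1 - cmod (x0 $ k)" by (simp only: pos_le_divide_eq[OF zero_less_numeral])
    with x0k show "cmod (x0 $ k) + r < 1" by argo
  qed
  have \<rho>: "\<rho> > 0" using \<eta> K r by (simp add: \<rho>_def)
  have \<rho>1: "cmod b + \<rho> < 1"
  proof -
    have "r \<le> (1 - cmod b) / (2 * (1 + \<eta>) * K)" unfolding r_def by (rule min.coboundedI2[OF min.cobounded2])
    then have "2 * \<rho> \<le> 1 - cmod b"
      using \<eta> K by (simp add: \<rho>_def pos_le_divide_eq mult_ac)
    then show ?thesis using \<rho> by linarith
  qed
  have s: "s > 0" "s \<le> r" "B * s \<le> \<eta> * K * r / 2"
  proof -
    show "s > 0" "s \<le> r" using r \<eta> K B by (auto simp: s_def)
    have "s \<le> \<eta> * K * r / (2 * B)" unfolding s_def by (rule min.cobounded2)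
    then show "B * s \<le> \<eta> * K * r / 2" using B by (simp add: pos_le_divide_eq mult_ac)
  qed
  define U where "U = {z \<in> fst c. snd c z \<in> ball x0 s}"
  have "open U" unfolding U_def by (rule chart_open_preimage[OF cA(1) open_ball])
  moreover have "p \<in> U" using p s by (simp add: U_def x0_def)
  moreover have "ennreal ((1 - \<eta>)\<^sup>2) * plaque_mass c E
       \<le> ennreal ((1 + \<eta>)\<^sup>2) * plaque_mass c' E"
    if E: "E \<subseteq> U" and Q: "plaque k c ` E \<in> sets borel" and Q': "plaque k c' ` E \<in> sets borel" for E
  proof -
    let ?Q = "plaque k c ` E" and ?Q' = "plaque k c' ` E"
    define Z where "Z = tube c (x0 $ k) r ?Q"
    define Z' where "Z' = tube c' b \<rho> ?Q'"
    have EU: "e \<in> fst c" "dist x0 (snd c e) < s" if "e \<in> E" for e using E that by (auto simp: U_def)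
    have inN: "y \<in> N" if "norm (y - x0) < d" for y
      using that d1(2) by (auto simp: d_def dist_norm norm_minus_commute)
    have Ec': "e \<in> fst c'" "snd c e \<in> N" if "e \<in> E" for e
    proof -
      have "norm (snd c e - x0) < d"
        using EU(2)[OF that] s r d by (simp add: dist_norm norm_minus_commute)
      then show "snd c e \<in> N" by (rule inN)
      then show "e \<in> fst c'" using overlap_point[OF cA(1) EU(1)[OF that]] N(3) by blast
    qed
    have QD: "?Q \<subseteq> polydisc" "?Q' \<subseteq> polydisc"
      using plaque_polydisc[OF c(1)] plaque_polydisc[OF c(2)] EU(1) Ec'(1) by auto
    have Zd: "z \<in> fst c'" "z \<in> Z'" "norm (snd c z - x0) < d" if z: "z \<in> Z" for z
    proof -
      let ?y = "snd c z"
      have zc: "z \<in> fst c" and zk: "cmod (x0 $ k - ?y $ k) < r" and "plaque k c z \<in> ?Q"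
        using z by (auto simp: Z_def tube_def cylinder_def plaque_def dist_norm)
      then obtain e where e: "e \<in> E" "plaque k c z = plaque k c e" by blast
      define \<zeta> where "\<zeta> = ?y $ k - x0 $ k"
      define u where "u = transverse k ?y - transverse k x0"
      have \<zeta>: "cmod \<zeta> < r" using zk by (simp add: \<zeta>_def norm_minus_commute)
      have y: "?y - x0 = \<zeta> *s ?e + u"
        by (simp add: vec_eq_iff axis_def \<zeta>_def u_def)
      have "norm u \<le> norm (snd c e - x0)"
        using e(2) norm_transverse_diff_le[of k "snd c e" x0] by (simp add: u_def plaque_def)
      then have u: "norm u < s" using EU(2)[OF e(1)] by (simp add: dist_norm norm_minus_commute)
      have "norm (?y - x0) \<le> cmod \<zeta> + norm u"
        unfolding y by (rule order.trans[OF norm_triangle_ineq]) (simp add: norm_vector_scalar_mult norm_axis_1)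
      then have ny: "norm (?y - x0) < 2 * r" using \<zeta> u s by linarith
      then show yd: "norm (?y - x0) < d" using r d by linarith
      have yN: "?y \<in> N" by (rule inN[OF yd])
      then show zc': "z \<in> fst c'" using overlap_point[OF cA(1) zc] N(3) by blast
      have "transverse k (trans_map c c' ?y) = transverse k (trans_map c c' (snd c e))"
        using yN Ec'(2)[OF e(1)] e(2) by (intro N(4)) (auto simp: plaque_def)
      then have "plaque k c' z = plaque k c' e"
        by (simp add: plaque_def trans_map_apply[OF cA(1) zc] trans_map_apply[OF cA(1) EU(1)[OF e(1)]])
      then have zQ: "plaque k c' z \<in> ?Q'" using e(1) by blast
      have "D (\<zeta> *s ?e) = \<zeta> * leaf_speed k c c' p"
        using dtrans_smult[OF cA x0] by (simp add: D_def leaf_speed_def x0_def)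
      then have Dy: "D (?y - x0) = \<zeta> * leaf_speed k c c' p + D u"
        unfolding y using bounded_linear.linear[OF Dbl] by (simp add: linear_add)
      have err: "norm (trans_map c c' ?y $ k - trans_map c c' x0 $ k - D (?y - x0)) \<le> \<eta> * K / 4 * (2 * r)"
      proof -
        have "norm (?y - x0) < d2" using yd by (simp add: d_def)
        from d2(2)[OF this] show ?thesis
          by (rule order.trans) (use ny \<eta> K in \<open>intro mult_left_mono, auto\<close>)
      qed
      have Du: "norm (D u) \<le> \<eta> * K * r / 2"
      proof -
        have "norm (D u) \<le> norm u * B" by (rule B(2))
        also have "\<dots> \<le> s * B" using u B by (intro mult_right_mono) auto
        finally show ?thesis using s(3) by (simp add: mult.commute)
      qed
      have "snd c' z $ k - b = (trans_map c c' ?y $ k - trans_map c c' x0 $ k - D (?y - x0))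
          + (\<zeta> * leaf_speed k c c' p + D u)"
        unfolding Dy trans_map_apply[OF cA(1) zc]
        by (simp add: x0_def b_def trans_map_apply[OF cA(1) p(1)])
      then have "norm (snd c' z $ k - b) \<le> \<eta> * K / 4 * (2 * r) + (cmod \<zeta> * K + \<eta> * K * r / 2)"
        using err Du by (metis (no_types, lifting) K_def add_mono norm_mult norm_triangle_mono order_refl)
      also have "\<dots> < \<eta> * K / 4 * (2 * r) + (r * K + \<eta> * K * r / 2)"
        using \<zeta> K by simp
      also have "\<dots> = \<rho>" by (simp add: \<rho>_def algebra_simps)
      finally have "snd c' z $ k \<in> ball b \<rho>" by (simp add: dist_norm norm_minus_commute)
      then show "z \<in> Z'" using zc' zQ by (simp add: Z'_def tube_def cylinder_def plaque_def)
    qed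
    have ZB: "Z \<in> sets borel" "Z' \<in> sets borel"
      unfolding Z_def Z'_def by (rule tube_borel[OF c(1) Q], rule tube_borel[OF c(2) Q'])
    have Zsub: "Z \<subseteq> fst c \<inter> fst c'" using Zd(1) by (auto simp: Z_def tube_def)
    have "ennreal (((1 - \<eta>) * K)\<^sup>2) * emeasure (leaf_measure c) Z
        = (\<integral>\<^sup>+z. ennreal (((1 - \<eta>) * K)\<^sup>2) * indicator Z z \<partial>leaf_measure c)"
      using ZB(1) by (simp add: nn_integral_cmult_indicator sets_leaf_measure)
    also have "\<dots> \<le> (\<integral>\<^sup>+z. ennreal ((cmod (leaf_speed k c c' z))\<^sup>2) * indicator Z z \<partial>leaf_measure c)"
    proof (rule nn_integral_mono)
      fix z
      show "ennreal (((1 - \<eta>) * K)\<^sup>2) * indicator Z z \<le> ennreal ((cmod (leaf_speed k c c' z))\<^sup>2) * indicator Z z"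
      proof (cases "z \<in> Z")
        case True
        have "dist (snd c z) x0 < d3" using Zd(3)[OF True] by (simp add: d_def dist_norm)
        from d3(2)[OF this] have "norm (leaf_speed k c c' z - leaf_speed k c c' p) < \<eta> * K"
          by (simp add: leaf_speed_def x0_def dist_norm)
        then have "(1 - \<eta>) * K \<le> cmod (leaf_speed k c c' z)"
          using norm_triangle_ineq2[of "leaf_speed k c c' p" "leaf_speed k c c' z"]
          by (simp add: K_def norm_minus_commute algebra_simps)
        then have "((1 - \<eta>) * K)\<^sup>2 \<le> (cmod (leaf_speed k c c' z))\<^sup>2"
          using \<eta> K by (intro power_mono) auto
        then show ?thesis using True by (simp add: ennreal_leI)
      qed simp
    qed
    also have "\<dots> = emeasure (leaf_measure c') Z"
      by (rule leaf_measure_change[OF c ZB(1) Zsub, symmetric])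
    also have "\<dots> \<le> emeasure (leaf_measure c') Z'"
      using Zd(2) ZB by (intro emeasure_mono) (auto simp: sets_leaf_measure)
    also have "\<dots> = ennreal (4 * \<rho>\<^sup>2) * emeasure (transverse_measure c') ?Q'"
      unfolding Z'_def by (rule leaf_measure_tube[OF c(2) Q' QD(2) \<rho>1 \<rho>])
    also have "emeasure (leaf_measure c) Z = ennreal (4 * r\<^sup>2) * emeasure (transverse_measure c) ?Q"
      unfolding Z_def by (rule leaf_measure_tube[OF c(1) Q QD(1) r(3,1)])
    finally have le: "ennreal (((1 - \<eta>) * K)\<^sup>2) * (ennreal (4 * r\<^sup>2) * emeasure (transverse_measure c) ?Q)
        \<le> ennreal (4 * \<rho>\<^sup>2) * emeasure (transverse_measure c') ?Q'" .
    \<comment> \<open>The radius and the leaf speed enter both sides through this common factor, so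
      only the \<eta>-dependent factors survive.\<close>
    let ?w = "ennreal (4 * r\<^sup>2 * K\<^sup>2)"
    have e1: "ennreal (((1 - \<eta>) * K)\<^sup>2) * ennreal (4 * r\<^sup>2) = ?w * ennreal ((1 - \<eta>)\<^sup>2)"
      by (simp add: ennreal_mult[symmetric] power_mult_distrib mult_ac)
    have e2: "ennreal (4 * \<rho>\<^sup>2) = ?w * ennreal ((1 + \<eta>)\<^sup>2)"
      by (simp add: ennreal_mult[symmetric] \<rho>_def power_mult_distrib mult_ac)
    have "?w * (ennreal ((1 - \<eta>)\<^sup>2) * emeasure (transverse_measure c) ?Q)
        \<le> ?w * (ennreal ((1 + \<eta>)\<^sup>2) * emeasure (transverse_measure c') ?Q')"
      using le unfolding e2 mult.assoc[symmetric] e1 .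
    moreover have "?w \<noteq> 0" "?w \<noteq> top" using r K by auto
    ultimately show ?thesis by (simp add: ennreal_mult_le_mult_iff)
  qed
  ultimately show ?thesis by blast
qed

lemma piece_transverse_finite:
  assumes C: "piece c C" and E: "E \<in> sets borel" "E \<subseteq> C"
  shows "plaque_mass c E < \<infinity>"
proof -
  have cF: "c \<in> F" "compact C" "C \<subseteq> fst c" using C by (auto simp: piece_def)
  have cK: "compact (plaque k c ` C)" by (rule compact_continuous_image[OF piece_continuous[OF C] cF(2)])
  have "plaque_mass c E \<le> plaque_mass c C"
    using E borel_compact[OF cK] by (intro emeasure_mono) (auto simp: sets_transverse_measure)
  also have "\<dots> < \<infinity>"
    using plaque_polydisc[OF cF(1)] cF(3) by (intro transverse_measure_finite_compact[OF cF(1) cK]) auto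
  finally show ?thesis .
qed

text \<open>On a piece the plaque map is injective, so disjoint parts have disjoint images.\<close>

lemma piece_measure_partition:
  fixes E :: "nat \<Rightarrow> 'a set"
  assumes C: "piece c C" and E: "\<And>i. E i \<in> sets borel" "\<And>i. E i \<subseteq> C" "disjoint_family E"
  shows "(\<Sum>i. plaque_mass c (E i)) = plaque_mass c (\<Union>i. E i)"
proof -
  have inj: "inj_on (plaque k c) C" using C by (simp add: piece_def)
  have "disjoint_family (\<lambda>i. plaque k c ` E i)"
    unfolding disjoint_family_on_def
  proof (intro ballI impI)
    fix i j :: nat assume "i \<noteq> j"
    then have "E i \<inter> E j = {}" using E(3) by (simp add: disjoint_family_on_def)
    then show "plaque k c ` E i \<inter> plaque k c ` E j = {}"
      using inj_on_image_Int[OF inj E(2) E(2), of i j] by simp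
  qed
  then have "(\<Sum>i. plaque_mass c (E i)) = emeasure (transverse_measure c) (\<Union>i. plaque k c ` E i)"
    using piece_image_borel[OF C E(1,2)] by (intro suminf_emeasure) (auto simp: sets_transverse_measure)
  then show ?thesis by (simp add: image_UN)
qed

text \<open>The local comparison at precision \<open>\<eta>\<close> is summed over a countable Borel
  partition of \<open>E\<close> and only then does \<open>\<eta>\<close> tend to 0, since the
  partition depends on \<open>\<eta>\<close>. Exchanging the boxes gives equality.\<close>

lemma transverse_measure_le:
  assumes C: "piece c C" "piece c' C'" and E: "E \<in> sets borel" "E \<subseteq> C" "E \<subseteq> C'"
  shows "plaque_mass c E \<le> plaque_mass c' E"
proof -
  let ?X = "plaque_mass c E"
  let ?Y = "plaque_mass c' E"
  have cF: "c \<in> F" "C \<subseteq> fst c" "c' \<in> F" "C' \<subseteq> fst c'" using C by (auto simp: piece_def)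
  have le: "ennreal ((1 - \<eta>)\<^sup>2) * ?X \<le> ennreal ((1 + \<eta>)\<^sup>2) * ?Y" if \<eta>: "0 < \<eta>" "\<eta> < 1" for \<eta>
  proof -
    let ?P = "\<lambda>U. \<forall>E\<subseteq>U. plaque k c ` E \<in> sets borel \<longrightarrow> plaque k c' ` E \<in> sets borel \<longrightarrow>
     ennreal ((1 - \<eta>)\<^sup>2) * plaque_mass c E
       \<le> ennreal ((1 + \<eta>)\<^sup>2) * plaque_mass c' E"
    have "\<exists>U. open U \<and> p \<in> U \<and> ?P U" if "p \<in> E" for p
      using that E cF by (intro transverse_measure_compare_local \<eta>) auto
    then obtain A where A: "\<And>i::nat. A i \<in> sets borel" "disjoint_family A" "E \<subseteq> (\<Union>i. A i)"
      "\<And>i. A i = {} \<or> (\<exists>U. open U \<and> ?P U \<and> A i \<subseteq> U)"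
      by (rule countable_borel_partition[OF countably_coverable_manifold, of E ?P]) (assumption, blast)
    let ?E = "\<lambda>i. E \<inter> A i"
    have Eb: "?E i \<in> sets borel" "?E i \<subseteq> C" "?E i \<subseteq> C'" for i using E A(1) by auto
    have dis: "disjoint_family ?E" using A(2) by (auto simp: disjoint_family_on_def)
    have EU: "(\<Union>i. ?E i) = E" using A(3) by blast
    have "ennreal ((1 - \<eta>)\<^sup>2) * ?X = ennreal ((1 - \<eta>)\<^sup>2) * (\<Sum>i. plaque_mass c (?E i))"
      unfolding piece_measure_partition[OF C(1) Eb(1,2) dis] EU ..
    also have "\<dots> = (\<Sum>i. ennreal ((1 - \<eta>)\<^sup>2) * plaque_mass c (?E i))"
      by (simp add: ennreal_suminf_cmult)
    also have "\<dots> \<le> (\<Sum>i. ennreal ((1 + \<eta>)\<^sup>2) * plaque_mass c' (?E i))"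
    proof (rule suminf_le)
      fix i
      show "ennreal ((1 - \<eta>)\<^sup>2) * plaque_mass c (?E i)
          \<le> ennreal ((1 + \<eta>)\<^sup>2) * plaque_mass c' (?E i)"
      proof (cases "A i = {}")
        case False
        then obtain U where U: "?P U" "A i \<subseteq> U" using A(4)[of i] by blast
        have "?E i \<subseteq> U" using U(2) by blast
        then show ?thesis
          using U(1) piece_image_borel[OF C(1) Eb(1,2)] piece_image_borel[OF C(2) Eb(1,3)] by blast
      qed simp
    qed auto
    also have "\<dots> = ennreal ((1 + \<eta>)\<^sup>2) * (\<Sum>i. plaque_mass c' (?E i))"
      by (simp add: ennreal_suminf_cmult)
    also have "\<dots> = ennreal ((1 + \<eta>)\<^sup>2) * ?Y"
      unfolding piece_measure_partition[OF C(2) Eb(1,3) dis] EU ..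
    finally show ?thesis .
  qed
  have fin: "?X < \<infinity>" "?Y < \<infinity>"
    by (rule piece_transverse_finite[OF C(1) E(1,2)], rule piece_transverse_finite[OF C(2) E(1,3)])
  obtain x where x: "?X = ennreal x" "x \<ge> 0" using fin(1) by (cases ?X) auto
  obtain y where y: "?Y = ennreal y" "y \<ge> 0" using fin(2) by (cases ?Y) auto
  \<comment> \<open>Both masses are finite, as \<open>E\<close> lies in compact pieces, so the limit
    can be taken in the reals.\<close>
  have real_le: "(1 - \<eta>)\<^sup>2 * x \<le> (1 + \<eta>)\<^sup>2 * y" if "0 < \<eta>" "\<eta> < 1" for \<eta>
  proof -
    have "ennreal ((1 - \<eta>)\<^sup>2 * x) \<le> ennreal ((1 + \<eta>)\<^sup>2 * y)"
      using le[OF that] by (simp add: x(1) y(1) ennreal_mult x(2) y(2))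
    then show ?thesis using y(2) by (simp add: ennreal_le_iff)
  qed
  have t1: "((\<lambda>\<eta>. (1 - \<eta>)\<^sup>2 * x) \<longlongrightarrow> (1 - 0)\<^sup>2 * x) (at_right 0)"
    by (intro tendsto_intros)
  have t2: "((\<lambda>\<eta>. (1 + \<eta>)\<^sup>2 * y) \<longlongrightarrow> (1 + 0)\<^sup>2 * y) (at_right 0)"
    by (intro tendsto_intros)
  have "eventually (\<lambda>\<eta>::real. (1 - \<eta>)\<^sup>2 * x \<le> (1 + \<eta>)\<^sup>2 * y) (at_right 0)"
    using eventually_at_right_real[of 0 1, OF zero_less_one] by (rule eventually_mono) (auto intro: real_le)
  then have "(1 - 0)\<^sup>2 * x \<le> (1 + 0)\<^sup>2 * y"
    by (rule tendsto_le[OF _ t2 t1, rotated]) simp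
  then show ?thesis by (simp add: x y ennreal_leI)
qed

lemma transverse_measure_eq:
  assumes "piece c C" "piece c' C'" "E \<in> sets borel" "E \<subseteq> C" "E \<subseteq> C'"
  shows "plaque_mass c E = plaque_mass c' E"
  using transverse_measure_le[OF assms] transverse_measure_le[OF assms(2,1,3,5,4)] by (rule antisym)

end

section \<open>The invariant measure\<close>

context directed_current
begin

lemma transversal_pieces:
  assumes \<Sigma>: "transversal k F \<Sigma>"
  obtains c :: "nat \<Rightarrow> ('a, 'n) chart" and C :: "nat \<Rightarrow> 'a set"
    where "\<And>i. piece (c i) (C i)" "(\<Union>i. C i) = \<Sigma>"
proof -
  let ?P = "\<lambda>U. \<exists>c C. piece c C \<and> C \<subseteq> \<Sigma> \<and> \<Sigma> \<inter> U \<subseteq> C"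
  have "\<exists>U. open U \<and> p \<in> U \<and> ?P U" if "p \<in> \<Sigma>" for p
  proof -
    obtain c where "c \<in> F" "p \<in> fst c" using box_cover by blast
    from transversal_piece[OF \<Sigma> that this] show ?thesis by blast
  qed
  then obtain U :: "nat \<Rightarrow> 'a set" where U: "\<And>i. open (U i)" "\<Sigma> \<subseteq> (\<Union>i. U i)" "\<And>i. U i = {} \<or> ?P (U i)"
    using countable_open_cover[OF countably_coverable_manifold, of \<Sigma> ?P] by metis
  have "\<exists>c C. piece c C \<and> C \<subseteq> \<Sigma> \<and> \<Sigma> \<inter> U i \<subseteq> C" for i
  proof (cases "U i = {}")
    case True
    obtain c where "c \<in> F" using box_cover by blast
    then have "piece c {}" by (simp add: piece_def)
    then show ?thesis using True by blast
  next
    case False then show ?thesis using U(3)[of i] by blast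
  qed
  then obtain c C where cC: "\<And>i. piece (c i) (C i) \<and> C i \<subseteq> \<Sigma> \<and> \<Sigma> \<inter> U i \<subseteq> C i" by metis
  show thesis
  proof (rule that[of c C])
    show "piece (c i) (C i)" for i using cC[of i] by (rule conjunct1)
    show "(\<Union>i. C i) = \<Sigma>"
    proof
      show "(\<Union>i. C i) \<subseteq> \<Sigma>"
      proof (rule UN_least)
        fix i show "C i \<subseteq> \<Sigma>" using cC[of i] by blast
      qed
      show "\<Sigma> \<subseteq> (\<Union>i. C i)"
      proof
        fix z assume z: "z \<in> \<Sigma>"
        then obtain i where "z \<in> U i" using U(2) by blast
        then have "z \<in> C i" using cC[of i] z by blast
        then show "z \<in> (\<Union>i. C i)" by blast
      qed
    qed
  qed
qed

lemma transversal_partition: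
  assumes \<Sigma>: "transversal k F \<Sigma>"
  obtains c :: "nat \<Rightarrow> ('a, 'n) chart" and C D :: "nat \<Rightarrow> 'a set"
    where "\<And>i. piece (c i) (C i)" "\<And>i. D i \<in> sets borel" "\<And>i. D i \<subseteq> C i"
      "disjoint_family D" "(\<Union>i. D i) = \<Sigma>"
proof -
  obtain c :: "nat \<Rightarrow> ('a, 'n) chart" and C where C: "\<And>i. piece (c i) (C i)" "(\<Union>i. C i) = \<Sigma>"
    by (rule transversal_pieces[OF \<Sigma>], rule that)
  have Cb: "C i \<in> sets borel" for i using C(1)[of i] by (auto simp: piece_def intro: borel_compact)
  show thesis
  proof (rule that[OF C(1)])
    show "disjointed C i \<in> sets borel" for i
      using Cb by (intro sets.range_disjointed_sets[of C borel, THEN subsetD]) auto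
    show "disjointed C i \<subseteq> C i" for i by (rule disjointed_subset)
    show "disjoint_family (disjointed C)" by (rule disjoint_family_disjointed)
    show "(\<Union>i. disjointed C i) = \<Sigma>" unfolding UN_disjointed_eq C(2) ..
  qed
qed

lemma transversal_borel:
  assumes "transversal k F \<Sigma>"
  shows "\<Sigma> \<in> sets borel"
proof -
  obtain c :: "nat \<Rightarrow> ('a, 'n) chart" and C D where "\<And>i. piece (c i) (C i)" and D: "\<And>i. D i \<in> sets borel"
    and "\<And>i. D i \<subseteq> C i" "disjoint_family D" and U: "(\<Union>i. D i) = \<Sigma>"
    by (rule transversal_partition[OF assms], rule that)
  have "(\<Union>i. D i) \<in> sets borel" using D by (intro sets.countable_UN) auto
  then show ?thesis using U by simp
qed

text \<open>The measure is described by all pieces in all boxes instead of a chosen partition, and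
  \<open>C\<close> may leave \<Sigma>. Any piece that happens to contain a set can thus be used to
  evaluate it.\<close>

definition transverse_compatible :: "'a set \<Rightarrow> 'a measure \<Rightarrow> bool" where
  "transverse_compatible \<Sigma> \<nu> \<longleftrightarrow> sets \<nu> = sets (restrict_space borel \<Sigma>) \<and>
     (\<forall>c C E. piece c C \<longrightarrow> E \<in> sets borel \<longrightarrow> E \<subseteq> C \<inter> \<Sigma> \<longrightarrow>
        emeasure \<nu> E = plaque_mass c E)"

lemma transverse_compatibleD:
  assumes "transverse_compatible \<Sigma> \<nu>"
  shows "sets \<nu> = sets (restrict_space borel \<Sigma>)"
    and "\<And>c C E. piece c C \<Longrightarrow> E \<in> sets borel \<Longrightarrow> E \<subseteq> C \<Longrightarrow> E \<subseteq> \<Sigma> \<Longrightarrow>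
        emeasure \<nu> E = plaque_mass c E"
  using assms unfolding transverse_compatible_def by auto

text \<open>The plaque masses of the parts of a countable partition into pieces are added up;
  \<open>transverse_measure_eq\<close> makes the result agree with every other piece.\<close>

lemma transverse_compatible_exists:
  assumes \<Sigma>: "transversal k F \<Sigma>"
  shows "\<exists>\<nu>. transverse_compatible \<Sigma> \<nu>"
proof -
  obtain c :: "nat \<Rightarrow> ('a, 'n) chart" and C D where C: "\<And>i. piece (c i) (C i)"
    and Db: "\<And>i. D i \<in> sets borel" and DC: "\<And>i. D i \<subseteq> C i"
    and Dd: "disjoint_family D" and DU: "(\<Union>i. D i) = \<Sigma>"
    by (rule transversal_partition[OF \<Sigma>], rule that)
  define R where "R = restrict_space borel \<Sigma>"
  have R: "sets R = {E. E \<in> sets borel \<and> E \<subseteq> \<Sigma>}"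
    unfolding R_def using transversal_borel[OF \<Sigma>] by (auto simp: sets_restrict_space_iff)
  \<comment> \<open>The series is written as an integral over the counting measure so that two
    infinite sums can be interchanged by \<open>nn_integral_suminf\<close>.\<close>
  define \<mu> where "\<mu> E = (\<integral>\<^sup>+i. plaque_mass (c i) (E \<inter> D i) \<partial>count_space (UNIV :: nat set))" for E
  define \<nu> where "\<nu> = measure_of (space R) (sets R) \<mu>"
  have sets: "sets \<nu> = sets R" unfolding \<nu>_def by (rule sets.sets_measure_of_eq)
  have em: "emeasure \<nu> E = \<mu> E" if "E \<in> sets R" for E
  proof (rule emeasure_measure_of[OF \<nu>_def])
    show "sets R \<subseteq> Pow (space R)" by (rule sets.space_closed)
    show "positive (sets \<nu>) \<mu>" by (simp add: positive_def \<mu>_def)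
    show "E \<in> sets \<nu>" using that sets by simp
    show "countably_additive (sets \<nu>) \<mu>"
      unfolding countably_additive_def
    proof (intro allI impI)
      fix A :: "nat \<Rightarrow> 'a set" assume A: "range A \<subseteq> sets \<nu>" "disjoint_family A" "(\<Union>i. A i) \<in> sets \<nu>"
      have Ab: "A i \<in> sets borel" for i using A(1) sets R by auto
      have "(\<Sum>n. \<mu> (A n)) = (\<integral>\<^sup>+i. (\<Sum>n. plaque_mass (c i) (A n \<inter> D i)) \<partial>count_space UNIV)"
        unfolding \<mu>_def by (rule nn_integral_suminf[symmetric]) simp
      also have "\<dots> = (\<integral>\<^sup>+i. plaque_mass (c i) (\<Union>n. A n \<inter> D i) \<partial>count_space UNIV)"
      proof (rule nn_integral_cong)
        fix i
        show "(\<Sum>n. plaque_mass (c i) (A n \<inter> D i))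
            = plaque_mass (c i) (\<Union>n. A n \<inter> D i)"
        proof (rule piece_measure_partition[OF C])
          show "A n \<inter> D i \<in> sets borel" "A n \<inter> D i \<subseteq> C i" for n using Ab Db DC[of i] by auto
          show "disjoint_family (\<lambda>n. A n \<inter> D i)" using A(2) unfolding disjoint_family_on_def by blast
        qed
      qed
      also have "\<dots> = \<mu> (\<Union>i. A i)" unfolding \<mu>_def by (simp only: UN_simps)
      finally show "(\<Sum>n. \<mu> (A n)) = \<mu> (\<Union>i. A i)" .
    qed
  qed
  have "transverse_compatible \<Sigma> \<nu>"
    unfolding transverse_compatible_def
  proof (intro conjI allI impI)
    show "sets \<nu> = sets (restrict_space borel \<Sigma>)" unfolding sets R_def ..
    fix c' C' E assume C': "piece c' C'" and E: "E \<in> sets borel" "E \<subseteq> C' \<inter> \<Sigma>"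
    have "emeasure \<nu> E = (\<Sum>i. plaque_mass (c i) (E \<inter> D i))"
      using em[of E] E R by (simp add: \<mu>_def nn_integral_count_space_nat)
    also have "\<dots> = (\<Sum>i. plaque_mass c' (E \<inter> D i))"
    proof (rule suminf_cong)
      fix i
      show "plaque_mass (c i) (E \<inter> D i) = plaque_mass c' (E \<inter> D i)"
        using E Db DC[of i] by (intro transverse_measure_eq[OF C C']) auto
    qed
    also have "\<dots> = plaque_mass c' (\<Union>i. E \<inter> D i)"
    proof (rule piece_measure_partition[OF C'])
      show "E \<inter> D i \<in> sets borel" "E \<inter> D i \<subseteq> C'" for i using E Db by auto
      show "disjoint_family (\<lambda>i. E \<inter> D i)" using Dd unfolding disjoint_family_on_def by blast
    qed
    also have "(\<Union>i. E \<inter> D i) = E" using E(2) DU by blast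
    finally show "emeasure \<nu> E = plaque_mass c' E" .
  qed
  then show ?thesis by blast
qed

text \<open>Finite Borel measures on a Euclidean space are inner regular, and compact sets of
  plaques pull back to compact subsets of the piece. Truncation to the image of \<open>C\<close>
  provides finiteness.\<close>

lemma piece_inner_regular:
  assumes C: "piece c C" and E: "E \<in> sets borel" "E \<subseteq> C"
  shows "plaque_mass c E
    \<le> (SUP K\<in>{K. compact K \<and> K \<subseteq> E}. plaque_mass c K)"
proof -
  let ?g = "inv_into C (plaque k c)" and ?Q = "plaque k c ` C"
  have inj: "inj_on (plaque k c) C" using C by (simp add: piece_def)
  have Cb: "C \<in> sets borel" using C by (auto simp: piece_def intro: borel_compact)
  have Q: "?Q \<in> sets borel" by (rule piece_image_borel[OF C Cb order_refl])
  define M' where "M' = density (transverse_measure c) (indicator ?Q)"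
  have sM': "sets M' = sets borel" by (simp add: M'_def sets_transverse_measure)
  have M': "emeasure M' Y = emeasure (transverse_measure c) (?Q \<inter> Y)" if "Y \<in> sets borel" for Y
    unfolding M'_def using that Q
    by (subst emeasure_density)
       (auto simp: sets_transverse_measure indicator_inter_arith[symmetric] intro!: borel_measurable_indicator)
  have fin: "emeasure M' (space M') \<noteq> \<infinity>"
    using piece_transverse_finite[OF C Cb order_refl] M'[of UNIV] sets_eq_imp_space_eq[OF sM'] by simp
  have "plaque_mass c E = emeasure M' (plaque k c ` E)"
    using M'[OF piece_image_borel[OF C E]] E(2) by (simp add: Int_absorb1 image_mono)
  also have "\<dots> = (SUP K\<in>{K. K \<subseteq> plaque k c ` E \<and> compact K}. emeasure M' K)"
    by (rule inner_regular[OF sM' fin piece_image_borel[OF C E]])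
  also have "\<dots> \<le> (SUP K\<in>{K. compact K \<and> K \<subseteq> E}. plaque_mass c K)"
  proof (rule SUP_least)
    fix K assume "K \<in> {K. K \<subseteq> plaque k c ` E \<and> compact K}"
    then have K: "K \<subseteq> plaque k c ` E" "compact K" by auto
    have KQ: "K \<subseteq> ?Q" using K(1) E(2) by blast
    have comp: "compact (?g ` K)"
      by (rule compact_continuous_image[OF continuous_on_subset[OF piece_inverse_continuous[OF C] KQ] K(2)])
    have sub: "?g ` K \<subseteq> E"
    proof
      fix z assume "z \<in> ?g ` K"
      then obtain e where "e \<in> E" "z = ?g (plaque k c e)" using K(1) by blast
      then show "z \<in> E" using E(2) inj by (auto simp: inv_into_f_f subset_iff)
    qed
    have img: "plaque k c ` ?g ` K = K"
      using KQ by (simp add: image_inv_into_cancel)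
    have "emeasure M' K = plaque_mass c (?g ` K)"
      unfolding img using M'[OF borel_compact[OF K(2)]] KQ by (simp add: Int_absorb1)
    also have "\<dots> \<le> (SUP K\<in>{K. compact K \<and> K \<subseteq> E}. plaque_mass c K)"
      by (rule SUP_upper) (use comp sub in simp)
    finally show "emeasure M' K \<le> (SUP K\<in>{K. compact K \<and> K \<subseteq> E}. plaque_mass c K)" .
  qed
  finally show ?thesis .
qed

text \<open>Finitely many pieces cover a neighbourhood, in the transversal, of a compact set and
  have finite mass. Inner regularity passes from the pieces to the possibly infinite whole through
  finite unions of compact sets.\<close>

lemma transverse_compatible_radon:
  assumes \<Sigma>: "transversal k F \<Sigma>" and \<nu>: "transverse_compatible \<Sigma> \<nu>"
  shows "radon_on \<Sigma> \<nu>"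
proof -
  note sets = transverse_compatibleD(1)[OF \<nu>] and val = transverse_compatibleD(2)[OF \<nu>]
  have sb: "E \<in> sets \<nu> \<longleftrightarrow> E \<in> sets borel \<and> E \<subseteq> \<Sigma>" for E
    unfolding sets using transversal_borel[OF \<Sigma>] by (auto simp: sets_restrict_space_iff)
  have fin: "emeasure \<nu> K < \<infinity>" if K: "compact K" "K \<subseteq> \<Sigma>" for K
  proof -
    have "\<exists>U. open U \<and> p \<in> U \<and> (\<exists>C. compact C \<and> C \<subseteq> \<Sigma> \<and> \<Sigma> \<inter> U \<subseteq> C \<and> emeasure \<nu> C < \<infinity>)" if "p \<in> K" for p
    proof -
      obtain c where c: "c \<in> F" "p \<in> fst c" using box_cover by blast
      have "p \<in> \<Sigma>" using that K by blast
      then obtain U C where UC: "open U" "p \<in> U" "piece c C" "C \<subseteq> \<Sigma>" "\<Sigma> \<inter> U \<subseteq> C"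
        using transversal_piece[OF \<Sigma> _ c] by blast
      have "compact C" using UC(3) by (simp add: piece_def)
      moreover have "emeasure \<nu> C < \<infinity>"
        using val[OF UC(3) borel_compact[OF \<open>compact C\<close>] order_refl UC(4)]
          piece_transverse_finite[OF UC(3) borel_compact[OF \<open>compact C\<close>] order_refl] by simp
      ultimately show ?thesis using UC by blast
    qed
    then obtain U C where UC: "\<And>p. p \<in> K \<Longrightarrow> open (U p) \<and> p \<in> U p \<and> compact (C p) \<and> C p \<subseteq> \<Sigma> \<and> \<Sigma> \<inter> U p \<subseteq> C p \<and> emeasure \<nu> (C p) < \<infinity>"
      by metis
    obtain D where D: "D \<subseteq> K" "finite D" "K \<subseteq> (\<Union>p\<in>D. U p)"
      by (rule compactE_image[OF K(1), of K U]) (use UC in auto)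
    have Cs: "C p \<in> sets \<nu>" if "p \<in> D" for p
      using UC[of p] that D(1) by (auto simp: sb intro: borel_compact)
    have "K \<subseteq> (\<Union>p\<in>D. C p)"
    proof
      fix z assume z: "z \<in> K"
      then obtain p where "p \<in> D" "z \<in> U p" using D(3) by blast
      then show "z \<in> (\<Union>p\<in>D. C p)" using UC[of p] D(1) K(2) z by blast
    qed
    then have "emeasure \<nu> K \<le> emeasure \<nu> (\<Union>p\<in>D. C p)"
      using Cs D(2) by (intro emeasure_mono) auto
    also have "\<dots> \<le> (\<Sum>p\<in>D. emeasure \<nu> (C p))"
      using Cs D(2) by (intro emeasure_subadditive_finite) auto
    also have "\<dots> < \<infinity>" using UC D by (simp add: subset_iff)
    finally show ?thesis .
  qed
  have inner: "emeasure \<nu> E = (SUP K\<in>{K. compact K \<and> K \<subseteq> E}. emeasure \<nu> K)" if E: "E \<in> sets \<nu>" for E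
  proof (rule antisym)
    let ?S = "\<lambda>E. SUP K\<in>{K. compact K \<and> K \<subseteq> E}. emeasure \<nu> K"
    have ne: "{K. compact K \<and> K \<subseteq> E} \<noteq> {}" for E :: "'a set" by blast
    have Eb: "E \<in> sets borel" "E \<subseteq> \<Sigma>" using E sb by auto
    show "?S E \<le> emeasure \<nu> E"
      by (intro SUP_least emeasure_mono E) auto
    obtain c :: "nat \<Rightarrow> ('a, 'n) chart" and C D where C: "\<And>i. piece (c i) (C i)"
      and Db: "\<And>i. D i \<in> sets borel" and DC: "\<And>i. D i \<subseteq> C i"
      and Dd: "disjoint_family D" and DU: "(\<Union>i. D i) = \<Sigma>"
      by (rule transversal_partition[OF \<Sigma>], rule that)
    have ED: "E \<inter> D i \<in> sets \<nu>" for i using Eb Db by (auto simp: sb)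
    have piece_le: "emeasure \<nu> (E \<inter> D i) \<le> ?S (E \<inter> D i)" for i
    proof -
      have s: "E \<inter> D i \<in> sets borel" "E \<inter> D i \<subseteq> C i" "E \<inter> D i \<subseteq> \<Sigma>" using Eb Db DC[of i] by auto
      have "emeasure \<nu> (E \<inter> D i) \<le> (SUP K\<in>{K. compact K \<and> K \<subseteq> E \<inter> D i}. plaque_mass (c i) K)"
        unfolding val[OF C s] by (rule piece_inner_regular[OF C s(1,2)])
      also have "\<dots> = ?S (E \<inter> D i)"
      proof (rule SUP_cong[OF refl])
        fix K assume "K \<in> {K. compact K \<and> K \<subseteq> E \<inter> D i}"
        then show "plaque_mass (c i) K = emeasure \<nu> K"
          using s by (intro val[OF C, symmetric]) (auto intro: borel_compact)
      qed
      finally show ?thesis .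
    qed
    \<comment> \<open>Compact sets approximating disjoint parts are disjoint and their union is
      compact, so the suprema add up.\<close>
    have fin_le: "(\<Sum>i<n. emeasure \<nu> (E \<inter> D i)) \<le> ?S (E \<inter> (\<Union>i<n. D i))" for n
    proof (induction n)
      case (Suc n)
      let ?A = "E \<inter> (\<Union>i<n. D i)" and ?B = "E \<inter> D n"
      have "(\<Sum>i<Suc n. emeasure \<nu> (E \<inter> D i)) \<le> ?S ?A + ?S ?B"
        using add_mono[OF Suc.IH piece_le[of n]] by simp
      also have "\<dots> = (SUP K\<in>{K. compact K \<and> K \<subseteq> ?A}. SUP L\<in>{L. compact L \<and> L \<subseteq> ?B}. emeasure \<nu> K + emeasure \<nu> L)"
      proof -
        have "?S ?A + ?S ?B = (SUP K\<in>{K. compact K \<and> K \<subseteq> ?A}. emeasure \<nu> K + ?S ?B)"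
          by (rule ennreal_SUP_add_left[OF ne, symmetric])
        then show ?thesis by (simp only: ennreal_SUP_add_right[OF ne])
      qed
      also have "\<dots> \<le> ?S (E \<inter> (\<Union>i<Suc n. D i))"
      proof (intro SUP_least)
        fix K L assume "K \<in> {K. compact K \<and> K \<subseteq> ?A}" "L \<in> {L. compact L \<and> L \<subseteq> ?B}"
        then have KL: "compact K" "K \<subseteq> ?A" "compact L" "L \<subseteq> ?B" by auto
        have "D i \<inter> D n = {}" if "i < n" for i using Dd that by (auto simp: disjoint_family_on_def)
        then have "K \<inter> L = {}" using KL by blast
        moreover have "K \<in> sets \<nu>" "L \<in> sets \<nu>" using KL Eb by (auto simp: sb intro: borel_compact)
        ultimately have "emeasure \<nu> K + emeasure \<nu> L = emeasure \<nu> (K \<union> L)" by (intro plus_emeasure)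
        also have "\<dots> \<le> ?S (E \<inter> (\<Union>i<Suc n. D i))"
        proof (rule SUP_upper)
          have "K \<union> L \<subseteq> E \<inter> (\<Union>i<Suc n. D i)" using KL by (auto simp: lessThan_Suc)
          then show "K \<union> L \<in> {K. compact K \<and> K \<subseteq> E \<inter> (\<Union>i<Suc n. D i)}" using KL by (auto intro: compact_Un)
        qed
        finally show "emeasure \<nu> K + emeasure \<nu> L \<le> ?S (E \<inter> (\<Union>i<Suc n. D i))" .
      qed
      finally show ?case .
    qed simp
    have "emeasure \<nu> E = (\<Sum>i. emeasure \<nu> (E \<inter> D i))"
    proof -
      have "(\<Sum>i. emeasure \<nu> (E \<inter> D i)) = emeasure \<nu> (\<Union>i. E \<inter> D i)"
      proof (rule suminf_emeasure)
        show "range (\<lambda>i. E \<inter> D i) \<subseteq> sets \<nu>" using ED by blast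
        show "disjoint_family (\<lambda>i. E \<inter> D i)" using Dd unfolding disjoint_family_on_def by blast
      qed
      moreover have "(\<Union>i. E \<inter> D i) = E" using Eb(2) DU by blast
      ultimately show ?thesis by simp
    qed
    also have "\<dots> \<le> ?S E"
    proof (rule suminf_le_const)
      fix n
      have "?S (E \<inter> (\<Union>i<n. D i)) \<le> ?S E" by (rule SUP_subset_mono) auto
      with fin_le[of n] show "(\<Sum>i<n. emeasure \<nu> (E \<inter> D i)) \<le> ?S E" by (rule order.trans)
    qed simp
    finally show "emeasure \<nu> E \<le> ?S E" .
  qed
  show ?thesis
    unfolding radon_on_def using sets fin inner by blast
qed

section \<open>Holonomy invariance\<close>

lemma holonomy_transversal: "holonomy k F B B' h \<Longrightarrow> transversal k F B \<and> transversal k F B'"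
  by (induction rule: holonomy.induct) auto

text \<open>A slide does not change the plaque in the box \<open>c\<close>, so a small set and its
  image have the same set of plaques there, and both measures evaluate to the same plaque
  mass.\<close>

lemma slide_invariant:
  assumes B: "transversal k F B" "transversal k F B'" and h: "homeomorphism B B' h g" and c: "c \<in> F"
    and sl: "\<And>x. x \<in> B \<Longrightarrow> x \<in> fst c \<and> h x \<in> fst c \<and> same_transverse k (snd c x) (snd c (h x))"
    and \<nu>: "transverse_compatible \<Sigma> \<nu>" "transverse_compatible \<Sigma>' \<nu>'"
    and sub: "E \<in> sets borel" "E \<subseteq> B" "E \<subseteq> \<Sigma>" "h ` E \<subseteq> \<Sigma>'"
    and tr: "transversal k F \<Sigma>" "transversal k F \<Sigma>'"
  shows "h ` E \<in> sets borel" "emeasure \<nu>' (h ` E) = emeasure \<nu> E"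
proof -
  have gh: "g (h x) = x" "h x \<in> B'" if "x \<in> B" for x
    using h that by (auto simp: homeomorphism_def)
  have injh: "inj_on h B" by (rule inj_on_inverseI[of _ g]) (rule gh)
  have pl: "plaque k c (h x) = plaque k c x" if "x \<in> B" for x
    using sl[OF that] by (simp add: plaque_def same_transverse_iff)
  have hb: "h ` Y \<in> sets borel" if Y: "Y \<in> sets borel" "Y \<subseteq> B" for Y
  proof -
    have B'b: "B' \<in> sets borel" by (rule transversal_borel[OF B(2)])
    have "continuous_on B' g" using h by (simp add: homeomorphism_def)
    then have "g \<in> borel_measurable (restrict_space borel B')" by (rule borel_measurable_continuous_on_restrict)
    from measurable_sets[OF this Y(1)] have "g -` Y \<inter> B' \<in> sets borel"
      using B'b by (simp add: space_restrict_space sets_restrict_space_iff)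
    moreover have "g -` Y \<inter> B' = h ` Y"
    proof
      show "g -` Y \<inter> B' \<subseteq> h ` Y"
      proof
        fix y assume "y \<in> g -` Y \<inter> B'"
        then have "h (g y) = y" "g y \<in> Y" using h by (auto simp: homeomorphism_def)
        then show "y \<in> h ` Y" by force
      qed
      show "h ` Y \<subseteq> g -` Y \<inter> B'" using Y(2) gh by auto
    qed
    ultimately show ?thesis by simp
  qed
  show "h ` E \<in> sets borel" by (rule hb[OF sub(1,2)])
  \<comment> \<open>Both the source and the target of the slide must be pieces in the same box
    \<open>c\<close>; \<open>transversal_piece\<close> is available for a prescribed box for this
    purpose.\<close>
  let ?P = "\<lambda>W. \<exists>C C'. piece c C \<and> piece c C' \<and> B \<inter> W \<subseteq> C \<and> h ` (B \<inter> W) \<subseteq> C'"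
  have "\<exists>W. open W \<and> p \<in> W \<and> ?P W" if p: "p \<in> E" for p
  proof -
    have pB: "p \<in> B" using p sub by blast
    obtain U C where U: "open U" "p \<in> U" "piece c C" "B \<inter> U \<subseteq> C"
      using transversal_piece[OF B(1) pB c] sl[OF pB] by blast
    obtain U' C' where U': "open U'" "h p \<in> U'" "piece c C'" "B' \<inter> U' \<subseteq> C'"
      using transversal_piece[OF B(2) gh(2)[OF pB] c] sl[OF pB] by blast
    have "continuous_on B h" using h by (simp add: homeomorphism_def)
    then obtain V where V: "open V" "V \<inter> B = h -` U' \<inter> B"
      using U'(1) unfolding continuous_on_open_invariant by metis
    have "?P (U \<inter> V)"
    proof (intro exI conjI)
      show "piece c C" "piece c C'" by fact+
      show "B \<inter> (U \<inter> V) \<subseteq> C" using U(4) by blast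
      show "h ` (B \<inter> (U \<inter> V)) \<subseteq> C'"
      proof
        fix y assume "y \<in> h ` (B \<inter> (U \<inter> V))"
        then obtain x where x: "y = h x" "x \<in> B" "x \<in> V" by blast
        then have "h x \<in> U'" using V(2) by blast
        then show "y \<in> C'" using x U'(4) gh(2)[OF x(2)] by blast
      qed
    qed
    moreover have "p \<in> U \<inter> V" using U V U' pB by blast
    moreover have "open (U \<inter> V)" using U V by blast
    ultimately show ?thesis by blast
  qed
  then obtain A where A: "\<And>i::nat. A i \<in> sets borel" "disjoint_family A" "E \<subseteq> (\<Union>i. A i)"
    "\<And>i. A i = {} \<or> (\<exists>U. open U \<and> ?P U \<and> A i \<subseteq> U)"
    by (rule countable_borel_partition[OF countably_coverable_manifold, of E ?P]) (assumption, blast)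
  let ?E = "\<lambda>i. E \<inter> A i"
  have Eb: "?E i \<in> sets borel" "?E i \<subseteq> B" for i using A(1) sub by auto
  have sb: "Y \<in> sets \<nu> \<longleftrightarrow> Y \<in> sets borel \<and> Y \<subseteq> \<Sigma>" for Y
    unfolding transverse_compatibleD(1)[OF \<nu>(1)] using transversal_borel[OF tr(1)] by (auto simp: sets_restrict_space_iff)
  have sb': "Y \<in> sets \<nu>' \<longleftrightarrow> Y \<in> sets borel \<and> Y \<subseteq> \<Sigma>'" for Y
    unfolding transverse_compatibleD(1)[OF \<nu>(2)] using transversal_borel[OF tr(2)] by (auto simp: sets_restrict_space_iff)
  have eq: "emeasure \<nu>' (h ` ?E i) = emeasure \<nu> (?E i)" for i
  proof (cases "A i = {}")
    case False
    then obtain W C C' where W: "A i \<subseteq> W" "piece c C" "piece c C'" "B \<inter> W \<subseteq> C" "h ` (B \<inter> W) \<subseteq> C'"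
      using A(4)[of i] by blast
    have s: "?E i \<subseteq> C" "h ` ?E i \<subseteq> C'" using W sub(2) by blast+
    have "emeasure \<nu>' (h ` ?E i) = emeasure (transverse_measure c) (plaque k c ` h ` ?E i)"
      using sub(4) by (intro transverse_compatibleD(2)[OF \<nu>(2) W(3) hb[OF Eb] s(2)]) blast
    also have "plaque k c ` h ` ?E i = plaque k c ` ?E i"
      unfolding image_image using pl sub(2) by (intro image_cong) auto
    also have "plaque_mass c (?E i) = emeasure \<nu> (?E i)"
      using sub(3) by (intro transverse_compatibleD(2)[OF \<nu>(1) W(2) Eb(1) s(1), symmetric]) blast
    finally show ?thesis .
  qed simp
  have EU: "(\<Union>i. ?E i) = E" using A(3) by blast
  have dis: "disjoint_family ?E" using A(2) unfolding disjoint_family_on_def by blast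
  have dish: "disjoint_family (\<lambda>i. h ` ?E i)"
    unfolding disjoint_family_on_def
  proof (intro ballI impI)
    fix i j :: nat assume "i \<noteq> j"
    then have "?E i \<inter> ?E j = {}" using dis unfolding disjoint_family_on_def by blast
    then show "h ` ?E i \<inter> h ` ?E j = {}"
      using inj_on_image_Int[OF injh Eb(2) Eb(2), of i j] by simp
  qed
  have "emeasure \<nu> E = (\<Sum>i. emeasure \<nu> (?E i))"
  proof -
    have "range ?E \<subseteq> sets \<nu>" using Eb sub(3) by (auto simp: sb)
    from suminf_emeasure[OF this dis] show ?thesis unfolding EU by (rule sym)
  qed
  also have "\<dots> = (\<Sum>i. emeasure \<nu>' (h ` ?E i))" by (simp only: eq)
  also have "\<dots> = emeasure \<nu>' (\<Union>i. h ` ?E i)"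
  proof (rule suminf_emeasure[OF _ dish])
    have "h ` ?E i \<in> sets \<nu>'" for i unfolding sb' using hb[OF Eb, of i] sub(4) by blast
    then show "range (\<lambda>i. h ` ?E i) \<subseteq> sets \<nu>'" by blast
  qed
  also have "(\<Union>i. h ` ?E i) = h ` E" unfolding image_UN[symmetric] EU ..
  finally show "emeasure \<nu>' (h ` E) = emeasure \<nu> E" ..
qed

text \<open>For a composition the intermediate transversal receives a compatible measure of its own,
  which is why the statement is for arbitrary compatible measures on arbitrary ambient
  transversals.\<close>

lemma holonomy_invariant:
  assumes hol: "holonomy k F B B' h"
    and "transversal k F \<Sigma>" "transversal k F \<Sigma>'"
    and "transverse_compatible \<Sigma> \<nu>" "transverse_compatible \<Sigma>' \<nu>'"
    and "E \<in> sets borel" "E \<subseteq> B" "B \<subseteq> \<Sigma>" "B' \<subseteq> \<Sigma>'"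
  shows "h ` E \<in> sets borel \<and> h ` E \<subseteq> B' \<and> emeasure \<nu>' (h ` E) = emeasure \<nu> E"
  using assms
proof (induction arbitrary: \<Sigma> \<Sigma>' \<nu> \<nu>' E rule: holonomy.induct)
  case (slide B B' h g c)
  have hB: "h ` E \<subseteq> B'" using slide.hyps(3) slide.prems(6) by (auto simp: homeomorphism_def)
  have "E \<subseteq> \<Sigma>" "h ` E \<subseteq> \<Sigma>'" using hB slide.prems(6-8) by auto
  from slide_invariant[OF slide.hyps(1-5) slide.prems(3-6) this slide.prems(1,2)] hB
  show ?case by blast
next
  case (comp B B' h B'' h')
  have B': "transversal k F B'" using holonomy_transversal[OF comp.hyps(1)] by blast
  obtain \<nu>1 where \<nu>1: "transverse_compatible B' \<nu>1" using transverse_compatible_exists[OF B'] by blast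
  have 1: "h ` E \<in> sets borel \<and> h ` E \<subseteq> B' \<and> emeasure \<nu>1 (h ` E) = emeasure \<nu> E"
    by (rule comp.IH(1)[OF comp.prems(1) B' comp.prems(3) \<nu>1 comp.prems(5,6,7) order_refl])
  have "h' ` (h ` E) \<in> sets borel \<and> h' ` (h ` E) \<subseteq> B'' \<and> emeasure \<nu>' (h' ` (h ` E)) = emeasure \<nu>1 (h ` E)"
    by (rule comp.IH(2)[OF B' comp.prems(2) \<nu>1 comp.prems(4)]) (use 1 comp.prems(8) in auto)
  with 1 show ?case by (simp add: image_comp)
qed

section \<open>Non-triviality\<close>

lemma transversal_section:
  assumes c: "c \<in> F"
  shows "transversal k F {z \<in> fst c. snd c z $ k = 0}"
  unfolding transversal_def
proof
  fix p assume p: "p \<in> {z \<in> fst c. snd c z $ k = 0}"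
  note cA = box_in_A[OF c]
  have bl: "bounded_linear (\<lambda>x::complex^'n. x $ k)" by (rule bounded_linear_vec_nth)
  have "(\<lambda>x::complex^'n. x $ k) = frechet_derivative (\<lambda>x. x $ k) (at x)" for x
    by (rule frechet_derivative_at[OF bounded_linear_imp_has_derivative[OF bl]])
  from fun_cong[OF this[symmetric]]
  have "frechet_derivative (\<lambda>x::complex^'n. x $ k) (at x) (axis k w) = w" for x w
    by (rule trans) (simp add: axis_def)
  moreover have "smooth_on (snd c ` fst c) (\<lambda>x::complex^'n. x $ k)"
    by (rule smooth_on_bounded_linear_id[OF chart_open(2)[OF cA] bl])
  ultimately show "\<exists>c'\<in>F. \<exists>V u. open V \<and> p \<in> V \<and> V \<subseteq> fst c' \<and>
        smooth_on (snd c' ` V) (u :: complex^'n \<Rightarrow> complex) \<and>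
        (\<forall>x\<in>snd c' ` V. \<forall>w. w \<noteq> 0 \<longrightarrow> frechet_derivative u (at x) (axis k w) \<noteq> 0) \<and>
        {z \<in> fst c. snd c z $ k = 0} \<inter> V = {q\<in>V. u (snd c' q) = 0}"
    using p chart_open(1)[OF cA] by (intro bexI[OF _ c] exI[of _ "fst c"] exI[of _ "\<lambda>x. x $ k"]) auto
qed

text \<open>Compact parts of the central slice of the box are pieces whose plaque map is the chart
  itself. If the slice were null, so would be the cylinders over these parts, and they exhaust the
  polydisc.\<close>

lemma transverse_compatible_nonzero:
  assumes c: "c \<in> F" "emeasure (chart_measure c) polydisc \<noteq> 0"
    and \<nu>: "transverse_compatible {z \<in> fst c. snd c z $ k = 0} \<nu>"
  shows "emeasure \<nu> {z \<in> fst c. snd c z $ k = 0} \<noteq> 0"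
proof
  let ?\<Sigma> = "{z \<in> fst c. snd c z $ k = 0}"
  assume zero: "emeasure \<nu> ?\<Sigma> = 0"
  note cA = box_in_A[OF c(1)]
  have \<Sigma>: "?\<Sigma> \<in> sets \<nu>"
    using transverse_compatibleD(1)[OF \<nu>] transversal_borel[OF transversal_section[OF c(1)]]
    by (simp add: sets_restrict_space_iff)
  \<comment> \<open>The double successor makes even the first radius positive (it is 1/2), as the
    tube formula requires.\<close>
  define \<rho> where "\<rho> n = 1 - 1 / real (Suc (Suc n))" for n
  define Q where "Q n = {x::complex^'n. \<forall>j. cmod (x $ j) \<le> \<rho> n} \<inter> {x. x $ k = 0}" for n
  have \<rho>: "0 < \<rho> n" "\<rho> n < 1" for n by (auto simp: \<rho>_def)
  have cl: "closed {x::complex^'n. x $ k = 0}" by (intro closed_Collect_eq continuous_intros)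
  have Qc: "compact (Q n)" for n
    unfolding Q_def by (rule compact_Int_closed[OF compact_closed_polydisc cl])
  have QD: "Q n \<subseteq> polydisc" for n
    using \<rho>(2)[of n] by (auto simp: Q_def polydisc_def intro: le_less_trans)
  have tQ: "transverse k x = x" if "x $ k = 0" for x :: "complex^'n"
    using that by (auto simp: vec_eq_iff)
  have tm: "emeasure (transverse_measure c) (Q n) = 0" for n
  proof -
    define C where "C = {z \<in> fst c. snd c z \<in> Q n}"
    have QI: "Q n \<subseteq> snd c ` fst c" using QD box_image[OF c(1)] by simp
    have Cc: "compact C" unfolding C_def by (rule chart_compact_preimage[OF cA Qc QI])
    have plC: "plaque k c z = snd c z" if "z \<in> C" for z
      using that tQ by (auto simp: C_def plaque_def Q_def)
    have "inj_on (plaque k c) C"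
      using chart_inj[OF cA] plC by (auto simp: inj_on_def C_def)
    then have pc: "piece c C" using c(1) Cc by (auto simp: piece_def C_def)
    have "plaque k c ` C = snd c ` C" by (rule image_cong[OF refl plC])
    also have "\<dots> = Q n" using QI by (auto simp: C_def)
    finally have img: "plaque k c ` C = Q n" .
    have C\<Sigma>: "C \<subseteq> ?\<Sigma>" by (auto simp: C_def Q_def)
    have "emeasure \<nu> C = emeasure (transverse_measure c) (Q n)"
      using transverse_compatibleD(2)[OF \<nu> pc borel_compact[OF Cc] order_refl C\<Sigma>] img by simp
    moreover have "emeasure \<nu> C \<le> emeasure \<nu> ?\<Sigma>" by (rule emeasure_mono[OF C\<Sigma> \<Sigma>])
    ultimately show ?thesis using zero by simp
  qed
  have cyl: "emeasure (chart_measure c) (cylinder k (ball 0 (\<rho> n)) (Q n)) = 0" for n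
    using cylinder_measure[OF chart_measure_derivative_null[OF c(1)] borel_compact[OF Qc] QD, of 0 "\<rho> n"] \<rho>[of n]
      tm[of n] emeasure_transverse_measure[OF borel_compact[OF Qc], of c n] by simp
  have cov: "polydisc \<subseteq> (\<Union>n. cylinder k (ball 0 (\<rho> n)) (Q n))"
  proof
    fix x :: "complex^'n" assume x: "x \<in> polydisc"
    define M where "M = Max (range (\<lambda>j. cmod (x $ j)))"
    have "M \<in> range (\<lambda>j. cmod (x $ j))" unfolding M_def by (rule Max_in) auto
    then have "M < 1" using x by (auto simp: polydisc_def)
    have M: "cmod (x $ j) \<le> M" for j unfolding M_def by (rule Max_ge) auto
    obtain n where n: "1 / real (Suc n) < 1 - M" using nat_approx_posE[of "1 - M"] \<open>M < 1\<close> by auto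
    have "1 / real (Suc (Suc n)) \<le> 1 / real (Suc n)" by (simp add: frac_le)
    then have "M < \<rho> n" using n by (simp add: \<rho>_def)
    then have "cmod (x $ j) < \<rho> n" for j using M[of j] by linarith
    then have "x \<in> cylinder k (ball 0 (\<rho> n)) (Q n)"
      using \<rho>[of n] by (auto simp: cylinder_def Q_def less_imp_le)
    then show "x \<in> (\<Union>n. cylinder k (ball 0 (\<rho> n)) (Q n))" by blast
  qed
  have sc: "sets (chart_measure c) = sets borel" by (simp add: chart_measure_def)
  have cb: "cylinder k (ball 0 (\<rho> n)) (Q n) \<in> sets borel" for n
    by (rule cylinder_borel[OF borel_open[OF open_ball] borel_compact[OF Qc]])
  have "emeasure (chart_measure c) polydisc \<le> emeasure (chart_measure c) (\<Union>n. cylinder k (ball 0 (\<rho> n)) (Q n))"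
    using cb by (intro emeasure_mono[OF cov] sets.countable_UN) (auto simp: sc)
  also have "\<dots> = 0"
    using cb by (intro emeasure_UN_eq_0 cyl) (auto simp: sc)
  finally show False using c(2) by simp
qed

theorem invariant_measure_exists:
  "\<exists>\<nu>. transversal_invariant_measure k F \<nu> \<and> (\<exists>\<Sigma>. transversal k F \<Sigma> \<and> emeasure (\<nu> \<Sigma>) \<Sigma> \<noteq> 0)"
proof -
  \<comment> \<open>On sets that are not transversals the choice is arbitrary; the conclusion does
    not speak of them.\<close>
  define \<nu> where "\<nu> \<Sigma> = (SOME \<mu>. transverse_compatible \<Sigma> \<mu>)" for \<Sigma>
  have \<nu>: "transverse_compatible \<Sigma> (\<nu> \<Sigma>)" if "transversal k F \<Sigma>" for \<Sigma>
    unfolding \<nu>_def by (rule someI_ex[OF transverse_compatible_exists[OF that]])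
  have "transversal_invariant_measure k F \<nu>"
    unfolding transversal_invariant_measure_def
  proof (intro conjI allI impI)
    fix \<Sigma> assume "transversal k F \<Sigma>"
    then show "radon_on \<Sigma> (\<nu> \<Sigma>)" by (intro transverse_compatible_radon \<nu>)
  next
    fix \<Sigma> \<Sigma>' B B' h E
    assume *: "transversal k F \<Sigma> \<and> transversal k F \<Sigma>' \<and>
        openin (top_of_set \<Sigma>) B \<and> openin (top_of_set \<Sigma>') B' \<and> holonomy k F B B' h \<and>
        E \<in> sets (\<nu> \<Sigma>) \<and> E \<subseteq> B"
    then have t: "transversal k F \<Sigma>" "transversal k F \<Sigma>'" by auto
    have "B \<subseteq> \<Sigma>" "B' \<subseteq> \<Sigma>'" using * openin_imp_subset by auto
    moreover have "E \<in> sets borel"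
      using * transverse_compatibleD(1)[OF \<nu>[OF t(1)]] transversal_borel[OF t(1)] by (simp add: sets_restrict_space_iff)
    ultimately show "emeasure (\<nu> \<Sigma>') (h ` E) = emeasure (\<nu> \<Sigma>) E"
      using holonomy_invariant[of B B' h \<Sigma> \<Sigma>' "\<nu> \<Sigma>" "\<nu> \<Sigma>'" E] * \<nu>[OF t(1)] \<nu>[OF t(2)] by blast
  qed
  moreover obtain c where "c \<in> F" "emeasure (chart_measure c) polydisc \<noteq> 0" using chart_measure_nonzero by blast
  then have "transversal k F {z \<in> fst c. snd c z $ k = 0} \<and> emeasure (\<nu> {z \<in> fst c. snd c z $ k = 0}) {z \<in> fst c. snd c z $ k = 0} \<noteq> 0"
    using transversal_section transverse_compatible_nonzero \<nu> by blast
  ultimately show ?thesis by blast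
qed

end

section \<open>From pluriexactness to a directed current that vanishes on closed test forms\<close>

lemma zero_form: "(\<lambda>z vs. 0) \<in> forms A p q"
proof -
  have "smooth_on S (\<lambda>x. 0 :: complex)" for S :: "(complex^'n::finite) set"
    by (rule smooth_on_subset[OF smooth_on_const[OF open_UNIV]]) simp
  then show ?thesis
    unfolding forms_def covectors_def form_in_def
    by (auto intro!: exI[of _ "\<lambda>I J. 0"])
qed

lemma (in pluriexact_foliation) directed_current_exists:
  obtains T M \<tau> \<xi> where "directed_current A k F T M \<tau> \<xi>"
proof -
  obtain T S where T: "\<exists>\<omega>\<in>forms A 1 1. T \<omega> \<noteq> 0" "directed A k F T" "S \<in> currents A 2 2"
    "\<And>\<omega>. \<omega> \<in> forms A 1 1 \<Longrightarrow> T \<omega> = S (ddc A \<omega>)"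
    using pluriexact unfolding pluriexact_def by blast
  obtain M :: "'a measure" and \<tau> :: "'a \<Rightarrow> ((complex^'n) list \<Rightarrow> complex) \<Rightarrow> complex" where M:
    "sets M = sets borel"
    "\<And>\<omega>. \<omega> \<in> forms A 1 1 \<Longrightarrow> integrable M (\<lambda>z. \<tau> z (\<omega> z)) \<and> T \<omega> = (LINT z|M. \<tau> z (\<omega> z))"
    "AE z in M. \<exists>v\<in>leaf_tangent A k F z. v \<noteq> 0 \<and> \<tau> z = bivector v"
    using T(2) unfolding directed_def by blast
  define \<xi> where "\<xi> z = (SOME v. v \<in> leaf_tangent A k F z \<and> v \<noteq> 0 \<and> \<tau> z = bivector v)" for z
  \<comment> \<open>A current is homogeneous only on forms, so the zero form has to be recognised as
    a form of bidegree (2,2) before the scalar 0 is applied.\<close>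
  have S0: "S (\<lambda>p vs. 0) = 0"
  proof -
    have "S (\<lambda>z vs. 0 * (0::complex)) = 0 * S (\<lambda>z vs. 0)"
      using T(3) zero_form[of A 2 2] unfolding currents_def mem_Collect_eq
      by (elim conjE allE[of _ 0]) (drule bspec, assumption, simp)
    then show ?thesis by simp
  qed
  have "directed_current A k F T M \<tau> \<xi>"
  proof (intro directed_current.intro directed_current_axioms.intro)
    show "pluriexact_foliation A k F" by (rule pluriexact_foliation_axioms)
    show "AE z in M. \<xi> z \<in> leaf_tangent A k F z \<and> \<xi> z \<noteq> 0 \<and> \<tau> z = bivector (\<xi> z)"
      using M(3)
    proof (rule AE_mp, intro AE_I2 impI)
      fix z assume "\<exists>v\<in>leaf_tangent A k F z. v \<noteq> 0 \<and> \<tau> z = bivector v"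
      then have "\<exists>v. v \<in> leaf_tangent A k F z \<and> v \<noteq> 0 \<and> \<tau> z = bivector v" by blast
      from someI_ex[OF this] show "\<xi> z \<in> leaf_tangent A k F z \<and> \<xi> z \<noteq> 0 \<and> \<tau> z = bivector (\<xi> z)"
        unfolding \<xi>_def .
    qed
    show "T \<omega> = 0" if "\<omega> \<in> forms A 1 1" "ddc A \<omega> = (\<lambda>p vs. 0)" for \<omega>
      using T(4)[OF that(1)] that(2) S0 by simp
    show "sets M = sets borel" "\<exists>\<omega>\<in>forms A 1 1. T \<omega> \<noteq> 0" by fact+
    show "integrable M (\<lambda>z. \<tau> z (\<omega> z))" "T \<omega> = (LINT z|M. \<tau> z (\<omega> z))" if "\<omega> \<in> forms A 1 1" for \<omega>
      using M(2)[OF that] by blast+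
  qed
  then show thesis by (rule that)
qed

theorem corollary3:
  fixes A F :: "('a::t2_space, 'n::finite) chart set" and k :: 'n
  assumes "compact (UNIV :: 'a set)"
    and "complex_structure A"
    and "foliation A k F"
    and "pluriexact A k F"
  shows "\<exists>\<nu>. transversal_invariant_measure k F \<nu> \<and>
           (\<exists>\<Sigma>. transversal k F \<Sigma> \<and> emeasure (\<nu> \<Sigma>) \<Sigma> \<noteq> 0)"
proof -
  interpret pluriexact_foliation A k F
    by (intro pluriexact_foliation.intro compact_complex_manifold.intro pluriexact_foliation_axioms.intro assms)
  obtain T M \<tau> \<xi> where "directed_current A k F T M \<tau> \<xi>" by (rule directed_current_exists)
  then interpret directed_current A k F T M \<tau> \<xi> .
  show ?thesis by (rule invariant_measure_exists)
qed

end
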